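(* Let $N=3$ and $g\in\mathrm{Reg}^+(\mathcal T)$. Then for all $U\in\mathring{\mathrm{Reg}}(\mathcal T)$ the distributional densitized Riemann curvature yields, after rescaling by the factor 4, $$\tfrac14\,\widetilde{\mathcal R\omega}(\mathbb A_gU)=\sum_{T\in\mathcal T}\int_T\langle\mathcal Q,U\rangle\,\omega_T-\sum_{F\in\mathring{\mathcal F}}\int_F\langle[\![\overline{\mathrm{I\!I}}]\!],U_F\rangle\,\omega_F+\sum_{E\in\mathring{\mathcal E}}\int_E\Theta_E\,U_{\tau\tau}\,\omega_E .$$ Moreover, for all $\sigma\in\mathrm{Reg}(\mathcal T)$ and $U\in\mathring{\mathrm{Reg}}(\mathcal T)$, $$a(g;\sigma,U)=-2\sum_{T}\int_T\mathcal Q:\sigma:U\,\omega_T-2\sum_{F\in\mathring{\mathcal F}}\int_F[\![\mathrm{I\!I}]\!]:\mathbb S_F(\sigma):\mathbb S_F(U)\,\omega_F-2\sum_{E\in\mathring{\mathcal E}}\int_E\Theta_E\,\sigma_{\tau\tau}\,U_{\tau\tau}\,\omega_E,$$ $$b(g;\sigma,U)=-2\sum_T\int_T\langle\mathrm{inc}\,\sigma,U\rangle\,\omega_T+2\sum_{F\in\mathring{\mathcal F}}\int_F\big\langle[\![((\mathrm{curl}\,\sigma)^T\times\nu)_F-\sigma_{\nu\nu}\overline{\mathrm{I\!I}}-\mathbb S_F\nabla(\nu\lrcorner\sigma)]\!],U_F\big\rangle\,\omega_F-2\sum_{E\in\mathring{\mathcal E}}\int_E\sum_{F\in\mathcal F_E}[\![\sigma_{\nu\mu}]\!]_F^E\,U_{\tau\tau}\,\omega_E,$$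 and $b(g;\sigma,U)=-2\,\widetilde{\mathrm{inc}\,\sigma}(U)$.
   Context: **Mesh and spaces.** $\Omega\subset\mathbb R^3$ is a bounded open domain with piecewise smooth boundary, subdivided into a finite triangulation $\mathcal T$ of (possibly curved) tetrahedra. $\mathring{\mathcal F}$ (resp. $\mathcal F_\partial$): facets not contained (resp. contained) in $\partial\Omega$; $\mathring{\mathcal E}$: edges not contained in $\partial\Omega$; $\mathcal F_E$: facets containing the edge $E$. "Smooth" on a cell means up to its boundary. $\mathfrak X(D)$: smooth vector fields tangent to $D$. $\mathrm{Reg}(\mathcal T)$: elementwise smooth symmetric covariant 2-tensor fields $\sigma$ that are $tt$-continuous, $\sigma|_{T_+}(X,Y)=\sigma|_{T_-}(X,Y)$ for $X,Y\in\mathfrak X(F)$, $F=T_+\cap T_-\in\mathring{\mathcal F}$; $\mathrm{Reg}^+(\mathcal T)$: those positive definite on each element; $\mathring{\mathrm{Reg}}(\mathcal T)$: those with $\sigma(X,Y)=0$ for $X,Y\in\mathfrak X(F)$, $F\in\mathcal F_\partial$. **Geometry of $g$.** $\nabla$: elementwise Levi-Civita connection; $(\nabla^2\sigma)(X,Y,\cdot,\cdot)=\nabla^2_{X,Y}\sigma$; $\mathcal R(X,Y,Z,W)=g(\nabla_X\nabla_YZ-\nabla_Y\nabla_XZ-\nabla_{[X,Y]}Z,W)$. $\langle\cdot,\cdot\rangle$: inner product of tensors by full contraction with $g$ (with $g_F=g|_F$ on facets). $\omega$: volume form; $\omega_T,\omega_F,\omega_E$: induced ones. $\nu=\nu_F^T$: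 $g|_T$-unit normal of $F$ pointing into $T$. $\mu=\mu_E^F$: $g$-unit vector tangent to $F$, orthogonal to $E$, pointing from $E$ into $F$. $\tau=\nu\times\mu$: unit tangent along $E$; $U_{\tau\tau}=U(\tau,\tau)$, $\sigma_{\nu\nu}=\sigma(\nu,\nu)$. $\mathrm{I\!I}^\nu(X,Y)=g|_T(\nu,\nabla_XY)$, $X,Y\in\mathfrak X(F)$. For a 2-tensor $V$: $V_F$ is its restriction to $\mathfrak X(F)$ and $\mathbb S_FV=V_F-\mathrm{tr}(V_F)g_F$; $\overline{\mathrm{I\!I}}^\nu=\mathbb S_F\mathrm{I\!I}^\nu$. For quantities depending oddly on $\nu$, $[\![B]\!]=B^{\nu_F^{T_+}}+B^{\nu_F^{T_-}}$. $\Theta_E=2\pi-\sum_{T\supset E}\arccos(g|_T(\mu_E^{F_+},\mu_E^{F_-}))$, $F_\pm$ the two facets of $T$ meeting in $E$. $[\![\sigma_{\nu\mu}]\!]_F^E=[\![\sigma_{\mu\nu}]\!]_F^E=\sigma|_{T_+}(\nu_F^{T_+},\mu_E^F)+\sigma|_{T_-}(\nu_F^{T_-},\mu_E^F)$. **3D operators.** $g(X\times Y,Z)=\omega(X,Y,Z)$. $(\mathrm{curl}\,\sigma)(X,Y\times Z)=(\nabla_Y\sigma)(X,Z)-(\nabla_Z\sigma)(X,Y)$; $V^T(X,Y)=V(Y,X)$; $\mathrm{inc}\,\sigma=\mathrm{curl}((\mathrm{curl}\,\sigma)^T)$; $(V\times u)(X,Y)=V(X,u\times Y)$. $(\nabla(\nu\lrcorner\sigma))(X,Y)=(\nabla_X(\sigma(\nu,\cdot)))(Y)$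 for $X,Y\in\mathfrak X(F)$. Triple product: $\rho:\sigma:\eta=\sum\rho(e_i,e_j)\sigma(e_k,e_j)\eta(e_k,e_i)$ in an orthonormal frame (of $T$ or of $F$). **Map $\mathbb A_g$.** $(\mathbb A_gU)(X,Y,Z,W)=-U(X\times Y,Z\times W)$ for symmetric 2-tensors $U$; it is a pointwise bijection onto the 4-tensors $A$ with $A(X,Y,Z,W)=-A(Y,X,Z,W)=-A(X,Y,W,Z)=A(Z,W,X,Y)$. $\mathcal Q=\mathbb A_g^{-1}\mathcal R$ (a symmetric 2-tensor on each element). **Functionals** (with $A=\mathbb A_gU$, $A_{F\nu\nu F}(X,Y)=A(X,\nu,\nu,Y)$ for $X,Y\in\mathfrak X(F)$, $A_{\mu\nu\nu\mu}=A(\mu,\nu,\nu,\mu)$): $$\widetilde{\mathcal R\omega}(A)=\sum_T\int_T\langle\mathcal R,A\rangle\omega_T+4\sum_{F\in\mathring{\mathcal F}}\int_F\langle[\![\mathrm{I\!I}]\!],A_{F\nu\nu F}\rangle\omega_F+4\sum_{E\in\mathring{\mathcal E}}\int_E\Theta_EA_{\mu\nu\nu\mu}\omega_E,$$ $$a(g;\sigma,U)=\sum_T\int_T\big(\langle L_\sigma^{(1)}\mathcal R,A\rangle-\tfrac12\mathrm{tr}(\sigma)\langle\mathcal R,A\rangle\big)\omega_T+2\sum_{F\in\mathring{\mathcal F}}\int_F[\![\mathrm{I\!I}]\!]:\mathbb S_F(\sigma):A_{F\nu\nu F}\,\omega_F-2\sum_{E\in\mathring{\mathcal E}}\int_E\mathrm{tr}(\sigma_E)\Theta_EA_{\mu\nu\nu\mu}\omega_E,$$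 $$b(g;\sigma,U)=2\sum_T\int_T\langle\nabla^2\sigma,SA\rangle\omega_T+2\sum_{F\in\mathring{\mathcal F}}\int_F\langle[\![\sigma_{\nu\nu}\mathrm{I\!I}+(\nabla\sigma)_{F\nu F}+(\nabla(\nu\lrcorner\sigma))_F-(\nabla\sigma)_{\nu FF}]\!],A_{F\nu\nu F}\rangle\omega_F-2\sum_{E\in\mathring{\mathcal E}}\int_E\sum_{F\in\mathcal F_E}[\![\sigma_{\mu\nu}]\!]_F^EA_{\mu\nu\nu\mu}\omega_E,$$ with $g(L_\sigma X,Y)=\sigma(X,Y)$, $(L_\sigma^{(1)}\mathcal R)(X,Y,Z,W)=\mathcal R(L_\sigma X,Y,Z,W)$, $\sigma_E$ the restriction to tangents of $E$, $(SA)(X,Y,Z,W)=A(X,Z,Y,W)$, and $(\nabla\sigma)_{F\nu F}(X,Y)=(\nabla_X\sigma)(\nu,Y)$, $(\nabla\sigma)_{\nu FF}(X,Y)=(\nabla_\nu\sigma)(X,Y)$, $(\nabla(\nu\lrcorner\sigma))_F$ the restriction of $\nabla(\nu\lrcorner\sigma)$, on $\mathfrak X(F)$. Finally $\widetilde{\mathrm{inc}\,\sigma}(U):=\widetilde{\mathrm{Inc}\,\sigma}(\mathbb A_gU)$, where, with $\mathrm{Inc}\,\sigma=-SP\nabla^2\sigma$ elementwise, $(PA)(X,Y,Z,W)=\frac14[A(X,Y,Z,W)-A(Z,Y,X,W)+A(Z,W,X,Y)-A(X,W,Z,Y)]$, $$\widetilde{\mathrm{Inc}\,\sigma}(A)=\sum_T\Big(\int_T\langle\mathrm{Inc}\,\sigma,A\rangle\omega_T-\int_{\partial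 T}\langle\sigma_{\nu\nu}\mathrm{I\!I}^\nu+(\nabla\sigma)_{F\nu F}+(\nabla(\nu\lrcorner\sigma))_F-(\nabla\sigma)_{\nu FF},A_{F\nu\nu F}\rangle\omega_{\partial T}\Big)-\sum_{E\in\mathring{\mathcal E}}\sum_{F\in\mathcal F_E}\int_E[\![\sigma_{\mu\nu}]\!]_F^EA_{\mu\nu\nu\mu}\omega_E .$$
   Formalization: The edge terms of b and of the distributional inc are printed with incompatible signs, so b = -2 inc fails as printed; it is proved with matching edge signs, correcting either one. The other identities, including the printed formula for b, are as stated. *)

theory Defs
  imports "HOL-Analysis.Analysis"
begin

section \<open>Smoothness\<close>

text \<open>For open \<^term>\<open>S\<close>; all iterated partial derivatives exist and are continuous.\<close>

primrec C_k_on :: "nat \<Rightarrow> 'a::euclidean_space set \<Rightarrow> ('a \<Rightarrow> 'b::real_normed_vector) \<Rightarrow> bool" where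
  "C_k_on 0 S f = continuous_on S f"
| "C_k_on (Suc k) S f = ((\<forall>x\<in>S. f differentiable (at x)) \<and>
      (\<forall>v. C_k_on k S (\<lambda>x. frechet_derivative f (at x) v)))"

definition smooth_on :: "'a::euclidean_space set \<Rightarrow> ('a \<Rightarrow> 'b::real_normed_vector) \<Rightarrow> bool" where
  "smooth_on S f \<longleftrightarrow> (\<forall>k. C_k_on k S f)"

definition smooth_upto :: "'a::euclidean_space set \<Rightarrow> ('a \<Rightarrow> 'b::real_normed_vector) \<Rightarrow> bool" where
  "smooth_upto D f \<longleftrightarrow>
    (\<exists>N h. open N \<and> D \<subseteq> N \<and> smooth_on N h \<and> (\<forall>x\<in>D. h x = f x))"

text \<open>On an element the derivative within the closed set is the derivative of any smooth
  extension. On a facet it is determined only on the tangent space of the facet, and is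
  only used there.\<close>

definition dD :: "(real^3) set \<Rightarrow> (real^3 \<Rightarrow> 'b::real_normed_vector) \<Rightarrow> real^3 \<Rightarrow> real^3 \<Rightarrow> 'b" where
  "dD D f x v = frechet_derivative f (at x within D) v"

section \<open>Tangent spaces of elements, facets and edges\<close>

text \<open>For an element, a facet or an edge the span of the one-sided tangent vectors is
  the full tangent space, also at points of the relative boundary.\<close>

definition tangent_cone :: "(real^3) set \<Rightarrow> real^3 \<Rightarrow> (real^3) set" where
  "tangent_cone D x = {v. \<exists>c::real \<Rightarrow> real^3. c 0 = x \<and> (\<forall>t\<in>{0..1}. c t \<in> D) \<and>
      (c has_vector_derivative v) (at 0 within {0..1})}"

definition tangent_space :: "(real^3) set \<Rightarrow> real^3 \<Rightarrow> (real^3) set" where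
  "tangent_space D x = span (tangent_cone D x)"

definition tangent_fields :: "(real^3) set \<Rightarrow> (real^3 \<Rightarrow> real^3) set" where
  "tangent_fields D = {X. smooth_upto D X \<and> (\<forall>x\<in>D. X x \<in> tangent_space D x)}"

section \<open>Curved tetrahedra and triangulations\<close>

definition ref_verts :: "(real^3) set" where
  "ref_verts = {0, axis 1 1, axis 2 1, axis 3 1}"

definition ref_tet :: "(real^3) set" where
  "ref_tet = convex hull ref_verts"

definition curved_tet :: "(real^3 \<Rightarrow> real^3) \<Rightarrow> (real^3) set \<Rightarrow> bool" where
  "curved_tet \<phi> T \<longleftrightarrow> T = \<phi> ` ref_tet \<and>
    (\<exists>N \<psi>. open N \<and> ref_tet \<subseteq> N \<and> smooth_on N \<phi> \<and>
       open (\<phi> ` N) \<and> smooth_on (\<phi> ` N) \<psi> \<and> (\<forall>p\<in>N. \<psi> (\<phi> p) = p))"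

record mesh =
  m_dom :: "(real^3) set"
  m_elems :: "(real^3) set set"
  m_chart :: "(real^3) set \<Rightarrow> real^3 \<Rightarrow> real^3"

text \<open>\<open>k\<close>-dimensional faces of an element: vertices, edges, facets for \<open>k = 0, 1, 2\<close>.\<close>

definition faces :: "mesh \<Rightarrow> nat \<Rightarrow> (real^3) set \<Rightarrow> (real^3) set set" where
  "faces M k T = {m_chart M T ` (convex hull V) |V. V \<subseteq> ref_verts \<and> card V = Suc k}"

definition facets :: "mesh \<Rightarrow> (real^3) set set" where
  "facets M = (\<Union>T\<in>m_elems M. faces M 2 T)"

definition edges :: "mesh \<Rightarrow> (real^3) set set" where
  "edges M = (\<Union>T\<in>m_elems M. faces M 1 T)"

definition int_facets :: "mesh \<Rightarrow> (real^3) set set" where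
  "int_facets M = {F \<in> facets M. \<not> F \<subseteq> frontier (m_dom M)}"

definition bd_facets :: "mesh \<Rightarrow> (real^3) set set" where
  "bd_facets M = {F \<in> facets M. F \<subseteq> frontier (m_dom M)}"

definition int_edges :: "mesh \<Rightarrow> (real^3) set set" where
  "int_edges M = {E \<in> edges M. \<not> E \<subseteq> frontier (m_dom M)}"

definition facet_elems :: "mesh \<Rightarrow> (real^3) set \<Rightarrow> (real^3) set set" where
  "facet_elems M F = {T \<in> m_elems M. F \<in> faces M 2 T}"

definition edge_facets :: "mesh \<Rightarrow> (real^3) set \<Rightarrow> (real^3) set set" where
  "edge_facets M E = {F \<in> facets M. E \<subseteq> F}"

text \<open>Conformity says that two different elements are disjoint or meet in a common face, and that
  a face of one element contained in another one is a face of both. The last two conditions hold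
  for every such subdivision: an interior facet has exactly two elements, and the elements
  around an interior edge are linked through facets containing that edge (so that
  the \<open>tt\<close>-component along the edge is single-valued). Piecewise smoothness of the boundary is
  expressed by its being the union of the (smooth) boundary facets.\<close>

definition triangulated_domain :: "mesh \<Rightarrow> bool" where
  "triangulated_domain M \<longleftrightarrow>
     open (m_dom M) \<and> connected (m_dom M) \<and> bounded (m_dom M) \<and> m_dom M \<noteq> {} \<and>
     finite (m_elems M) \<and> (\<forall>T\<in>m_elems M. curved_tet (m_chart M T) T) \<and>
     closure (m_dom M) = \<Union>(m_elems M) \<and>
     frontier (m_dom M) = \<Union>(bd_facets M) \<and>
     (\<forall>T\<in>m_elems M. \<forall>T'\<in>m_elems M. T \<noteq> T' \<longrightarrow>
        T \<inter> T' = {} \<or> (\<exists>k\<le>2. T \<inter> T' \<in> faces M k T \<inter> faces M k T')) \<and>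
     (\<forall>T\<in>m_elems M. \<forall>T'\<in>m_elems M. \<forall>k\<le>2. \<forall>G\<in>faces M k T. G \<subseteq> T' \<longrightarrow> G \<in> faces M k T') \<and>
     (\<forall>F\<in>int_facets M. card (facet_elems M F) = 2) \<and>
     (\<forall>E\<in>int_edges M. \<forall>T\<in>m_elems M. \<forall>T'\<in>m_elems M. E \<subseteq> T \<and> E \<subseteq> T' \<longrightarrow>
        (T, T') \<in> {(T1, T2). T1 \<in> m_elems M \<and> T2 \<in> m_elems M \<and>
            (\<exists>F \<in> faces M 2 T1 \<inter> faces M 2 T2. E \<subseteq> F)}\<^sup>*)"

section \<open>Regge spaces\<close>

type_synonym tensor2 = "real^3 \<Rightarrow> real^3 \<Rightarrow> real"
type_synonym tensor4 = "real^3 \<Rightarrow> real^3 \<Rightarrow> real^3 \<Rightarrow> real^3 \<Rightarrow> real"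

text \<open>An elementwise field assigns to each element \<open>T\<close> a field on \<open>T\<close>; only the values at points
  of \<open>T\<close> matter.\<close>

type_synonym pw2 = "(real^3) set \<Rightarrow> real^3 \<Rightarrow> tensor2"
type_synonym pw4 = "(real^3) set \<Rightarrow> real^3 \<Rightarrow> tensor4"

definition Reg :: "mesh \<Rightarrow> pw2 set" where
  "Reg M = {\<sigma>.
     (\<forall>T\<in>m_elems M.
        (\<forall>x\<in>T. bilinear (\<sigma> T x) \<and> (\<forall>X Y. \<sigma> T x X Y = \<sigma> T x Y X)) \<and>
        (\<forall>X Y. smooth_upto T (\<lambda>x. \<sigma> T x X Y))) \<and>
     (\<forall>F\<in>int_facets M. \<forall>T\<in>facet_elems M F. \<forall>T'\<in>facet_elems M F.
        \<forall>X\<in>tangent_fields F. \<forall>Y\<in>tangent_fields F. \<forall>x\<in>F.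
          \<sigma> T x (X x) (Y x) = \<sigma> T' x (X x) (Y x))}"

definition Reg_plus :: "mesh \<Rightarrow> pw2 set" where
  "Reg_plus M = {g \<in> Reg M. \<forall>T\<in>m_elems M. \<forall>x\<in>T. \<forall>X. X \<noteq> 0 \<longrightarrow> g T x X X > 0}"

definition Reg0 :: "mesh \<Rightarrow> pw2 set" where
  "Reg0 M = {\<sigma> \<in> Reg M. \<forall>F\<in>bd_facets M. \<forall>T\<in>facet_elems M F.
     \<forall>X\<in>tangent_fields F. \<forall>Y\<in>tangent_fields F. \<forall>x\<in>F. \<sigma> T x (X x) (Y x) = 0}"

section \<open>Orthonormal frames and contractions\<close>

text \<open>All contractions below are written in an orthonormal frame; they do not depend on the
  choice of the frame.\<close>

definition oframe :: "tensor2 \<Rightarrow> (real^3) set \<Rightarrow> 'n::finite \<Rightarrow> real^3" where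
  "oframe h V = (SOME e. (\<forall>i. e i \<in> V) \<and> (\<forall>i j. h (e i) (e j) = (if i = j then 1 else 0)))"

definition frameT :: "tensor2 \<Rightarrow> 3 \<Rightarrow> real^3" where
  "frameT h = oframe h UNIV"

definition frameF :: "tensor2 \<Rightarrow> (real^3) set \<Rightarrow> real^3 \<Rightarrow> 2 \<Rightarrow> real^3" where
  "frameF h F x = oframe h (tangent_space F x)"

definition frameE :: "tensor2 \<Rightarrow> (real^3) set \<Rightarrow> real^3 \<Rightarrow> 1 \<Rightarrow> real^3" where
  "frameE h E x = oframe h (tangent_space E x)"

definition tr2 :: "('n::finite \<Rightarrow> real^3) \<Rightarrow> tensor2 \<Rightarrow> real" where
  "tr2 e V = (\<Sum>i\<in>UNIV. V (e i) (e i))"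

definition ip2 :: "('n::finite \<Rightarrow> real^3) \<Rightarrow> tensor2 \<Rightarrow> tensor2 \<Rightarrow> real" where
  "ip2 e V W = (\<Sum>i\<in>UNIV. \<Sum>j\<in>UNIV. V (e i) (e j) * W (e i) (e j))"

definition ip4 :: "('n::finite \<Rightarrow> real^3) \<Rightarrow> tensor4 \<Rightarrow> tensor4 \<Rightarrow> real" where
  "ip4 e A B = (\<Sum>i\<in>UNIV. \<Sum>j\<in>UNIV. \<Sum>k\<in>UNIV. \<Sum>l\<in>UNIV.
      A (e i) (e j) (e k) (e l) * B (e i) (e j) (e k) (e l))"

definition triple :: "('n::finite \<Rightarrow> real^3) \<Rightarrow> tensor2 \<Rightarrow> tensor2 \<Rightarrow> tensor2 \<Rightarrow> real" where
  "triple e \<rho> \<sigma> \<eta> = (\<Sum>i\<in>UNIV. \<Sum>j\<in>UNIV. \<Sum>k\<in>UNIV.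
      \<rho> (e i) (e j) * \<sigma> (e k) (e j) * \<eta> (e k) (e i))"

definition SF :: "tensor2 \<Rightarrow> (real^3) set \<Rightarrow> real^3 \<Rightarrow> tensor2 \<Rightarrow> tensor2" where
  "SF h F x V = (\<lambda>X Y. V X Y - tr2 (frameF h F x) V * h X Y)"

section \<open>Levi-Civita connection and curvature of a metric field on an element\<close>

text \<open>\<open>christoffel T g x X Y\<close> is the value at \<open>x\<close> of \<open>\<nabla>\<^sub>X Y\<close> for constant \<open>X\<close> and \<open>Y\<close>
  (Koszul formula).\<close>

definition christoffel :: "(real^3) set \<Rightarrow> (real^3 \<Rightarrow> tensor2) \<Rightarrow> real^3 \<Rightarrow> real^3 \<Rightarrow> real^3 \<Rightarrow> real^3" where
  "christoffel T g x X Y = (THE v. \<forall>Z. g x v Z =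
     (dD T (\<lambda>y. g y Y Z) x X + dD T (\<lambda>y. g y X Z) x Y - dD T (\<lambda>y. g y X Y) x Z) / 2)"

text \<open>Covariant derivative at \<open>x\<close>, in the direction of the vector \<open>X\<close>, of a vector field \<open>Y\<close>
  given along \<open>D \<subseteq> T\<close>; here \<open>X\<close> has to be tangent to \<open>D\<close>.\<close>

definition cov_vec :: "(real^3) set \<Rightarrow> (real^3 \<Rightarrow> tensor2) \<Rightarrow> (real^3) set \<Rightarrow> real^3 \<Rightarrow> (real^3 \<Rightarrow> real^3) \<Rightarrow> real^3 \<Rightarrow> real^3" where
  "cov_vec T g D X Y x = dD D Y x X + christoffel T g x X (Y x)"

definition nabla_vec :: "(real^3) set \<Rightarrow> (real^3 \<Rightarrow> tensor2) \<Rightarrow> (real^3 \<Rightarrow> real^3) \<Rightarrow> (real^3 \<Rightarrow> real^3) \<Rightarrow> real^3 \<Rightarrow> real^3" where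
  "nabla_vec T g X Y = (\<lambda>x. cov_vec T g T (X x) Y x)"

definition lie_bracket :: "(real^3) set \<Rightarrow> (real^3 \<Rightarrow> real^3) \<Rightarrow> (real^3 \<Rightarrow> real^3) \<Rightarrow> real^3 \<Rightarrow> real^3" where
  "lie_bracket T X Y = (\<lambda>x. dD T Y x (X x) - dD T X x (Y x))"

definition curv_op :: "(real^3) set \<Rightarrow> (real^3 \<Rightarrow> tensor2) \<Rightarrow> (real^3 \<Rightarrow> real^3) \<Rightarrow> (real^3 \<Rightarrow> real^3) \<Rightarrow>
    (real^3 \<Rightarrow> real^3) \<Rightarrow> real^3 \<Rightarrow> real^3" where
  "curv_op T g X Y Z = (\<lambda>x. nabla_vec T g X (nabla_vec T g Y Z) x
      - nabla_vec T g Y (nabla_vec T g X Z) x - nabla_vec T g (lie_bracket T X Y) Z x)"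

text \<open>Being tensorial, the curvature at a point is evaluated on constant extensions.\<close>

definition riemann :: "(real^3) set \<Rightarrow> (real^3 \<Rightarrow> tensor2) \<Rightarrow> real^3 \<Rightarrow> tensor4" where
  "riemann T g x = (\<lambda>X Y Z W. g x (curv_op T g (\<lambda>_. X) (\<lambda>_. Y) (\<lambda>_. Z) x) W)"

text \<open>\<open>nab2 T g \<sigma> x X Y Z\<close> is \<open>(\<nabla>\<^sub>X\<sigma>)(Y,Z)\<close>, and \<open>nabnab2 T g \<sigma> x X Y Z W\<close> is
  \<open>(\<nabla>\<^sup>2\<^sub>X\<^sub>,\<^sub>Y \<sigma>)(Z,W)\<close>, with \<open>\<nabla>\<^sup>2\<^sub>X\<^sub>,\<^sub>Y = \<nabla>\<^sub>X\<nabla>\<^sub>Y - \<nabla>\<close> in direction \<open>\<nabla>\<^sub>X Y\<close>.\<close>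

definition nab2 :: "(real^3) set \<Rightarrow> (real^3 \<Rightarrow> tensor2) \<Rightarrow> (real^3 \<Rightarrow> tensor2) \<Rightarrow> real^3 \<Rightarrow>
    real^3 \<Rightarrow> real^3 \<Rightarrow> real^3 \<Rightarrow> real" where
  "nab2 T g \<sigma> x X Y Z = dD T (\<lambda>y. \<sigma> y Y Z) x X
     - \<sigma> x (christoffel T g x X Y) Z - \<sigma> x Y (christoffel T g x X Z)"

definition nabnab2 :: "(real^3) set \<Rightarrow> (real^3 \<Rightarrow> tensor2) \<Rightarrow> (real^3 \<Rightarrow> tensor2) \<Rightarrow> real^3 \<Rightarrow> tensor4" where
  "nabnab2 T g \<sigma> x = (\<lambda>X Y Z W. dD T (\<lambda>y. nab2 T g \<sigma> y Y Z W) x X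
     - nab2 T g \<sigma> x (christoffel T g x X Y) Z W
     - nab2 T g \<sigma> x Y (christoffel T g x X Z) W
     - nab2 T g \<sigma> x Y Z (christoffel T g x X W))"

section \<open>Three-dimensional operators\<close>

definition metric_det :: "tensor2 \<Rightarrow> real" where
  "metric_det h = det (\<chi> i j. h (axis i 1) (axis j 1) :: real^3^3)"

definition vol :: "tensor2 \<Rightarrow> real^3 \<Rightarrow> real^3 \<Rightarrow> real^3 \<Rightarrow> real" where
  "vol h X Y Z = sqrt (metric_det h) * det (vector [X, Y, Z] :: real^3^3)"

definition gcross :: "tensor2 \<Rightarrow> real^3 \<Rightarrow> real^3 \<Rightarrow> real^3" where
  "gcross h X Y = (THE v. \<forall>Z. h v Z = vol h X Y Z)"

definition curl :: "(real^3) set \<Rightarrow> (real^3 \<Rightarrow> tensor2) \<Rightarrow> (real^3 \<Rightarrow> tensor2) \<Rightarrow> real^3 \<Rightarrow> tensor2" where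
  "curl T g \<sigma> x = (THE C. bilinear C \<and>
     (\<forall>X Y Z. C X (gcross (g x) Y Z) = nab2 T g \<sigma> x Y X Z - nab2 T g \<sigma> x Z X Y))"

definition transp2 :: "tensor2 \<Rightarrow> tensor2" where
  "transp2 V = (\<lambda>X Y. V Y X)"

definition inc :: "(real^3) set \<Rightarrow> (real^3 \<Rightarrow> tensor2) \<Rightarrow> (real^3 \<Rightarrow> tensor2) \<Rightarrow> real^3 \<Rightarrow> tensor2" where
  "inc T g \<sigma> = curl T g (\<lambda>x. transp2 (curl T g \<sigma> x))"

definition tcross :: "tensor2 \<Rightarrow> tensor2 \<Rightarrow> real^3 \<Rightarrow> tensor2" where
  "tcross h V u = (\<lambda>X Y. V X (gcross h u Y))"

definition Aop :: "tensor2 \<Rightarrow> tensor2 \<Rightarrow> tensor4" where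
  "Aop h U = (\<lambda>X Y Z W. - U (gcross h X Y) (gcross h Z W))"

definition A_g :: "pw2 \<Rightarrow> pw2 \<Rightarrow> pw4" where
  "A_g g U = (\<lambda>T x. Aop (g T x) (U T x))"

definition Q_curv :: "(real^3) set \<Rightarrow> (real^3 \<Rightarrow> tensor2) \<Rightarrow> real^3 \<Rightarrow> tensor2" where
  "Q_curv T g x = (THE Q. bilinear Q \<and> (\<forall>X Y. Q X Y = Q Y X) \<and> Aop (g x) Q = riemann T g x)"

definition Lend :: "tensor2 \<Rightarrow> tensor2 \<Rightarrow> real^3 \<Rightarrow> real^3" where
  "Lend h \<sigma> X = (THE v. \<forall>Y. h v Y = \<sigma> X Y)"

definition Sop :: "tensor4 \<Rightarrow> tensor4" where
  "Sop A = (\<lambda>X Y Z W. A X Z Y W)"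

definition Pop :: "tensor4 \<Rightarrow> tensor4" where
  "Pop A = (\<lambda>X Y Z W. (A X Y Z W - A Z Y X W + A Z W X Y - A X W Z Y) / 4)"

definition Inc :: "(real^3) set \<Rightarrow> (real^3 \<Rightarrow> tensor2) \<Rightarrow> (real^3 \<Rightarrow> tensor2) \<Rightarrow> real^3 \<Rightarrow> tensor4" where
  "Inc T g \<sigma> x = (\<lambda>X Y Z W. - Sop (Pop (nabnab2 T g \<sigma> x)) X Y Z W)"

section \<open>Normals, conormals, second fundamental form, angle defect\<close>

text \<open>For \<open>D\<close> a facet of the element \<open>S\<close>, or an edge of the facet \<open>S\<close>: the unit vector
  tangent to \<open>S\<close>, orthogonal to \<open>D\<close>, and pointing into \<open>S\<close>. As \<open>D\<close> may be reached at a corner,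
  or at an obtuse angle, pointing into \<open>S\<close> is understood modulo vectors tangent to \<open>D\<close>.\<close>

definition inward_normal :: "tensor2 \<Rightarrow> (real^3) set \<Rightarrow> (real^3) set \<Rightarrow> real^3 \<Rightarrow> real^3" where
  "inward_normal h S D x = (THE n. n \<in> tangent_space S x \<and> h n n = 1 \<and>
     (\<forall>X\<in>tangent_space D x. h n X = 0) \<and>
     (\<exists>v\<in>tangent_cone S x. n - v \<in> tangent_space D x))"

text \<open>\<open>nrm\<close> is \<open>\<nu>\<close> on the facet \<open>F\<close> of \<open>T\<close>; \<open>conrm\<close> is \<open>\<mu>\<close> on the edge \<open>E\<close> of \<open>F\<close>.\<close>

definition nrm :: "pw2 \<Rightarrow> (real^3) set \<Rightarrow> (real^3) set \<Rightarrow> real^3 \<Rightarrow> real^3" where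
  "nrm g T F x = inward_normal (g T x) T F x"

definition conrm :: "pw2 \<Rightarrow> (real^3) set \<Rightarrow> (real^3) set \<Rightarrow> (real^3) set \<Rightarrow> real^3 \<Rightarrow> real^3" where
  "conrm g T F E x = inward_normal (g T x) F E x"

text \<open>\<open>g(\<nu>,\<nabla>\<^sub>X Y)\<close> with the vector \<open>Y\<close> extended to a field in \<open>\<XX>(F)\<close>; the value does not
  depend on the extension.\<close>

definition II :: "pw2 \<Rightarrow> (real^3) set \<Rightarrow> (real^3) set \<Rightarrow> real^3 \<Rightarrow> tensor2" where
  "II g T F x = (\<lambda>X Y. g T x (nrm g T F x)
     (cov_vec T (g T) F X (SOME Y'. Y' \<in> tangent_fields F \<and> Y' x = Y) x))"

definition IIbar :: "pw2 \<Rightarrow> (real^3) set \<Rightarrow> (real^3) set \<Rightarrow> real^3 \<Rightarrow> tensor2" where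
  "IIbar g T F x = SF (g T x) F x (II g T F x)"

text \<open>\<open>\<nabla>(\<nu>\<lrcorner>\<sigma>)\<close>: covariant derivative along \<open>F\<close> of the covector field \<open>\<sigma>(\<nu>,\<sqdot>)\<close>.\<close>

definition nab_nu :: "pw2 \<Rightarrow> (real^3) set \<Rightarrow> (real^3) set \<Rightarrow> pw2 \<Rightarrow> real^3 \<Rightarrow> tensor2" where
  "nab_nu g T F \<sigma> x = (\<lambda>X Y. dD F (\<lambda>y. \<sigma> T y (nrm g T F y) Y) x X
     - \<sigma> T x (nrm g T F x) (christoffel T (g T) x X Y))"

definition B_nu :: "pw2 \<Rightarrow> (real^3) set \<Rightarrow> (real^3) set \<Rightarrow> pw2 \<Rightarrow> real^3 \<Rightarrow> tensor2" where
  "B_nu g T F \<sigma> x = (let \<nu> = nrm g T F x in (\<lambda>X Y.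
      \<sigma> T x \<nu> \<nu> * II g T F x X Y
    + nab2 T (g T) (\<sigma> T) x X \<nu> Y
    + nab_nu g T F \<sigma> x X Y
    - nab2 T (g T) (\<sigma> T) x \<nu> X Y))"

definition A_FnnF :: "pw2 \<Rightarrow> (real^3) set \<Rightarrow> (real^3) set \<Rightarrow> pw4 \<Rightarrow> real^3 \<Rightarrow> tensor2" where
  "A_FnnF g T F A x = (\<lambda>X Y. A T x X (nrm g T F x) (nrm g T F x) Y)"

definition A_mnnm :: "pw2 \<Rightarrow> (real^3) set \<Rightarrow> (real^3) set \<Rightarrow> (real^3) set \<Rightarrow> pw4 \<Rightarrow> real^3 \<Rightarrow> real" where
  "A_mnnm g T F E A x =
     A T x (conrm g T F E x) (nrm g T F x) (nrm g T F x) (conrm g T F E x)"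

definition dihedral :: "mesh \<Rightarrow> pw2 \<Rightarrow> (real^3) set \<Rightarrow> (real^3) set \<Rightarrow> real^3 \<Rightarrow> real" where
  "dihedral M g T E x = (let (F, F') = (SOME (F, F'). F \<noteq> F' \<and> {F, F'} = {F \<in> faces M 2 T. E \<subseteq> F})
     in arccos (g T x (conrm g T F E x) (conrm g T F' E x)))"

definition Theta :: "mesh \<Rightarrow> pw2 \<Rightarrow> (real^3) set \<Rightarrow> real^3 \<Rightarrow> real" where
  "Theta M g E x = 2 * pi - (\<Sum>T\<in>{T \<in> m_elems M. E \<subseteq> T}. dihedral M g T E x)"

text \<open>Jump over a facet of quantities depending oddly on the normal: the sum over the (two)
  elements of an interior facet.\<close>

definition jump :: "mesh \<Rightarrow> (real^3) set \<Rightarrow> ((real^3) set \<Rightarrow> tensor2) \<Rightarrow> tensor2" where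
  "jump M F B = (\<lambda>X Y. \<Sum>T\<in>facet_elems M F. B T X Y)"

definition edge_jump :: "mesh \<Rightarrow> pw2 \<Rightarrow> pw2 \<Rightarrow> (real^3) set \<Rightarrow> (real^3) set \<Rightarrow> real^3 \<Rightarrow> real" where
  "edge_jump M g \<sigma> F E x =
     (\<Sum>T\<in>facet_elems M F. \<sigma> T x (nrm g T F x) (conrm g T F E x))"

text \<open>Quantities on \<open>F\<close> or \<open>E\<close> that are the same seen from all adjacent elements
  (such as \<open>g\<^sub>F\<close>, \<open>U\<^sub>F\<close>, and \<open>U(\<tau>,\<tau>)\<close> for \<open>U\<close> in the Regge space) are taken from an arbitrary one.\<close>

definition side :: "mesh \<Rightarrow> (real^3) set \<Rightarrow> (real^3) set" where
  "side M F = (SOME T. T \<in> facet_elems M F)"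

definition facet_at :: "mesh \<Rightarrow> (real^3) set \<Rightarrow> (real^3) set" where
  "facet_at M E = (SOME F. F \<in> edge_facets M E)"

definition side_E :: "mesh \<Rightarrow> (real^3) set \<Rightarrow> (real^3) set" where
  "side_E M E = side M (facet_at M E)"

definition gF_frame :: "mesh \<Rightarrow> pw2 \<Rightarrow> (real^3) set \<Rightarrow> real^3 \<Rightarrow> 2 \<Rightarrow> real^3" where
  "gF_frame M g F x = frameF (g (side M F) x) F x"

definition tau_comp :: "mesh \<Rightarrow> pw2 \<Rightarrow> pw2 \<Rightarrow> (real^3) set \<Rightarrow> real^3 \<Rightarrow> real" where
  "tau_comp M g U E x = (let T = side_E M E; F = facet_at M E;
      \<tau> = gcross (g T x) (nrm g T F x) (conrm g T F E x) in U T x \<tau> \<tau>)"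

section \<open>Integrals\<close>

definition elem_int :: "(real^3) set \<Rightarrow> (real^3 \<Rightarrow> tensor2) \<Rightarrow> (real^3 \<Rightarrow> real) \<Rightarrow> real" where
  "elem_int T h f = (LINT x:T|lborel. f x * sqrt (metric_det (h x)))"

text \<open>Facet and edge integrals are computed in an arbitrary regular parametrization; they do not
  depend on it.\<close>

definition ref_tri :: "(real^2) set" where
  "ref_tri = {p. 0 \<le> p $ 1 \<and> 0 \<le> p $ 2 \<and> p $ 1 + p $ 2 \<le> 1}"

definition regular_param :: "'a::euclidean_space set \<Rightarrow> (real^3) set \<Rightarrow> ('a \<Rightarrow> real^3) \<Rightarrow> bool" where
  "regular_param K D \<gamma> \<longleftrightarrow> \<gamma> ` K = D \<and> inj_on \<gamma> K \<and>
     (\<exists>N. open N \<and> K \<subseteq> N \<and> smooth_on N \<gamma>) \<and>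
     (\<forall>p\<in>K. inj (frechet_derivative \<gamma> (at p)))"

definition facet_param :: "(real^3) set \<Rightarrow> real^2 \<Rightarrow> real^3" where
  "facet_param F = (SOME \<gamma>. regular_param ref_tri F \<gamma>)"

definition edge_param :: "(real^3) set \<Rightarrow> real \<Rightarrow> real^3" where
  "edge_param E = (SOME \<gamma>. regular_param {0..1} E \<gamma>)"

definition facet_int :: "(real^3) set \<Rightarrow> (real^3 \<Rightarrow> tensor2) \<Rightarrow> (real^3 \<Rightarrow> real) \<Rightarrow> real" where
  "facet_int F h f = (let \<gamma> = facet_param F;
      d = (\<lambda>i p. frechet_derivative \<gamma> (at p) (axis i 1)) in
      LINT p:ref_tri|lborel. f (\<gamma> p) *
        sqrt (h (\<gamma> p) (d 1 p) (d 1 p) * h (\<gamma> p) (d 2 p) (d 2 p) - (h (\<gamma> p) (d 1 p) (d 2 p))\<^sup>2))"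

definition edge_int :: "(real^3) set \<Rightarrow> (real^3 \<Rightarrow> tensor2) \<Rightarrow> (real^3 \<Rightarrow> real) \<Rightarrow> real" where
  "edge_int E h f = (let \<gamma> = edge_param E;
      d = (\<lambda>t. frechet_derivative \<gamma> (at t) 1) in
      LINT t:{0..1}|lborel. f (\<gamma> t) * sqrt (h (\<gamma> t) (d t) (d t)))"

definition int_F :: "mesh \<Rightarrow> pw2 \<Rightarrow> (real^3) set \<Rightarrow> (real^3 \<Rightarrow> real) \<Rightarrow> real" where
  "int_F M g F f = facet_int F (g (side M F)) f"

definition int_E :: "mesh \<Rightarrow> pw2 \<Rightarrow> (real^3) set \<Rightarrow> (real^3 \<Rightarrow> real) \<Rightarrow> real" where
  "int_E M g E f = edge_int E (g (side_E M E)) f"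

section \<open>Functionals\<close>

definition Rw_dist :: "mesh \<Rightarrow> pw2 \<Rightarrow> pw4 \<Rightarrow> real" where
  "Rw_dist M g A =
     (\<Sum>T\<in>m_elems M. elem_int T (g T) (\<lambda>x. ip4 (frameT (g T x)) (riemann T (g T) x) (A T x)))
   + 4 * (\<Sum>F\<in>int_facets M. int_F M g F (\<lambda>x.
        ip2 (gF_frame M g F x) (jump M F (\<lambda>T. II g T F x)) (A_FnnF g (side M F) F A x)))
   + 4 * (\<Sum>E\<in>int_edges M. int_E M g E (\<lambda>x.
        Theta M g E x * A_mnnm g (side_E M E) (facet_at M E) E A x))"

definition a_form :: "mesh \<Rightarrow> pw2 \<Rightarrow> pw2 \<Rightarrow> pw2 \<Rightarrow> real" where
  "a_form M g \<sigma> U = (let A = A_g g U in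
     (\<Sum>T\<in>m_elems M. elem_int T (g T) (\<lambda>x.
        ip4 (frameT (g T x))
          (\<lambda>X Y Z W. riemann T (g T) x (Lend (g T x) (\<sigma> T x) X) Y Z W) (A T x)
        - 1/2 * tr2 (frameT (g T x)) (\<sigma> T x) *
            ip4 (frameT (g T x)) (riemann T (g T) x) (A T x)))
   + 2 * (\<Sum>F\<in>int_facets M. int_F M g F (\<lambda>x.
        triple (gF_frame M g F x) (jump M F (\<lambda>T. II g T F x))
          (SF (g (side M F) x) F x (\<sigma> (side M F) x)) (A_FnnF g (side M F) F A x)))
   - 2 * (\<Sum>E\<in>int_edges M. int_E M g E (\<lambda>x.
        tr2 (frameE (g (side_E M E) x) E x) (\<sigma> (side_E M E) x) * Theta M g E x *
          A_mnnm g (side_E M E) (facet_at M E) E A x)))"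

text \<open>The parameter \<open>\<epsilon>\<close>, with value \<open>1\<close> or \<open>-1\<close>, is the sign of the edge terms. In the literature \<open>b\<close>
  is given with edge coefficient \<open>-2\<close>, that is \<open>\<epsilon> = -1\<close>, and the distributional \<open>Inc\<close> with edge
  coefficient \<open>-1\<close>, that is \<open>\<epsilon> = 1\<close>. These two conventions are incompatible: \<open>b = -2 inc\<close> requires
  the same \<open>\<epsilon>\<close> on both sides.\<close>

definition b_form :: "real \<Rightarrow> mesh \<Rightarrow> pw2 \<Rightarrow> pw2 \<Rightarrow> pw2 \<Rightarrow> real" where
  "b_form \<epsilon> M g \<sigma> U = (let A = A_g g U in
     2 * (\<Sum>T\<in>m_elems M. elem_int T (g T) (\<lambda>x.
        ip4 (frameT (g T x)) (nabnab2 T (g T) (\<sigma> T) x) (Sop (A T x))))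
   + 2 * (\<Sum>F\<in>int_facets M. int_F M g F (\<lambda>x.
        ip2 (gF_frame M g F x) (jump M F (\<lambda>T. B_nu g T F \<sigma> x)) (A_FnnF g (side M F) F A x)))
   + \<epsilon> * 2 * (\<Sum>E\<in>int_edges M. int_E M g E (\<lambda>x.
        \<Sum>F\<in>edge_facets M E. edge_jump M g \<sigma> F E x * A_mnnm g (side M F) F E A x)))"

definition Inc_dist :: "real \<Rightarrow> mesh \<Rightarrow> pw2 \<Rightarrow> pw2 \<Rightarrow> pw4 \<Rightarrow> real" where
  "Inc_dist \<epsilon> M g \<sigma> A =
     (\<Sum>T\<in>m_elems M.
        elem_int T (g T) (\<lambda>x. ip4 (frameT (g T x)) (Inc T (g T) (\<sigma> T) x) (A T x))
      - (\<Sum>F\<in>faces M 2 T. facet_int F (g T) (\<lambda>x.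
           ip2 (frameF (g T x) F x) (B_nu g T F \<sigma> x) (A_FnnF g T F A x))))
   - \<epsilon> * (\<Sum>E\<in>int_edges M. \<Sum>F\<in>edge_facets M E. int_E M g E (\<lambda>x.
        edge_jump M g \<sigma> F E x * A_mnnm g (side M F) F E A x))"

definition inc_dist :: "real \<Rightarrow> mesh \<Rightarrow> pw2 \<Rightarrow> pw2 \<Rightarrow> pw2 \<Rightarrow> real" where
  "inc_dist \<epsilon> M g \<sigma> U = Inc_dist \<epsilon> M g \<sigma> (A_g g U)"

end

theory Submission
  imports Defs
begin

text \<open>
  Apart from \<open>b = -2 inc\<close>, the identities hold integrand by integrand. On an element, an orthonormal frame \<open>e\<^sub>i\<close> satisfies
  \<open>e\<^sub>i \<times> e\<^sub>j = \<plusminus> e\<^sub>k\<close>, so that contracting \<open>\<A>\<^sub>gU\<close> over all four slots counts each pair of axes twice in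
  each half: \<open>\<langle>\<A>\<^sub>gV,\<A>\<^sub>gU\<rangle> = 4\<langle>V,U\<rangle>\<close>. The existence of \<open>\<Q>\<close> is the symmetry of the Riemann tensor, and since
  the cross product is parallel, \<open>inc \<sigma>(V \<times> W, Y \<times> Z)\<close> is an alternating sum of second covariant
  derivatives of \<open>\<sigma>\<close>. On a facet, \<open>\<nu> \<times> \<cdot>\<close> is a rotation by a right angle, whence
  \<open>A\<^sub>F\<^sub>\<nu>\<^sub>\<nu>\<^sub>F = - \<S>\<^sub>F U\<close>, and \<open>\<S>\<^sub>F\<close> is self-adjoint. On an edge, \<open>A\<^sub>\<mu>\<^sub>\<nu>\<^sub>\<nu>\<^sub>\<mu> = U\<^sub>\<tau>\<^sub>\<tau>\<close>, which is
  single-valued by \<open>tt\<close>-continuity.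

  In \<open>b = -2 inc\<close>, splitting the jump over a facet into the two element boundaries requires
  integrability of each side. It holds because \<open>\<nu>\<close> and the conormals are obtained from the
  smooth tangent fields of the chart by the Gram-Schmidt process, and because differentiating
  \<open>g(\<nu>,Y) = 0\<close> expresses \<open>II\<close> through the derivative of \<open>\<nu>\<close> alone.
\<close>

subsection \<open>Calculus of smooth functions\<close>

text \<open>Most objects are fixed by choice operators (\<open>THE\<close>, \<open>SOME\<close>,
  \<open>frechet_derivative\<close> within a closed set), and fields are smooth only up to the
  boundary of each element. Two devices deal with this. A derivative within a set is determined on
  the span of its one-sided tangent vectors; for a curved tetrahedron this span is the whole space
  even at the vertices, so derivatives on an element obey the usual calculus, while along a facet
  only tangential ones may be compared. And vectors given by \<open>THE\<close>, such as Christoffel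
  symbols and cross products, are rewritten by Cramer's rule, from which their smooth dependence on
  the point is read off. Frames are chosen without regard to orientation, so cross products of frame
  vectors are known only up to a sign s = 1 or s = -1; it enters every contraction an even number of
  times. Normals and cross products depend on the full metric of one side. Whatever is compared
  across a facet or around an edge is therefore first reduced to values on common tangent vectors,
  where the metric is single-valued.\<close>

lemma C_k_on_has_derivative:
  "C_k_on (Suc k) S f \<Longrightarrow> x \<in> S \<Longrightarrow> (f has_derivative frechet_derivative f (at x)) (at x)"
  by (simp add: frechet_derivative_works)

lemma C_k_on_cong:
  assumes "open S" "\<And>x. x \<in> S \<Longrightarrow> f x = g x" "C_k_on k S f"
  shows "C_k_on k S g"
  using assms(2,3)
proof (induction k arbitrary: f g)
  case 0
  then show ?case by (simp cong: continuous_on_cong)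
next
  case (Suc k)
  have d: "(g has_derivative frechet_derivative f (at x)) (at x)" if "x \<in> S" for x
    by (rule has_derivative_transform_within_open[OF C_k_on_has_derivative[OF Suc.prems(2) that] assms(1) that])
       (rule Suc.prems(1))
  then have e: "frechet_derivative g (at x) = frechet_derivative f (at x)" if "x \<in> S" for x
    using that frechet_derivative_at by metis
  have "C_k_on k S (\<lambda>x. frechet_derivative g (at x) v)" for v
    by (rule Suc.IH[of "\<lambda>x. frechet_derivative f (at x) v"]) (use e Suc.prems(2) in auto)
  with d show ?case by (auto simp: differentiable_def)
qed

text \<open>Allows smoothness to be shown with any formula for the derivative in place of the chosen
  \<open>frechet_derivative\<close>.\<close>

lemma C_k_on_SucI:
  assumes "open S" "\<And>x. x \<in> S \<Longrightarrow> (f has_derivative f' x) (at x)" "\<And>v. C_k_on k S (\<lambda>x. f' x v)"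
  shows "C_k_on (Suc k) S f"
proof -
  have "f' x = frechet_derivative f (at x)" if "x \<in> S" for x
    using assms(2)[OF that] by (rule frechet_derivative_at)
  then have "C_k_on k S (\<lambda>x. frechet_derivative f (at x) v)" for v
    by (intro C_k_on_cong[OF assms(1) _ assms(3)[of v]]) simp
  with assms(2) show ?thesis by (auto simp: differentiable_def)
qed

lemma C_k_on_subset: "C_k_on k S f \<Longrightarrow> R \<subseteq> S \<Longrightarrow> C_k_on k R f"
  by (induction k arbitrary: f) (auto intro: continuous_on_subset)

lemma C_k_on_SucD: "C_k_on (Suc k) S f \<Longrightarrow> C_k_on k S f"
proof (induction k arbitrary: f)
  case 0
  then show ?case
    by (auto intro!: differentiable_imp_continuous_on differentiable_at_imp_differentiable_on)
next
  case (Suc k)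
  then show ?case by (metis C_k_on.simps(2))
qed

lemma C_k_on_const: "open S \<Longrightarrow> C_k_on k S (\<lambda>x. c)"
proof (induction k arbitrary: c)
  case (Suc k)
  then show ?case by (intro C_k_on_SucI[where f'="\<lambda>x h. 0"]) (auto intro: derivative_eq_intros)
qed simp

lemma C_k_on_add:
  "open S \<Longrightarrow> C_k_on k S f \<Longrightarrow> C_k_on k S g \<Longrightarrow> C_k_on k S (\<lambda>x. f x + g x)"
proof (induction k arbitrary: f g)
  case (Suc k)
  show ?case
    by (rule C_k_on_SucI[OF Suc.prems(1)])
       (rule has_derivative_add[OF Suc.prems(2)[THEN C_k_on_has_derivative] Suc.prems(3)[THEN C_k_on_has_derivative]],
        use Suc in auto)
qed (simp add: continuous_on_add)

lemma C_k_on_sum: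
  "open S \<Longrightarrow> (\<And>i. i \<in> I \<Longrightarrow> C_k_on k S (f i)) \<Longrightarrow> C_k_on k S (\<lambda>x. \<Sum>i\<in>I. f i x)"
  by (induction I rule: infinite_finite_induct) (auto intro: C_k_on_const C_k_on_add)

lemma C_k_on_bounded_linear:
  assumes "bounded_linear L"
  shows "open S \<Longrightarrow> C_k_on k S f \<Longrightarrow> C_k_on k S (\<lambda>x. L (f x))"
proof (induction k arbitrary: f)
  case 0
  then show ?case by (simp add: bounded_linear.continuous_on[OF assms])
next
  case (Suc k)
  show ?case
    by (rule C_k_on_SucI[OF Suc.prems(1)])
       (rule bounded_linear.has_derivative[OF assms Suc.prems(2)[THEN C_k_on_has_derivative]],
        use Suc in auto)
qed

lemma C_k_on_bilinear:
  assumes "bounded_bilinear P"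
  shows "open S \<Longrightarrow> C_k_on k S f \<Longrightarrow> C_k_on k S g \<Longrightarrow> C_k_on k S (\<lambda>x. P (f x) (g x))"
proof (induction k arbitrary: f g)
  case 0
  then show ?case by (simp add: bounded_bilinear.continuous_on[OF assms])
next
  case (Suc k)
  have "C_k_on k S f" "C_k_on k S g" using Suc.prems C_k_on_SucD by auto
  then have "C_k_on k S (\<lambda>x. P (f x) (frechet_derivative g (at x) v) + P (frechet_derivative f (at x) v) (g x))" for v
    using Suc.prems by (intro C_k_on_add Suc.IH) auto
  moreover have "((\<lambda>x. P (f x) (g x)) has_derivative (\<lambda>v. P (f x) (frechet_derivative g (at x) v) + P (frechet_derivative f (at x) v) (g x))) (at x)"
    if "x \<in> S" for x
    by (rule bounded_bilinear.FDERIV[OF assms Suc.prems(2)[THEN C_k_on_has_derivative] Suc.prems(3)[THEN C_k_on_has_derivative]]) (use that in auto)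
  ultimately show ?case
    by (intro C_k_on_SucI[OF Suc.prems(1)])
qed

lemmas C_k_on_mult = C_k_on_bilinear[OF bounded_bilinear_mult]
lemmas C_k_on_scaleR = C_k_on_bilinear[OF bounded_bilinear_scaleR]

lemma C_k_on_id: "open S \<Longrightarrow> C_k_on k S (\<lambda>x. x)"
  by (cases k) (auto intro!: C_k_on_SucI[where f'="\<lambda>x h. h"] C_k_on_const continuous_on_id)

text \<open>In the chain rule the outer derivative is applied to a vector that itself varies with x,
  whereas \<open>C_k_on\<close> controls derivatives in fixed directions only. Expanding that vector
  in the standard basis separates the two dependences.\<close>

lemma C_k_on_compose:
  fixes h :: "'a::euclidean_space \<Rightarrow> 'b::euclidean_space" and f :: "'b \<Rightarrow> 'c::real_normed_vector"
  assumes "open S" "open R" "h ` S \<subseteq> R"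
  shows "C_k_on k R f \<Longrightarrow> C_k_on k S h \<Longrightarrow> C_k_on k S (\<lambda>x. f (h x))"
proof (induction k arbitrary: f)
  case 0
  then show ?case using assms(3) by (auto intro: continuous_on_compose2)
next
  case (Suc k)
  have hk: "C_k_on k S h" using Suc.prems C_k_on_SucD by auto
  show ?case
  proof (rule C_k_on_SucI[OF assms(1)])
    fix x assume x: "x \<in> S"
    show "((\<lambda>x. f (h x)) has_derivative
       (\<lambda>v. \<Sum>b\<in>Basis. (frechet_derivative h (at x) v \<bullet> b) *\<^sub>R frechet_derivative f (at (h x)) b)) (at x)"
    proof -
      have hx: "h x \<in> R" using x assms(3) by auto
      have D: "((\<lambda>x. f (h x)) has_derivative (\<lambda>v. frechet_derivative f (at (h x)) (frechet_derivative h (at x) v))) (at x)"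
        by (rule has_derivative_compose[OF C_k_on_has_derivative[OF Suc.prems(2) x]
              C_k_on_has_derivative[OF Suc.prems(1) hx]])
      have "linear (frechet_derivative f (at (h x)))"
        using C_k_on_has_derivative[OF Suc.prems(1) hx] has_derivative_linear by blast
      then have "frechet_derivative f (at (h x)) w = (\<Sum>b\<in>Basis. (w \<bullet> b) *\<^sub>R frechet_derivative f (at (h x)) b)" for w
        by (subst (1) euclidean_representation[of w, symmetric]) (simp add: linear_sum linear_cmul)
      then show ?thesis by (intro has_derivative_eq_rhs[OF D] ext)
    qed
  next
    fix v
    have "C_k_on k S (\<lambda>x. (frechet_derivative h (at x) v \<bullet> b) *\<^sub>R frechet_derivative f (at (h x)) b)" for b
      by (intro C_k_on_scaleR assms(1) C_k_on_bounded_linear[OF bounded_linear_inner_left] Suc.IH hk)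
        (use Suc.prems in auto)
    then show "C_k_on k S (\<lambda>x. \<Sum>b\<in>Basis. (frechet_derivative h (at x) v \<bullet> b) *\<^sub>R frechet_derivative f (at (h x)) b)"
      by (intro C_k_on_sum assms(1))
  qed
qed

text \<open>The derivative is a polynomial in the inverse itself and the derivative of f, so order k
  of the inverse yields order k + 1. The square root below follows the same pattern.\<close>

lemma C_k_on_inverse:
  fixes f :: "'a::euclidean_space \<Rightarrow> real"
  assumes "open S" "\<And>x. x \<in> S \<Longrightarrow> f x \<noteq> 0"
  shows "C_k_on k S f \<Longrightarrow> C_k_on k S (\<lambda>x. inverse (f x))"
proof (induction k)
  case 0
  then show ?case using assms by (auto intro: continuous_on_inverse)
next
  case (Suc k)
  have ik: "C_k_on k S (\<lambda>x. inverse (f x))" using Suc C_k_on_SucD by blast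
  have "C_k_on k S (\<lambda>x. (-1) * (inverse (f x) * frechet_derivative f (at x) v * inverse (f x)))" for v
    using Suc.prems by (intro C_k_on_mult C_k_on_const assms(1) ik) auto
  moreover have "((\<lambda>x. inverse (f x)) has_derivative (\<lambda>v. (-1) * (inverse (f x) * frechet_derivative f (at x) v * inverse (f x)))) (at x)"
    if "x \<in> S" for x
    using Deriv.has_derivative_inverse[OF assms(2)[OF that] C_k_on_has_derivative[OF Suc.prems that]] by simp
  ultimately show ?case by (intro C_k_on_SucI[OF assms(1)])
qed

lemma C_k_on_sqrt:
  fixes f :: "'a::euclidean_space \<Rightarrow> real"
  assumes "open S" "\<And>x. x \<in> S \<Longrightarrow> f x > 0"
  shows "C_k_on k S f \<Longrightarrow> C_k_on k S (\<lambda>x. sqrt (f x))"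
proof (induction k)
  case 0
  then show ?case by (auto intro: continuous_on_real_sqrt)
next
  case (Suc k)
  have ik: "C_k_on k S (\<lambda>x. sqrt (f x))" using Suc C_k_on_SucD by blast
  have n: "sqrt (f x) \<noteq> 0" if "x \<in> S" for x using assms(2)[OF that] by auto
  show ?case
  proof (rule C_k_on_SucI[OF assms(1)])
    fix x assume x: "x \<in> S"
    show "((\<lambda>x. sqrt (f x)) has_derivative (\<lambda>v. frechet_derivative f (at x) v * (inverse (sqrt (f x)) * (1/2)))) (at x)"
      using has_derivative_real_sqrt[OF assms(2)[OF x] C_k_on_has_derivative[OF Suc.prems x]]
      by (simp add: field_simps)
  next
    fix v
    show "C_k_on k S (\<lambda>x. frechet_derivative f (at x) v * (inverse (sqrt (f x)) * (1/2)))"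
      using Suc.prems by (intro C_k_on_mult C_k_on_const assms(1) C_k_on_inverse n ik) auto
  qed
qed

text \<open>Schwarz's theorem, on which the pair symmetry of the curvature tensor will rest. The
  second difference over the parallelogram with sides s u and s v is symmetric in u and v, and
  divided by s^2 it tends to either of the two mixed derivatives.\<close>

lemma C_2_symmetric:
  fixes f :: "'a::euclidean_space \<Rightarrow> real"
  assumes S: "open S" and f: "C_k_on 2 S f" and x: "x \<in> S"
  shows "frechet_derivative (\<lambda>y. frechet_derivative f (at y) u) (at x) v
       = frechet_derivative (\<lambda>y. frechet_derivative f (at y) v) (at x) u"
proof -
  define D where "D u v y = frechet_derivative (\<lambda>y. frechet_derivative f (at y) u) (at y) v" for u v y
  define d where "d u y = frechet_derivative f (at y) u" for u y
  have f2: "C_k_on (Suc (Suc 0)) S f" using f by (simp add: numeral_2_eq_2)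
  have d0: "(f has_derivative (\<lambda>u. d u y)) (at y)" if "y \<in> S" for y
    using C_k_on_has_derivative[OF f2 that] unfolding d_def by simp
  have d1: "(d u has_derivative (\<lambda>v. D u v y)) (at y)" if "y \<in> S" for u y
    using C_k_on_has_derivative[of 0 S "d u" y] f2 that unfolding d_def D_def by auto
  have cD: "continuous_on S (D u v)" for u v
    using f2 unfolding D_def[abs_def] by auto
  have ds: "d (s *\<^sub>R w) y = s * d w y" if "y \<in> S" for s w y
    using linear_cmul[OF has_derivative_linear[OF d0[OF that]]] by simp
  have Ds: "D u (s *\<^sub>R w) y = s * D u w y" if "y \<in> S" for s u w y
    using linear_cmul[OF has_derivative_linear[OF d1[OF that]]] by simp
  obtain r where r: "r > 0" "ball x r \<subseteq> S" using S x openE by blast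
  \<comment> \<open>With this m one has m (|u| + |v|) = r - m < r, so the parallelogram stays in the
    ball; the summand 1 keeps the denominator positive and provides the slack.\<close>
  define m where "m = r / (1 + norm u + norm v)"
  have n0: "1 + norm u + norm v > 0" by (simp add: add_pos_nonneg)
  then have m: "m > 0" using r by (simp add: m_def)
  have inS: "x + a *\<^sub>R u + b *\<^sub>R v \<in> S" if "0 \<le> a" "0 \<le> b" "a < m" "b < m" for a b
  proof -
    have "norm (a *\<^sub>R u + b *\<^sub>R v) \<le> a * norm u + b * norm v"
      using that norm_triangle_ineq[of "a *\<^sub>R u" "b *\<^sub>R v"] by simp
    also have "\<dots> \<le> m * norm u + m * norm v" using that by (intro add_mono mult_right_mono) auto
    also have "\<dots> = m * (1 + norm u + norm v) - m" by (simp add: algebra_simps)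
    also have "\<dots> = r - m" using n0 by (simp add: m_def)
    also have "\<dots> < r" using m by simp
    finally have "norm (a *\<^sub>R u + b *\<^sub>R v) < r" .
    moreover have "x - (x + a *\<^sub>R u + b *\<^sub>R v) = - (a *\<^sub>R u + b *\<^sub>R v)" by (simp add: algebra_simps)
    ultimately have "x + a *\<^sub>R u + b *\<^sub>R v \<in> ball x r"
      by (metis mem_ball dist_norm norm_minus_cancel)
    then show ?thesis using r by auto
  qed
  \<comment> \<open>Apply the mean value theorem in both directions to the mixed second difference.\<close>
  have key: "\<exists>a b. 0 \<le> a \<and> a \<le> s \<and> 0 \<le> b \<and> b \<le> s \<and>
      f (x + s *\<^sub>R u + s *\<^sub>R v) - f (x + s *\<^sub>R u) - f (x + s *\<^sub>R v) + f x = s * s * D u v (x + a *\<^sub>R u + b *\<^sub>R v)"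
    if s: "0 < s" "s < m" and
      inS: "\<And>a b. 0 \<le> a \<Longrightarrow> 0 \<le> b \<Longrightarrow> a < m \<Longrightarrow> b < m \<Longrightarrow> x + a *\<^sub>R u + b *\<^sub>R v \<in> S" for s u v
  proof -
    have A: "((\<lambda>a. f (x + a *\<^sub>R u + b *\<^sub>R v)) has_derivative (\<lambda>h. h * d u (x + a *\<^sub>R u + b *\<^sub>R v))) (at a)"
      if "0 \<le> a" "0 \<le> b" "a < m" "b < m" for a b
    proof -
      have "((\<lambda>a. x + a *\<^sub>R u + b *\<^sub>R v) has_derivative (\<lambda>h. h *\<^sub>R u)) (at a)"
        by (auto intro!: derivative_eq_intros)
      from has_derivative_compose[OF this d0[OF inS[OF that]]]
      show ?thesis using ds[OF inS[OF that]] by simp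
    qed
    have B: "((\<lambda>b. d u (x + a *\<^sub>R u + b *\<^sub>R v)) has_derivative (\<lambda>h. h * D u v (x + a *\<^sub>R u + b *\<^sub>R v))) (at b)"
      if "0 \<le> a" "0 \<le> b" "a < m" "b < m" for a b
    proof -
      have "((\<lambda>b. x + a *\<^sub>R u + b *\<^sub>R v) has_derivative (\<lambda>h. h *\<^sub>R v)) (at b)"
        by (auto intro!: derivative_eq_intros)
      from has_derivative_compose[OF this d1[OF inS[OF that]]]
      show ?thesis using Ds[OF inS[OF that]] by simp
    qed
    \<comment> \<open>The second difference is p s - p 0. The summand with factor 0 is kept so that
      \<open>A\<close> applies to both terms.\<close>
    define p where "p a = f (x + a *\<^sub>R u + s *\<^sub>R v) - f (x + a *\<^sub>R u + 0 *\<^sub>R v)" for a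
    have p': "(p has_derivative (\<lambda>h. h * d u (x + a *\<^sub>R u + s *\<^sub>R v) - h * d u (x + a *\<^sub>R u + 0 *\<^sub>R v))) (at a)"
      if "0 \<le> a" "a \<le> s" for a
      unfolding p_def by (intro has_derivative_diff A) (use that s in auto)
    have "\<exists>a\<in>{0<..<s}. p s - p 0 = (s - 0) * d u (x + a *\<^sub>R u + s *\<^sub>R v) - (s - 0) * d u (x + a *\<^sub>R u + 0 *\<^sub>R v)"
      by (rule mvt_simple[OF s(1)]) (rule has_derivative_at_withinI[OF p'], auto)
    then obtain a where a: "0 < a" "a < s" and pa: "p s - p 0 = s * (d u (x + a *\<^sub>R u + s *\<^sub>R v) - d u (x + a *\<^sub>R u + 0 *\<^sub>R v))"
      by (auto simp: algebra_simps)
    have "\<exists>b\<in>{0<..<s}. d u (x + a *\<^sub>R u + s *\<^sub>R v) - d u (x + a *\<^sub>R u + 0 *\<^sub>R v) = (s - 0) * D u v (x + a *\<^sub>R u + b *\<^sub>R v)"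
      by (rule mvt_simple[OF s(1)]) (rule has_derivative_at_withinI[OF B], use a s in auto)
    then obtain b where b: "0 < b" "b < s" "p s - p 0 = s * s * D u v (x + a *\<^sub>R u + b *\<^sub>R v)"
      using pa by (auto simp: algebra_simps)
    show ?thesis
      by (rule exI[of _ a], rule exI[of _ b]) (use a b in \<open>auto simp: p_def algebra_simps\<close>)
  qed
  \<comment> \<open>The shift by 2 gives s n < m strictly already for n = 0.\<close>
  define s where "s n = m / real (n + 2)" for n :: nat
  have s: "0 < s n" "s n < m" for n using m by (auto simp: s_def divide_less_eq add_pos_nonneg)
  have s0: "s \<longlonglongrightarrow> 0" unfolding s_def
    by (rule LIMSEQ_ignore_initial_segment[OF lim_const_over_n])
  have lim: "\<exists>q. q \<longlonglongrightarrow> D u v x \<and> (\<forall>n. f (x + s n *\<^sub>R u + s n *\<^sub>R v) - f (x + s n *\<^sub>R u) - f (x + s n *\<^sub>R v) + f x = s n * s n * q n)"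
    if inS: "\<And>a b. 0 \<le> a \<Longrightarrow> 0 \<le> b \<Longrightarrow> a < m \<Longrightarrow> b < m \<Longrightarrow> x + a *\<^sub>R u + b *\<^sub>R v \<in> S" for u v
  proof -
    have "\<forall>n. \<exists>a b. 0 \<le> a \<and> a \<le> s n \<and> 0 \<le> b \<and> b \<le> s n \<and>
      f (x + s n *\<^sub>R u + s n *\<^sub>R v) - f (x + s n *\<^sub>R u) - f (x + s n *\<^sub>R v) + f x = s n * s n * D u v (x + a *\<^sub>R u + b *\<^sub>R v)"
      using key[OF s inS] by blast
    then obtain a b where ab: "\<And>n. 0 \<le> a n" "\<And>n. a n \<le> s n" "\<And>n. 0 \<le> b n" "\<And>n. b n \<le> s n"
      and eq: "\<And>n. f (x + s n *\<^sub>R u + s n *\<^sub>R v) - f (x + s n *\<^sub>R u) - f (x + s n *\<^sub>R v) + f x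
         = s n * s n * D u v (x + a n *\<^sub>R u + b n *\<^sub>R v)" by metis
    have a0: "a \<longlonglongrightarrow> 0" by (rule tendsto_sandwich[OF _ _ tendsto_const s0]) (use ab in auto)
    have b0: "b \<longlonglongrightarrow> 0" by (rule tendsto_sandwich[OF _ _ tendsto_const s0]) (use ab in auto)
    have "(\<lambda>n. x + a n *\<^sub>R u + b n *\<^sub>R v) \<longlonglongrightarrow> x + 0 *\<^sub>R u + 0 *\<^sub>R v"
      by (intro tendsto_intros a0 b0)
    moreover have "isCont (D u v) x" using continuous_on_eq_continuous_at[OF S, of "D u v"] cD x by blast
    ultimately have "(\<lambda>n. D u v (x + a n *\<^sub>R u + b n *\<^sub>R v)) \<longlonglongrightarrow> D u v x"
      by (intro isCont_tendsto_compose[of x "D u v"]) auto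
    with eq show ?thesis by blast
  qed
  obtain q1 where q1: "q1 \<longlonglongrightarrow> D u v x" "\<And>n. f (x + s n *\<^sub>R u + s n *\<^sub>R v) - f (x + s n *\<^sub>R u) - f (x + s n *\<^sub>R v) + f x = s n * s n * q1 n"
    using lim[OF inS] by blast
  have inS': "x + a *\<^sub>R v + b *\<^sub>R u \<in> S" if "0 \<le> a" "0 \<le> b" "a < m" "b < m" for a b
    using inS[of b a] that by (simp add: algebra_simps)
  obtain q2 where q2: "q2 \<longlonglongrightarrow> D v u x" "\<And>n. f (x + s n *\<^sub>R v + s n *\<^sub>R u) - f (x + s n *\<^sub>R v) - f (x + s n *\<^sub>R u) + f x = s n * s n * q2 n"
    using lim[OF inS'] by blast
  have "q1 = q2"
  proof
    fix n
    have "s n * s n * q1 n = s n * s n * q2 n"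
      using q1(2)[of n] q2(2)[of n] by (simp add: algebra_simps)
    then show "q1 n = q2 n" using s(1)[of n] by simp
  qed
  then have "D u v x = D v u x" using q1(1) q2(1) LIMSEQ_unique by blast
  then show ?thesis by (simp add: D_def)
qed

subsection \<open>Smoothness up to the boundary\<close>

lemma smooth_uptoI:
  "open N \<Longrightarrow> D \<subseteq> N \<Longrightarrow> smooth_on N h \<Longrightarrow> (\<And>x. x \<in> D \<Longrightarrow> h x = f x) \<Longrightarrow> smooth_upto D f"
  unfolding smooth_upto_def by blast

lemma smooth_upto_cong:
  "(\<And>x. x \<in> D \<Longrightarrow> f x = f' x) \<Longrightarrow> smooth_upto D f \<Longrightarrow> smooth_upto D f'"
  unfolding smooth_upto_def by metis

lemma smooth_upto_subset: "smooth_upto D f \<Longrightarrow> D' \<subseteq> D \<Longrightarrow> smooth_upto D' f"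
  unfolding smooth_upto_def by blast

lemma smooth_on_subset: "smooth_on N f \<Longrightarrow> N' \<subseteq> N \<Longrightarrow> smooth_on N' f"
  unfolding smooth_on_def using C_k_on_subset by blast

lemma smooth_upto_const: "smooth_upto D (\<lambda>x. c)"
  by (rule smooth_uptoI[OF open_UNIV]) (auto simp: smooth_on_def C_k_on_const)

text \<open>The two extensions live on different neighbourhoods; the rule for P is assumed on every
  open set so that it can be applied on their intersection.\<close>

lemma smooth_upto_binary:
  fixes D :: "'a::euclidean_space set"
  assumes "\<And>k (S :: 'a set) f g. open S \<Longrightarrow> C_k_on k S f \<Longrightarrow> C_k_on k S g \<Longrightarrow> C_k_on k S (\<lambda>x. P (f x) (g x))"
    and "smooth_upto D f" "smooth_upto D g"
  shows "smooth_upto D (\<lambda>x. P (f x) (g x))"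
proof -
  obtain N h where N: "open N" "D \<subseteq> N" "smooth_on N h" "\<forall>x\<in>D. h x = f x" using assms(2) unfolding smooth_upto_def by (elim exE conjE)
  obtain N' h' where N': "open N'" "D \<subseteq> N'" "smooth_on N' h'" "\<forall>x\<in>D. h' x = g x" using assms(3) unfolding smooth_upto_def by (elim exE conjE)
  have "smooth_on (N \<inter> N') (\<lambda>x. P (h x) (h' x))"
    unfolding smooth_on_def
  proof
    fix k
    have "C_k_on k (N \<inter> N') h" "C_k_on k (N \<inter> N') h'"
      using smooth_on_subset[OF N(3), of "N \<inter> N'"] smooth_on_subset[OF N'(3), of "N \<inter> N'"]
      unfolding smooth_on_def by auto
    then show "C_k_on k (N \<inter> N') (\<lambda>x. P (h x) (h' x))" by (rule assms(1)[OF open_Int[OF N(1) N'(1)]])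
  qed
  then show ?thesis by (rule smooth_uptoI[rotated 2]) (use N N' in auto)
qed

lemma smooth_upto_add:
  assumes "smooth_upto D f" "smooth_upto D g"
  shows "smooth_upto D (\<lambda>x. f x + g x)"
  by (rule smooth_upto_binary[where P=plus, OF _ assms]) (rule C_k_on_add)

lemma smooth_upto_mult:
  fixes f g :: "_ \<Rightarrow> _::real_normed_algebra"
  assumes "smooth_upto D f" "smooth_upto D g"
  shows "smooth_upto D (\<lambda>x. f x * g x)"
  by (rule smooth_upto_binary[where P=times, OF _ assms]) (rule C_k_on_mult)

lemma smooth_upto_scaleR:
  assumes "smooth_upto D f" "smooth_upto D g"
  shows "smooth_upto D (\<lambda>x. f x *\<^sub>R g x)"
  by (rule smooth_upto_binary[where P=scaleR, OF _ assms]) (rule C_k_on_scaleR)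

lemma smooth_upto_bounded_linear:
  assumes "bounded_linear L" "smooth_upto D f"
  shows "smooth_upto D (\<lambda>x. L (f x))"
  by (rule smooth_upto_binary[where P="\<lambda>a b. L a", OF _ assms(2,2)]) (rule C_k_on_bounded_linear[OF assms(1)])

lemma smooth_upto_diff:
  assumes "smooth_upto D f" "smooth_upto D g"
  shows "smooth_upto D (\<lambda>x. f x - g x)"
  using smooth_upto_add[OF assms(1) smooth_upto_bounded_linear[OF bounded_linear_minus[OF bounded_linear_ident] assms(2)]]
  by simp

lemma smooth_upto_minus:
  assumes "smooth_upto D f" shows "smooth_upto D (\<lambda>x. - f x)"
  using smooth_upto_diff[OF smooth_upto_const assms, of 0] by simp

lemma smooth_upto_sum:
  "(\<And>i. i \<in> I \<Longrightarrow> smooth_upto D (f i)) \<Longrightarrow> smooth_upto D (\<lambda>x. \<Sum>i\<in>I. f i x)"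
  by (induction I rule: infinite_finite_induct) (auto intro: smooth_upto_const smooth_upto_add)

lemma smooth_upto_nth: 
  "smooth_upto D f \<Longrightarrow> smooth_upto D (\<lambda>x. (f x :: real^'n) $ i)"
  by (rule smooth_upto_bounded_linear[OF bounded_linear_vec_nth])

lemma smooth_upto_vec:
  fixes f :: "'a::euclidean_space \<Rightarrow> real^'n"
  assumes "\<And>i. smooth_upto D (\<lambda>x. f x $ i)"
  shows "smooth_upto D f"
proof -
  have "smooth_upto D (\<lambda>x. \<Sum>i\<in>UNIV. f x $ i *\<^sub>R axis i 1)"
    by (intro smooth_upto_sum smooth_upto_scaleR assms smooth_upto_const)
  then show ?thesis
    by (rule smooth_upto_cong[rotated]) (simp add: vec_eq_iff sum_component axis_def if_distrib cong: if_cong)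
qed

text \<open>Away from D the extension may leave the region R where P is smooth. The neighbourhood is
  shrunk to the preimage of R, which is open and still contains D.\<close>

lemma smooth_upto_unary:
  fixes f :: "'a::euclidean_space \<Rightarrow> real"
  assumes P: "\<And>k (S :: 'a set) f. open S \<Longrightarrow> (\<And>x. x \<in> S \<Longrightarrow> f x \<in> R) \<Longrightarrow> C_k_on k S f \<Longrightarrow> C_k_on k S (\<lambda>x. P (f x))"
    and R: "open R" and f: "smooth_upto D f" "\<And>x. x \<in> D \<Longrightarrow> f x \<in> R"
  shows "smooth_upto D (\<lambda>x. P (f x))"
proof -
  obtain N h where N: "open N" "D \<subseteq> N" "smooth_on N h" "\<forall>x\<in>D. h x = f x"
    using f unfolding smooth_upto_def by blast
  define N' where "N' = N \<inter> h -` R"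
  have "continuous_on N h" using N(3) C_k_on.simps(1) unfolding smooth_on_def by metis
  then have "open N'" unfolding N'_def using N(1) R by (intro continuous_open_preimage)
  moreover have "smooth_on N' (\<lambda>x. P (h x))"
    unfolding smooth_on_def
  proof
    fix k
    have "C_k_on k N' h" using smooth_on_subset[OF N(3), of N'] by (auto simp: N'_def smooth_on_def)
    then show "C_k_on k N' (\<lambda>x. P (h x))" using \<open>open N'\<close> by (intro P) (auto simp: N'_def)
  qed
  ultimately show ?thesis by (intro smooth_uptoI[of N' D "\<lambda>x. P (h x)"]) (use N f(2) in \<open>auto simp: N'_def\<close>)
qed

lemma smooth_upto_inverse:
  fixes f :: "'a::euclidean_space \<Rightarrow> real"
  assumes "smooth_upto D f" "\<And>x. x \<in> D \<Longrightarrow> f x \<noteq> 0"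
  shows "smooth_upto D (\<lambda>x. inverse (f x))"
  by (rule smooth_upto_unary[where R="-{0}" and P=inverse, OF _ _ assms(1)])
     (use assms in \<open>auto intro: C_k_on_inverse\<close>)

lemma smooth_upto_divide:
  fixes f :: "'a::euclidean_space \<Rightarrow> real"
  assumes "smooth_upto D g" "smooth_upto D f" "\<And>x. x \<in> D \<Longrightarrow> f x \<noteq> 0"
  shows "smooth_upto D (\<lambda>x. g x / f x)"
  unfolding divide_inverse by (intro smooth_upto_mult smooth_upto_inverse assms)

lemma smooth_upto_sqrt:
  fixes f :: "'a::euclidean_space \<Rightarrow> real"
  assumes "smooth_upto D f" "\<And>x. x \<in> D \<Longrightarrow> f x > 0"
  shows "smooth_upto D (\<lambda>x. sqrt (f x))"
  by (rule smooth_upto_unary[where R="{0<..}" and P=sqrt, OF _ _ assms(1)])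
     (use assms in \<open>auto intro: C_k_on_sqrt\<close>)

lemma smooth_upto_continuous_on: "smooth_upto D f \<Longrightarrow> continuous_on D f"
proof -
  assume "smooth_upto D f"
  then obtain N h where N: "D \<subseteq> N" "smooth_on N h" "\<And>x. x \<in> D \<Longrightarrow> h x = f x" unfolding smooth_upto_def by blast
  have "C_k_on 0 N h" using N(2) unfolding smooth_on_def by blast
  then have "continuous_on D h" using N(1) by (auto intro: continuous_on_subset)
  then show ?thesis by (rule continuous_on_eq) (rule N(3))
qed

section \<open>Derivatives within a closed set\<close>

lemma smooth_upto_ext:
  assumes "smooth_upto D f"
  obtains N h where "open N" "D \<subseteq> N" "smooth_on N h" "\<And>x. x \<in> D \<Longrightarrow> h x = f x"
    "\<And>x. x \<in> D \<Longrightarrow> (f has_derivative frechet_derivative h (at x)) (at x within D)"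
proof -
  obtain N h where N: "open N" "D \<subseteq> N" "smooth_on N h" "\<forall>x\<in>D. h x = f x"
    using assms unfolding smooth_upto_def by blast
  have "(f has_derivative frechet_derivative h (at x)) (at x within D)" if "x \<in> D" for x
  proof -
    have "C_k_on (Suc 0) N h" using N(3) unfolding smooth_on_def by blast
    then have "(h has_derivative frechet_derivative h (at x)) (at x within D)"
      using C_k_on_has_derivative has_derivative_at_withinI N(2) that by blast
    then show ?thesis by (rule has_derivative_transform[OF that, rotated]) (simp add: N(4))
  qed
  then show ?thesis using N that by blast
qed

text \<open>The choice behind \<open>dD\<close> returns a genuine derivative within D as soon as one
  exists, also where several exist, as on a facet in transversal directions.\<close>

lemma smooth_upto_has_derivative:
  assumes "smooth_upto D f" "x \<in> D"
  shows "(f has_derivative dD D f x) (at x within D)"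
proof -
  obtain h where "(f has_derivative frechet_derivative h (at x)) (at x within D)"
    by (rule smooth_upto_ext[OF assms(1)]) (use assms(2) in blast)
  then have "f differentiable (at x within D)"
    by (auto simp: differentiable_def)
  then show ?thesis unfolding dD_def using frechet_derivative_works by blast
qed

text \<open>Composition with a curve in D reduces the claim for a one-sided tangent vector to
  uniqueness of the derivative on the unit interval. Linearity extends it to the span.\<close>

lemma has_derivative_tangent_unique:
  assumes f: "(f has_derivative f1) (at x within D)" "(f has_derivative f2) (at x within D)"
    and v: "v \<in> tangent_space D x"
  shows "f1 v = f2 v"
proof -
  have 1: "f1 v = f2 v" if v: "v \<in> tangent_cone D x" for v
  proof -
    obtain c where c: "c 0 = x" "\<forall>t\<in>{0..1}. c t \<in> D" "(c has_vector_derivative v) (at (0::real) within {0..1})"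
      using v unfolding tangent_cone_def by blast
    have cf: "(f \<circ> c has_derivative (\<lambda>t. f' (t *\<^sub>R v))) (at 0 within {0..1})"
      if f': "(f has_derivative f') (at x within D)" for f'
    proof -
      have "(f has_derivative f') (at (c 0) within c ` {0..1})"
        using f' c(1,2) by (auto intro: has_derivative_subset)
      from diff_chain_within[OF c(3)[unfolded has_vector_derivative_def] this]
      show ?thesis by (simp add: comp_def)
    qed
    have "(f \<circ> c has_vector_derivative f' v) (at 0 within {0..1})"
      if "(f has_derivative f') (at x within D)" for f'
      using cf[OF that] linear_cmul[OF has_derivative_linear[OF that]] unfolding has_vector_derivative_def by simp
    from this[OF f(1)] this[OF f(2)] show ?thesis
      by (rule vector_derivative_unique_within[rotated]) (simp add: trivial_limit_within islimpt_Icc)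
  qed
  have lin: "linear f1" "linear f2" using f has_derivative_linear by auto
  show ?thesis using linear_eq_on_span[OF lin 1] v unfolding tangent_space_def by blast
qed

lemma dD_eq:
  assumes "(f has_derivative f') (at x within D)" "v \<in> tangent_space D x"
  shows "dD D f x v = f' v"
proof -
  have "(f has_derivative dD D f x) (at x within D)"
    unfolding dD_def using assms(1) by (auto simp: differentiable_def frechet_derivative_works[symmetric])
  then show ?thesis using assms has_derivative_tangent_unique by blast
qed

text \<open>With D a facet and D' its element, this turns derivatives along the facet into
  derivatives on the element, where they can be computed.\<close>

lemma dD_cong:
  assumes "\<And>y. y \<in> D \<Longrightarrow> f y = f' y" "smooth_upto D' f'" "D \<subseteq> D'" "x \<in> D" "v \<in> tangent_space D x"
    "v \<in> tangent_space D' x"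
  shows "dD D f x v = dD D' f' x v"
proof -
  have "(f' has_derivative dD D' f' x) (at x within D')" using smooth_upto_has_derivative assms by blast
  then have "(f' has_derivative dD D' f' x) (at x within D)" using has_derivative_subset assms(3) by blast
  then have "(f has_derivative dD D' f' x) (at x within D)"
    by (rule has_derivative_transform[OF assms(4), rotated]) (rule assms(1))
  then show ?thesis using dD_eq assms(5) by blast
qed

text \<open>When all tangent spaces are full, a smooth extension computes \<open>dD\<close> in every
  direction. Hence \<open>dD\<close> preserves smoothness and can be iterated.\<close>

lemma dD_ext:
  assumes "smooth_upto D f" "\<And>x. x \<in> D \<Longrightarrow> tangent_space D x = UNIV"
  obtains N h where "open N" "D \<subseteq> N" "smooth_on N h" "\<And>x. x \<in> D \<Longrightarrow> h x = f x"
    "\<And>x v. x \<in> D \<Longrightarrow> dD D f x v = frechet_derivative h (at x) v"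
proof -
  obtain N h where N: "open N" "D \<subseteq> N" "smooth_on N h" "\<And>x. x \<in> D \<Longrightarrow> h x = f x"
    and d: "\<And>x. x \<in> D \<Longrightarrow> (f has_derivative frechet_derivative h (at x)) (at x within D)"
    by (rule smooth_upto_ext[OF assms(1)]) blast
  have "dD D f x v = frechet_derivative h (at x) v" if "x \<in> D" for x v
    by (rule dD_eq[OF d]) (use assms(2) that in auto)
  from that[OF N this] show ?thesis .
qed

lemma smooth_on_derivative:
  assumes "smooth_on N h"
  shows "smooth_on N (\<lambda>x. frechet_derivative h (at x) v)"
  unfolding smooth_on_def
proof
  fix k
  have "C_k_on (Suc k) N h" using assms unfolding smooth_on_def by blast
  then show "C_k_on k N (\<lambda>x. frechet_derivative h (at x) v)" by simp
qed

lemma smooth_upto_dD: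
  assumes "smooth_upto D f" "\<And>x. x \<in> D \<Longrightarrow> tangent_space D x = UNIV"
  shows "smooth_upto D (\<lambda>x. dD D f x v)"
proof -
  obtain N h where N: "open N" "D \<subseteq> N" "smooth_on N h"
    and d: "\<And>x v. x \<in> D \<Longrightarrow> dD D f x v = frechet_derivative h (at x) v"
    by (rule dD_ext[OF assms]) blast+
  show ?thesis by (rule smooth_uptoI[OF N(1,2) smooth_on_derivative[OF N(3)]]) (simp add: d)
qed

lemma dD_commute:
  fixes f :: "real^3 \<Rightarrow> real"
  assumes "smooth_upto D f" "\<And>x. x \<in> D \<Longrightarrow> tangent_space D x = UNIV" "x \<in> D"
  shows "dD D (\<lambda>y. dD D f y u) x v = dD D (\<lambda>y. dD D f y v) x u"
proof -
  obtain N h where N: "open N" "D \<subseteq> N" "smooth_on N h"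
    and d: "\<And>x v. x \<in> D \<Longrightarrow> dD D f x v = frechet_derivative h (at x) v"
    by (rule dD_ext[OF assms(1,2)]) blast+
  have *: "dD D (\<lambda>y. dD D f y u) x v = frechet_derivative (\<lambda>y. frechet_derivative h (at y) u) (at x) v" for u v
  proof (rule dD_eq)
    have "C_k_on (Suc 0) N (\<lambda>y. frechet_derivative h (at y) u)"
      using smooth_on_derivative[OF N(3)] unfolding smooth_on_def by blast
    from C_k_on_has_derivative[OF this, of x]
    have "((\<lambda>y. frechet_derivative h (at y) u) has_derivative frechet_derivative (\<lambda>y. frechet_derivative h (at y) u) (at x)) (at x within D)"
      using N(2) assms(3) by (auto intro: has_derivative_at_withinI)
    then show "((\<lambda>y. dD D f y u) has_derivative frechet_derivative (\<lambda>y. frechet_derivative h (at y) u) (at x)) (at x within D)"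
      by (rule has_derivative_transform[OF assms(3), rotated]) (simp add: d)
  qed (use assms in auto)
  have "C_k_on 2 N h" using N(3) unfolding smooth_on_def by blast
  then show ?thesis using C_2_symmetric[OF N(1)] N(2) assms(3) by (auto simp: *)
qed


subsection \<open>Inner products on the tangent space\<close>

lemmas bilinear_simps = bilinear_ladd bilinear_radd bilinear_lmul bilinear_rmul bilinear_lneg bilinear_rneg
  bilinear_lsub bilinear_rsub bilinear_lzero bilinear_rzero

lemma bilinear_lsum: "bilinear (f :: 'a::real_vector \<Rightarrow> 'b::real_vector \<Rightarrow> 'c::real_vector) \<Longrightarrow> f (\<Sum>i\<in>I. u i) w = (\<Sum>i\<in>I. f (u i) w)"
  using linear_sum[of "\<lambda>x. f x w" u I] by (simp add: bilinear_def)

lemma bilinear_rsum: "bilinear (f :: 'a::real_vector \<Rightarrow> 'b::real_vector \<Rightarrow> 'c::real_vector) \<Longrightarrow> f w (\<Sum>i\<in>I. u i) = (\<Sum>i\<in>I. f w (u i))"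
  by (simp add: bilinear_def linear_sum)

lemma det_rows: "det (vector [X, Y, Z] :: real^3^3) =
   X$1*Y$2*Z$3 + X$2*Y$3*Z$1 + X$3*Y$1*Z$2 - X$1*Y$3*Z$2 - X$2*Y$1*Z$3 - X$3*Y$2*Z$1"
  by (simp add: det_3)

definition onb :: "tensor2 \<Rightarrow> ('n::finite \<Rightarrow> real^3) \<Rightarrow> bool" where
  "onb h e \<longleftrightarrow> (\<forall>i j. h (e i) (e j) = (if i = j then 1 else 0))"

lemma onb_in: "onb h e \<Longrightarrow> h (e i) (e j) = (if i = j then 1 else 0)"
  by (simp add: onb_def)

definition unit_vec :: "tensor2 \<Rightarrow> real^3 \<Rightarrow> real^3" where
  "unit_vec h v = (1 / sqrt (h v v)) *\<^sub>R v"

text \<open>Gram-Schmidt is written out as a formula, instead of asserting that an orthonormal frame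
  exists, because applied to the tangent fields of a chart it must give fields that vary
  smoothly.\<close>

definition gs2 :: "tensor2 \<Rightarrow> real^3 \<Rightarrow> real^3 \<Rightarrow> real^3" where
  "gs2 h a b = (let p = unit_vec h a in unit_vec h (b - h b p *\<^sub>R p))"

definition gs3 :: "tensor2 \<Rightarrow> real^3 \<Rightarrow> real^3 \<Rightarrow> real^3 \<Rightarrow> real^3" where
  "gs3 h a b c = (let p = unit_vec h a; q = gs2 h a b in unit_vec h (c - h c p *\<^sub>R p - h c q *\<^sub>R q))"

text \<open>Cramer's rule for the vector that represents the linear form L. As a quotient of
  determinants it shows how the vector depends on the metric, which the defining \<open>THE\<close>
  does not.\<close>

definition riesz :: "tensor2 \<Rightarrow> (real^3 \<Rightarrow> real) \<Rightarrow> real^3" where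
  "riesz h L = (\<chi> k. det (\<chi> i j. if j = k then L (axis i 1) else h (axis i 1) (axis j 1)) / metric_det h)"

text \<open>The linear form that corresponds to an alternating bilinear form b when X \<times> Y is
  substituted for the pair (X, Y). The numbers \<open>h v (axis i 1) / sqrt (metric_det h)\<close>
  are, for v = X \<times> Y, the 2-by-2 minors of X and Y.\<close>

definition cross_dual :: "tensor2 \<Rightarrow> (real^3 \<Rightarrow> real^3 \<Rightarrow> real) \<Rightarrow> real^3 \<Rightarrow> real" where
  "cross_dual h b v = (h v (axis 1 1) * b (axis 2 1) (axis 3 1) + h v (axis 2 1) * b (axis 3 1) (axis 1 1)
      + h v (axis 3 1) * b (axis 1 1) (axis 2 1)) / sqrt (metric_det h)"

lemma vec3_expand: "(v :: real^3) = v$1 *\<^sub>R axis 1 1 + v$2 *\<^sub>R axis 2 1 + v$3 *\<^sub>R axis 3 1"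
  by (simp add: vec_eq_iff forall_3 axis_def)

lemma linear_vec3: 
  fixes L :: "real^3 \<Rightarrow> 'a::real_vector"
  assumes "linear L"
  shows "L v = v$1 *\<^sub>R L (axis 1 1) + v$2 *\<^sub>R L (axis 2 1) + v$3 *\<^sub>R L (axis 3 1)"
  by (subst (1) vec3_expand[of v]) (simp add: linear_add[OF assms] linear_cmul[OF assms])

locale inner3 =
  fixes h :: tensor2
  assumes bil: "bilinear h" and hsym: "h X Y = h Y X" and pos: "X \<noteq> 0 \<Longrightarrow> h X X > 0"
begin

lemmas h_simps = bilinear_simps[OF bil] bilinear_lsum[OF bil] bilinear_rsum[OF bil]

lemma nonneg: "h X X \<ge> 0"
  using pos[of X] by (cases "X = 0") (auto simp: h_simps)

lemma eq_0_iff: "h X X = 0 \<longleftrightarrow> X = 0"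
  using pos[of X] by (cases "X = 0") (auto simp: h_simps)

lemma nondeg: "(\<And>Z. h v Z = h w Z) \<Longrightarrow> v = w"
  using eq_0_iff[of "v - w"] by (simp add: h_simps)

lemma onb_inj: "onb h e \<Longrightarrow> inj e"
  unfolding onb_def inj_def by (metis zero_neq_one)

lemma onb_independent:
  assumes e: "onb h e" shows "independent (range e)"
  unfolding dependent_def
proof clarify
  fix j assume j: "e j \<in> span (range e - {e j})"
  have "linear (\<lambda>v. h v (e j))" using bil by (simp add: bilinear_def)
  then have "h (e j) (e j) = 0"
    by (rule linear_eq_0_on_span[OF _ _ j]) (use e in \<open>auto simp: onb_def\<close>)
  then show False using e by (simp add: onb_def)
qed

text \<open>Stated relative to a set V so that one lemma serves the tangent planes of facets, with
  two frame vectors, and the full space, with three.\<close>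

lemma onb_expand:
  fixes e :: "'n::finite \<Rightarrow> real^3"
  assumes e: "onb h e" "\<And>i. e i \<in> V" and V: "dim V \<le> CARD('n)" "v \<in> V"
  shows "v = (\<Sum>i\<in>UNIV. h v (e i) *\<^sub>R e i)"
proof -
  have "card (range e) = CARD('n)" using onb_inj[OF e(1)] by (simp add: card_image)
  then have "V \<subseteq> span (range e)"
    using card_ge_dim_independent[of "range e" V] onb_independent[OF e(1)] e(2) V(1) by auto
  with V have "v \<in> span (range e)" by blast
  then show ?thesis
  proof (induction rule: span_induct_alt)
    case (step c x y)
    then obtain j where j: "x = e j" by auto
    have "(\<Sum>i\<in>UNIV. h (c *\<^sub>R x + y) (e i) *\<^sub>R e i) =
       (\<Sum>i\<in>UNIV. if i = j then c *\<^sub>R e i else 0) + (\<Sum>i\<in>UNIV. h y (e i) *\<^sub>R e i)"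
      unfolding sum.distrib[symmetric]
      by (rule sum.cong) (use e(1) in \<open>auto simp: j h_simps onb_def scaleR_add_left\<close>)
    then show ?case using step j by simp
  qed (simp add: h_simps)
qed

lemma onb3_expand:
  fixes e :: "3 \<Rightarrow> real^3"
  assumes e: "onb h e"
  shows "v = (\<Sum>i\<in>UNIV. h v (e i) *\<^sub>R e i)"
  by (rule onb_expand[OF e, of UNIV]) auto

lemma trace_frame:
  fixes e e' :: "'n::finite \<Rightarrow> real^3"
  assumes e: "onb h e" "\<And>i. e i \<in> V" and e': "onb h e'" "\<And>i. e' i \<in> V" and V: "dim V \<le> CARD('n)"
    and B: "bilinear B"
  shows "(\<Sum>i\<in>UNIV. B (e i) (e i)) = (\<Sum>i\<in>UNIV. B (e' i) (e' i) :: real)"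
proof -
  have "(\<Sum>i\<in>UNIV. B (e i) (e i)) = (\<Sum>i\<in>UNIV. \<Sum>j\<in>UNIV. h (e i) (e' j) * B (e' j) (e i))"
  proof (rule sum.cong)
    fix i
    have "B (e i) w = (\<Sum>j\<in>UNIV. h (e i) (e' j) * B (e' j) w)" for w
      by (subst onb_expand[OF e' V e(2)[of i]]) (simp add: bilinear_lsum[OF B] bilinear_lmul[OF B])
    then show "B (e i) (e i) = (\<Sum>j\<in>UNIV. h (e i) (e' j) * B (e' j) (e i))" .
  qed simp
  also have "\<dots> = (\<Sum>j\<in>UNIV. \<Sum>i\<in>UNIV. h (e' j) (e i) * B (e' j) (e i))"
    by (subst sum.swap) (simp add: hsym)
  also have "\<dots> = (\<Sum>j\<in>UNIV. B (e' j) (e' j))"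
  proof (rule sum.cong)
    fix j
    have "B w (e' j) = (\<Sum>i\<in>UNIV. h (e' j) (e i) * B w (e i))" for w
      by (subst onb_expand[OF e V e'(2)[of j]]) (simp add: bilinear_rsum[OF B] bilinear_rmul[OF B])
    then show "(\<Sum>i\<in>UNIV. h (e' j) (e i) * B (e' j) (e i)) = B (e' j) (e' j)" by simp
  qed simp
  finally show ?thesis .
qed

text \<open>Obtained from \<open>trace_frame\<close> one slot at a time. It allows the frame chosen
  in \<open>frameF\<close> to be exchanged for the Gram-Schmidt frame, whose smoothness is
  known.\<close>

lemma ip2_frame:
  fixes e e' :: "'n::finite \<Rightarrow> real^3"
  assumes e: "onb h e" "\<And>i. e i \<in> V" and e': "onb h e'" "\<And>i. e' i \<in> V" and V: "dim V \<le> CARD('n)"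
    and B: "bilinear B" "bilinear C"
  shows "ip2 e B C = ip2 e' B C"
proof -
  have 1: "bilinear (\<lambda>x y. B x w * C y w)" for w
    using B by (auto simp: bilinear_def linear_iff algebra_simps)
  have 2: "bilinear (\<lambda>x y. B w x * C w y)" for w
    using B by (auto simp: bilinear_def linear_iff algebra_simps)
  have "ip2 e B C = (\<Sum>j\<in>UNIV. \<Sum>i\<in>UNIV. B (e i) (e j) * C (e i) (e j))"
    unfolding ip2_def by (rule sum.swap)
  also have "\<dots> = (\<Sum>j\<in>UNIV. \<Sum>i\<in>UNIV. B (e' i) (e j) * C (e' i) (e j))"
    by (intro sum.cong trace_frame[OF e e' V 1] refl)
  also have "\<dots> = (\<Sum>i\<in>UNIV. \<Sum>j\<in>UNIV. B (e' i) (e j) * C (e' i) (e j))"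
    by (rule sum.swap)
  also have "\<dots> = ip2 e' B C"
    unfolding ip2_def by (intro sum.cong trace_frame[OF e e' V 2] refl)
  finally show ?thesis .
qed

lemma unit_vec_unit: "v \<noteq> 0 \<Longrightarrow> h (unit_vec h v) (unit_vec h v) = 1"
  using pos[of v] by (simp add: unit_vec_def h_simps real_sqrt_mult[symmetric] flip: real_sqrt_mult)

lemma unit_vec_pos: "v \<noteq> 0 \<Longrightarrow> 1 / sqrt (h v v) > 0"
  using pos[of v] by simp

lemma unit_vec_span: "unit_vec h v \<in> span {v}"
  by (simp add: unit_vec_def span_base span_scale)

text \<open>The positive r records that Gram-Schmidt does not change sides: modulo the span of a,
  the new vector is a positive multiple of b. This is what will identify it as the inward conormal,
  and likewise \<open>gs3\<close> as the inward normal.\<close>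

lemma gs2:
  assumes "a \<noteq> 0" "b \<notin> span {a}"
  shows "h (gs2 h a b) (gs2 h a b) = 1" "h (gs2 h a b) (unit_vec h a) = 0"
    "\<exists>r>0. gs2 h a b - r *\<^sub>R b \<in> span {a}" "gs2 h a b \<in> span {a, b}"
    "b - h b (unit_vec h a) *\<^sub>R unit_vec h a \<noteq> 0"
proof -
  define p where "p = unit_vec h a"
  define w where "w = b - h b p *\<^sub>R p"
  have p: "h p p = 1" "p \<in> span {a}" unfolding p_def using unit_vec_unit unit_vec_span assms by auto
  have w: "w \<noteq> 0"
  proof
    assume "w = 0"
    then have "b = h b p *\<^sub>R p" by (simp add: w_def)
    then show False using p(2) assms(2) span_scale by metis
  qed
  then show "b - h b (unit_vec h a) *\<^sub>R unit_vec h a \<noteq> 0" by (simp add: w_def p_def)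
  have g: "gs2 h a b = unit_vec h w" by (simp add: gs2_def Let_def w_def p_def)
  show "h (gs2 h a b) (gs2 h a b) = 1" using unit_vec_unit[OF w] g by simp
  have "h w p = 0" by (simp add: w_def h_simps p)
  then show "h (gs2 h a b) (unit_vec h a) = 0" by (simp add: g unit_vec_def[of h w] h_simps p_def)
  show "\<exists>r>0. gs2 h a b - r *\<^sub>R b \<in> span {a}"
  proof (intro exI conjI)
    show "1 / sqrt (h w w) > 0" by (rule unit_vec_pos[OF w])
    have "gs2 h a b - (1 / sqrt (h w w)) *\<^sub>R b = - ((h b p / sqrt (h w w)) *\<^sub>R p)"
      unfolding g unit_vec_def by (simp add: w_def algebra_simps)
    then show "gs2 h a b - (1 / sqrt (h w w)) *\<^sub>R b \<in> span {a}" using p(2) by (simp add: span_neg span_scale)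
  qed
  have "p \<in> span {a, b}" using p(2) span_mono[of "{a}" "{a,b}"] by auto
  then have "w \<in> span {a, b}" unfolding w_def by (intro span_diff span_scale) (auto simp: span_base)
  then show "gs2 h a b \<in> span {a, b}" unfolding g unit_vec_def by (rule span_scale)
qed

lemma gs3:
  assumes "a \<noteq> 0" "b \<notin> span {a}" "c \<notin> span {a, b}"
  shows "h (gs3 h a b c) (gs3 h a b c) = 1" "h (gs3 h a b c) (unit_vec h a) = 0" "h (gs3 h a b c) (gs2 h a b) = 0"
    "\<exists>r>0. gs3 h a b c - r *\<^sub>R c \<in> span {a, b}"
    "c - h c (unit_vec h a) *\<^sub>R unit_vec h a - h c (gs2 h a b) *\<^sub>R gs2 h a b \<noteq> 0"
proof -
  define p where "p = unit_vec h a"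
  define q where "q = gs2 h a b"
  define w where "w = c - h c p *\<^sub>R p - h c q *\<^sub>R q"
  have p: "h p p = 1" "h q q = 1" "h q p = 0" "h p q = 0"
    unfolding p_def q_def using unit_vec_unit gs2[OF assms(1,2)] assms hsym by auto
  have ps: "p \<in> span {a, b}" unfolding p_def using unit_vec_span[of a] span_mono[of "{a}" "{a,b}"] by auto
  have qs: "q \<in> span {a, b}" unfolding q_def using gs2[OF assms(1,2)] by auto
  have w: "w \<noteq> 0"
  proof
    assume "w = 0"
    then have "c = h c p *\<^sub>R p + h c q *\<^sub>R q" by (simp add: w_def algebra_simps)
    then show False using ps qs assms(3) span_scale span_add by metis
  qed
  then show "c - h c (unit_vec h a) *\<^sub>R unit_vec h a - h c (gs2 h a b) *\<^sub>R gs2 h a b \<noteq> 0" by (simp add: w_def p_def q_def)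
  have g: "gs3 h a b c = unit_vec h w" by (simp add: gs3_def Let_def w_def p_def q_def)
  show "h (gs3 h a b c) (gs3 h a b c) = 1" using unit_vec_unit[OF w] g by simp
  have "h w p = 0" "h w q = 0" by (simp_all add: w_def h_simps p)
  then show "h (gs3 h a b c) (unit_vec h a) = 0" "h (gs3 h a b c) (gs2 h a b) = 0"
    by (simp_all add: g unit_vec_def[of h w] h_simps p_def q_def)
  show "\<exists>r>0. gs3 h a b c - r *\<^sub>R c \<in> span {a, b}"
  proof (intro exI conjI)
    show "1 / sqrt (h w w) > 0" by (rule unit_vec_pos[OF w])
    have "gs3 h a b c - (1 / sqrt (h w w)) *\<^sub>R c = - ((h c p / sqrt (h w w)) *\<^sub>R p) - ((h c q / sqrt (h w w)) *\<^sub>R q)"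
      unfolding g unit_vec_def by (simp add: w_def algebra_simps)
    then show "gs3 h a b c - (1 / sqrt (h w w)) *\<^sub>R c \<in> span {a, b}"
      using ps qs by (simp add: span_neg span_scale span_diff)
  qed
qed

definition frame3 :: "real^3 \<Rightarrow> real^3 \<Rightarrow> real^3 \<Rightarrow> 3 \<Rightarrow> real^3" where
  "frame3 p q r i = (if i = 1 then p else if i = 2 then q else r)"

lemma frame3_simps [simp]: "frame3 p q r 1 = p" "frame3 p q r 2 = q" "frame3 p q r 3 = r"
  by (auto simp: frame3_def)

lemma frame3_eta: "frame3 (e 1) (e 2) (e 3) = e"
  by (simp add: fun_eq_iff forall_3)

lemma onb_frame3:
  assumes "h p p = 1" "h q q = 1" "h r r = 1" "h p q = 0" "h p r = 0" "h q r = 0"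
  shows "onb h (frame3 p q r)"
  unfolding onb_def forall_3 using assms hsym[of q p] hsym[of r p] hsym[of r q] by simp

lemma onb3_exists: "\<exists>e :: 3 \<Rightarrow> real^3. onb h e"
proof -
  have 1: "axis 1 1 \<noteq> (0 :: real^3)" by simp
  have 2: "axis 2 1 \<notin> span {axis 1 1 :: real^3}"
    by (auto simp: span_singleton vec_eq_iff forall_3 axis_def)
  have 3: "axis 3 1 \<notin> span {axis 1 1, axis 2 1 :: real^3}"
    by (auto simp: span_breakdown_eq span_singleton vec_eq_iff forall_3 axis_def)
  show ?thesis
    using onb_frame3[of "unit_vec h (axis 1 1)" "gs2 h (axis 1 1) (axis 2 1)" "gs3 h (axis 1 1) (axis 2 1) (axis 3 1)"]
      unit_vec_unit[OF 1] gs2[OF 1 2] gs3[OF 1 2 3] hsym by metis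
qed

lemma onb_frameT: "onb h (frameT h)"
proof -
  have "\<exists>e :: 3 \<Rightarrow> real^3. (\<forall>i. e i \<in> UNIV) \<and> (\<forall>i j. h (e i) (e j) = (if i = j then 1 else 0))"
    using onb3_exists by (simp add: onb_def)
  from someI_ex[OF this] show ?thesis unfolding frameT_def oframe_def onb_def by blast
qed

text \<open>If M has the frame vectors as rows and A is the matrix of h, orthonormality reads M A
  M^T = 1; take determinants. This gives both the positivity of the metric determinant and the
  volume 1 or -1 of an orthonormal frame.\<close>

lemma matrix_onb:
  fixes X Y Z :: "real^3"
  assumes "onb h (frame3 X Y Z)"
  shows "metric_det h * (det (vector [X, Y, Z] :: real^3^3))\<^sup>2 = 1"
proof -
  let ?M = "vector [X, Y, Z] :: real^3^3" and ?A = "\<chi> i j. h (axis i 1) (axis j 1) :: real^3^3"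
  have r: "?M $ i = frame3 X Y Z i" for i using exhaust_3[of i] by auto
  have hh: "h x y = (\<Sum>i\<in>UNIV. \<Sum>j\<in>UNIV. x$i * h (axis i 1) (axis j 1) * y$j)" for x y
    by (subst vec3_expand[of x], subst vec3_expand[of y]) (simp add: h_simps sum_3 algebra_simps)
  have "(?M ** ?A ** transpose ?M) $ i $ j = h (?M $ i) (?M $ j)" for i j
    unfolding hh[of "?M $ i"] by (simp add: matrix_matrix_mult_def transpose_def sum_3 algebra_simps)
  then have "?M ** ?A ** transpose ?M = mat 1"
    using assms by (simp add: vec_eq_iff mat_def r onb_def)
  then have "det (?M ** ?A ** transpose ?M) = 1" by simp
  then show ?thesis by (simp add: det_mul metric_det_def power2_eq_square algebra_simps)
qed

lemma metric_det_pos: "metric_det h > 0"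
proof -
  obtain e :: "3 \<Rightarrow> real^3" where "onb h e" using onb3_exists by blast
  then have "metric_det h * (det (vector [e 1, e 2, e 3] :: real^3^3))\<^sup>2 = 1"
    by (intro matrix_onb) (simp add: frame3_eta[of e])
  moreover have "metric_det h * q\<^sup>2 \<le> 0" if "metric_det h \<le> 0" for q
    using that by (simp add: mult_nonpos_nonneg)
  ultimately show ?thesis by (metis linorder_not_less not_one_le_zero)
qed

lemma riesz:
  assumes L: "linear L" shows "h (riesz h L) Z = L Z"
proof -
  let ?A = "\<chi> i j. h (axis i 1) (axis j 1) :: real^3^3" and ?b = "\<chi> i. L (axis i 1) :: real^3"
  have "?A *v riesz h L = ?b"
    using metric_det_pos cramer[of ?A "riesz h L" ?b]
    by (simp add: riesz_def metric_det_def cong: if_cong)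
  then have A: "(?A *v riesz h L) $ i = L (axis i 1)" for i by simp
  have *: "h (riesz h L) (axis i 1) = L (axis i 1)" for i
  proof -
    have "linear (h (axis i 1))" using bil by (simp add: bilinear_def)
    from linear_vec3[OF this, of "riesz h L"] A[of i] show ?thesis
      by (simp add: hsym[of "riesz h L"] matrix_vector_mult_def sum_3 algebra_simps)
  qed
  show ?thesis
    using linear_vec3[OF L, of Z] linear_vec3[of "h (riesz h L)" Z] bil by (simp add: bilinear_def *)
qed

lemma riesz_the:
  assumes "linear L" shows "(THE v. \<forall>Z. h v Z = L Z) = riesz h L"
  by (rule the_equality) (auto simp: riesz[OF assms] intro: nondeg)

lemma linear_vol: "linear (vol h X Y)"
  by (rule linearI) (simp_all add: vol_def det_rows algebra_simps)

lemma gcross_riesz: "gcross h X Y = riesz h (vol h X Y)"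
  unfolding gcross_def by (rule riesz_the[OF linear_vol])

lemma gcross: "h (gcross h X Y) Z = vol h X Y Z"
  by (simp add: gcross_riesz riesz[OF linear_vol])

lemma bilinear_gcross: "bilinear (gcross h)"
proof -
  have "gcross h (X + X') Y = gcross h X Y + gcross h X' Y" "gcross h (c *\<^sub>R X) Y = c *\<^sub>R gcross h X Y"
    "gcross h Y (X + X') = gcross h Y X + gcross h Y X'" "gcross h Y (c *\<^sub>R X) = c *\<^sub>R gcross h Y X" for X X' Y c
    by (rule nondeg, simp add: gcross h_simps, simp add: vol_def det_rows algebra_simps)+
  then show ?thesis unfolding bilinear_def linear_iff by blast
qed

lemmas gcross_simps = bilinear_simps[OF bilinear_gcross]

lemma gcross_antisym: "gcross h X Y = - gcross h Y X"
  by (rule nondeg) (simp add: gcross h_simps, simp add: vol_def det_rows algebra_simps)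

lemma gcross_self: "gcross h X X = 0"
  by (rule nondeg) (simp add: gcross h_simps, simp add: vol_def det_rows algebra_simps)

lemma gcross_orth: "h (gcross h X Y) X = 0" "h (gcross h X Y) Y = 0"
  by (simp_all add: gcross, simp_all add: vol_def det_rows algebra_simps)

text \<open>The number s is the signed volume of the frame. Its value is left open because the
  frames of \<open>frameT\<close> and \<open>frameF\<close> are chosen without orientation.\<close>

lemma gcross_frame:
  assumes e: "onb h (e :: 3 \<Rightarrow> real^3)"
  obtains s where "s = 1 \<or> s = (-1::real)"
    "gcross h (e 1) (e 2) = s *\<^sub>R e 3" "gcross h (e 2) (e 3) = s *\<^sub>R e 1" "gcross h (e 3) (e 1) = s *\<^sub>R e 2"
    "gcross h (e 2) (e 1) = - s *\<^sub>R e 3" "gcross h (e 3) (e 2) = - s *\<^sub>R e 1" "gcross h (e 1) (e 3) = - s *\<^sub>R e 2"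
proof -
  define s where "s = vol h (e 1) (e 2) (e 3)"
  have "metric_det h * (det (vector [e 1, e 2, e 3] :: real^3^3))\<^sup>2 = 1"
    by (rule matrix_onb) (use e in \<open>simp add: frame3_eta[of e]\<close>)
  then have "s\<^sup>2 = 1" using metric_det_pos by (simp add: s_def vol_def power_mult_distrib)
  then have s: "s = 1 \<or> s = -1" by (simp add: power2_eq_1_iff)
  have x: "v = h v (e 1) *\<^sub>R e 1 + h v (e 2) *\<^sub>R e 2 + h v (e 3) *\<^sub>R e 3" for v
    using onb3_expand[OF e, of v] by (simp add: sum_3)
  have v: "vol h (e 2) (e 3) (e 1) = s" "vol h (e 3) (e 1) (e 2) = s"
    by (simp_all add: s_def, simp_all add: vol_def det_rows algebra_simps)
  have 1: "gcross h (e 1) (e 2) = s *\<^sub>R e 3"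
    by (subst x[of "gcross h (e 1) (e 2)"]) (simp add: gcross_orth, simp add: gcross s_def)
  have 2: "gcross h (e 2) (e 3) = s *\<^sub>R e 1"
    by (subst x[of "gcross h (e 2) (e 3)"]) (simp add: gcross_orth, simp add: gcross v)
  have 3: "gcross h (e 3) (e 1) = s *\<^sub>R e 2"
    by (subst x[of "gcross h (e 3) (e 1)"]) (simp add: gcross_orth, simp add: gcross v)
  show ?thesis
    by (rule that[OF s 1 2 3]) (use 1 2 3 gcross_antisym[of "e 2" "e 1"] gcross_antisym[of "e 3" "e 2"] gcross_antisym[of "e 1" "e 3"] in simp_all)
qed

text \<open>Up to sign the cross products of frame vectors are the frame vectors again, so cross
  products span. This is the uniqueness half of \<open>curl\<close> and, through
  \<open>bilinear_eq_gcross\<close>, of the inverse of \<open>Aop\<close>.\<close>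

lemma linear_eq_gcross:
  fixes C :: "real^3 \<Rightarrow> real"
  assumes C: "linear C" "linear C'" and eq: "\<And>X Y. C (gcross h X Y) = C' (gcross h X Y)"
  shows "C v = C' v"
proof -
  obtain e :: "3 \<Rightarrow> real^3" where e: "onb h e" using onb3_exists by blast
  obtain s where s: "s = 1 \<or> s = (-1::real)" "gcross h (e 1) (e 2) = s *\<^sub>R e 3"
    "gcross h (e 2) (e 3) = s *\<^sub>R e 1" "gcross h (e 3) (e 1) = s *\<^sub>R e 2"
    by (rule gcross_frame[OF e])
  have "C (s *\<^sub>R e i) = C' (s *\<^sub>R e i)" for i
    using eq[of "e 1" "e 2"] eq[of "e 2" "e 3"] eq[of "e 3" "e 1"] s(2-4) exhaust_3[of i] by auto
  then have "C (e i) = C' (e i)" for i using s(1) by (auto simp: linear_cmul[OF C(1)] linear_cmul[OF C(2)])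
  then show ?thesis
    by (subst (1 2) onb3_expand[OF e, of v]) (simp add: linear_sum[OF C(1)] linear_sum[OF C(2)] linear_cmul[OF C(1)] linear_cmul[OF C(2)])
qed

lemma bilinear_eq_gcross:
  fixes B :: tensor2
  assumes B: "bilinear B" "bilinear B'"
    and eq: "\<And>X Y Z W. B (gcross h X Y) (gcross h Z W) = B' (gcross h X Y) (gcross h Z W)"
  shows "B v w = B' v w"
proof (rule linear_eq_gcross[of "\<lambda>v. B v w" "\<lambda>v. B' v w"])
  show "B (gcross h X Y) w = B' (gcross h X Y) w" for X Y
    by (rule linear_eq_gcross[of "B (gcross h X Y)" "B' (gcross h X Y)"]) (use B eq in \<open>auto simp: bilinear_def\<close>)
qed (use B in \<open>auto simp: bilinear_def\<close>)

lemma linear_cross_dual: "linear (cross_dual h b)"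
  by (rule linearI) (simp_all add: cross_dual_def h_simps add_divide_distrib algebra_simps)

text \<open>Both sides are the same combination of the 2-by-2 minors of X and Y with the values of b
  on pairs of axes.\<close>

lemma cross_dual:
  assumes b: "bilinear b" "\<And>X Y. b X Y = - b Y X"
  shows "cross_dual h b (gcross h X Y) = b X Y"
proof -
  have z: "b X X = 0" for X using b(2)[of X X] by simp
  have "cross_dual h b (gcross h X Y) = (X$2*Y$3 - X$3*Y$2) * b (axis 2 1) (axis 3 1)
     + (X$3*Y$1 - X$1*Y$3) * b (axis 3 1) (axis 1 1) + (X$1*Y$2 - X$2*Y$1) * b (axis 1 1) (axis 2 1)"
    using metric_det_pos by (simp add: cross_dual_def gcross vol_def det_rows axis_def field_simps)
  moreover have "b X Y = (X$2*Y$3 - X$3*Y$2) * b (axis 2 1) (axis 3 1)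
     + (X$3*Y$1 - X$1*Y$3) * b (axis 3 1) (axis 1 1) + (X$1*Y$2 - X$2*Y$1) * b (axis 1 1) (axis 2 1)"
    by (subst vec3_expand[of X], subst vec3_expand[of Y])
       (simp add: bilinear_simps[OF b(1)] z b(2)[of "axis 3 1" "axis 2 1"] b(2)[of "axis 1 1" "axis 3 1"]
          b(2)[of "axis 2 1" "axis 1 1"], simp add: algebra_simps)
  ultimately show ?thesis by simp
qed


subsection \<open>Contractions in dimension three\<close>

lemma Aop_unique:
  assumes "bilinear Q" "bilinear Q'" "Aop h Q = Aop h Q'"
  shows "Q = Q'"
proof (intro ext, rule bilinear_eq_gcross[OF assms(1,2)])
  fix X Y Z W
  show "Q (gcross h X Y) (gcross h Z W) = Q' (gcross h X Y) (gcross h Z W)"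
    using fun_cong[OF fun_cong[OF fun_cong[OF fun_cong[OF assms(3), of X], of Y], of Z], of W] by (simp add: Aop_def)
qed

text \<open>\<open>cross_dual\<close> is applied to the two antisymmetric slot pairs in turn: the
  last pair gives D, the first pair then gives Q, and the minus sign is that of \<open>Aop\<close>.
  Pair symmetry of R becomes symmetry of Q, tested on cross products.\<close>

lemma Aop_exists:
  fixes R :: tensor4
  assumes lin: "\<And>Z W. bilinear (\<lambda>X Y. R X Y Z W)" "\<And>X Y. bilinear (R X Y)"
    and anti: "\<And>X Y Z W. R X Y Z W = - R Y X Z W" "\<And>X Y Z W. R X Y Z W = - R X Y W Z"
    and pair: "\<And>X Y Z W. R X Y Z W = R Z W X Y"
  shows "\<exists>Q. bilinear Q \<and> (\<forall>X Y. Q X Y = Q Y X) \<and> Aop h Q = R"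
proof -
  define D where "D W X Y = cross_dual h (R X Y) W" for W X Y
  define Q where "Q V W = - cross_dual h (D W) V" for V W
  have D: "bilinear (D W)" "D W X Y = - D W Y X" for W X Y
  proof -
    have "D W (X + X') Y = D W X Y + D W X' Y" "D W Y (X + X') = D W Y X + D W Y X'"
      "D W (c *\<^sub>R X) Y = c * D W X Y" "D W Y (c *\<^sub>R X) = c * D W Y X" for X X' Y c
      unfolding D_def cross_dual_def
      by (simp_all add: bilinear_simps[OF lin(1)] add_divide_distrib algebra_simps)
    then show "bilinear (D W)" by (simp add: bilinear_def linear_iff)
    show "D W X Y = - D W Y X" unfolding D_def cross_dual_def
      by (subst (1 2 3) anti(1)) (simp add: add_divide_distrib diff_divide_distrib algebra_simps)
  qed
  have DW: "linear (\<lambda>W. D W X Y)" for X Y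
    unfolding D_def by (rule linear_cross_dual)
  have Q: "bilinear Q"
  proof -
    have "linear (\<lambda>V. Q V W)" for W
      unfolding Q_def by (intro linear_compose_neg linear_cross_dual)
    moreover have "linear (Q V)" for V
      unfolding Q_def cross_dual_def
      by (rule linearI) (simp_all add: linear_add[OF DW] linear_cmul[OF DW] add_divide_distrib algebra_simps)
    ultimately show ?thesis by (simp add: bilinear_def)
  qed
  have QR: "Q (gcross h X Y) (gcross h Z W) = - R X Y Z W" for X Y Z W
  proof -
    have "Q (gcross h X Y) (gcross h Z W) = - D (gcross h Z W) X Y"
      unfolding Q_def using cross_dual[OF D] by simp
    also have "D (gcross h Z W) X Y = R X Y Z W"
      unfolding D_def using cross_dual[OF lin(2) anti(2)] by simp
    finally show ?thesis .
  qed
  have Qt: "bilinear (\<lambda>x y. Q y x)" using Q by (simp add: bilinear_def)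
  have "Q V W = Q W V" for V W
    by (rule bilinear_eq_gcross[OF Q Qt]) (use QR pair in metis)
  then show ?thesis using Q QR by (intro exI[of _ Q]) (auto simp: Aop_def)
qed

text \<open>Each frame vector arises, up to sign, from two ordered pairs, whence the factor 2.
  Evenness of q absorbs the order of the pair and the orientation alike; in the applications q is
  quadratic.\<close>

lemma sum_gcross:
  fixes e :: "3 \<Rightarrow> real^3" and q :: "real^3 \<Rightarrow> real"
  assumes e: "onb h e" and q: "\<And>v. q (- v) = q v" "q 0 = 0"
  shows "(\<Sum>i\<in>UNIV. \<Sum>j\<in>UNIV. q (gcross h (e i) (e j))) = 2 * (\<Sum>i\<in>UNIV. q (e i))"
proof -
  obtain s where s: "s = 1 \<or> s = (-1::real)"
    "gcross h (e 1) (e 2) = s *\<^sub>R e 3" "gcross h (e 2) (e 3) = s *\<^sub>R e 1" "gcross h (e 3) (e 1) = s *\<^sub>R e 2"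
    "gcross h (e 2) (e 1) = - s *\<^sub>R e 3" "gcross h (e 3) (e 2) = - s *\<^sub>R e 1" "gcross h (e 1) (e 3) = - s *\<^sub>R e 2"
    by (rule gcross_frame[OF e])
  have "q (s *\<^sub>R v) = q v" "q (- s *\<^sub>R v) = q v" for v using s(1) q(1) by auto
  then have "q (gcross h (e 1) (e 2)) = q (e 3)" "q (gcross h (e 2) (e 3)) = q (e 1)" "q (gcross h (e 3) (e 1)) = q (e 2)"
    "q (gcross h (e 2) (e 1)) = q (e 3)" "q (gcross h (e 3) (e 2)) = q (e 1)" "q (gcross h (e 1) (e 3)) = q (e 2)"
    "q (gcross h v v) = 0" for v
    unfolding s(2-) gcross_self q(2) by auto
  then show ?thesis unfolding sum_3 by simp
qed

lemma ip2_gcross: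
  fixes e :: "3 \<Rightarrow> real^3"
  assumes e: "onb h e" and V: "bilinear V" and U: "bilinear U"
  shows "(\<Sum>i\<in>UNIV. \<Sum>j\<in>UNIV. \<Sum>k\<in>UNIV. \<Sum>l\<in>UNIV.
      V (gcross h (e i) (e j)) (gcross h (e k) (e l)) * U (gcross h (e i) (e j)) (gcross h (e k) (e l)))
     = 4 * ip2 e V U"
proof -
  note b = bilinear_simps[OF V] bilinear_simps[OF U]
  have "(\<Sum>k\<in>UNIV. \<Sum>l\<in>UNIV. V v (gcross h (e k) (e l)) * U v (gcross h (e k) (e l)))
      = 2 * (\<Sum>k\<in>UNIV. V v (e k) * U v (e k))" for v
    by (rule sum_gcross[OF e]) (simp_all add: b)
  moreover have "(\<Sum>i\<in>UNIV. \<Sum>j\<in>UNIV. 2 * (\<Sum>k\<in>UNIV. V (gcross h (e i) (e j)) (e k) * U (gcross h (e i) (e j)) (e k)))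
      = 2 * (\<Sum>i\<in>UNIV. 2 * (\<Sum>k\<in>UNIV. V (e i) (e k) * U (e i) (e k)))"
    by (rule sum_gcross[OF e]) (simp_all add: b)
  ultimately show ?thesis by (simp add: ip2_def sum_distrib_left)
qed

lemma ip4_Aop:
  fixes e :: "3 \<Rightarrow> real^3"
  assumes "onb h e" "bilinear V" "bilinear U"
  shows "ip4 e (Aop h V) (Aop h U) = 4 * ip2 e V U"
  using ip2_gcross[OF assms] by (simp add: ip4_def Aop_def)

lemma Lend_eq:
  assumes "bilinear \<sigma>" shows "h (Lend h \<sigma> X) Y = \<sigma> X Y"
proof -
  have l: "linear (\<sigma> X)" using assms by (simp add: bilinear_def)
  show ?thesis unfolding Lend_def riesz_the[OF l] by (rule riesz[OF l])
qed

text \<open>In components this is the contraction of two permutation symbols over one index, a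
  difference of two products of Kronecker deltas. Paired with \<sigma>, the first product gives the
  trace term and the second the term without trace.\<close>

lemma sum_Lend_gcross:
  fixes e :: "3 \<Rightarrow> real^3" and p q :: "real^3 \<Rightarrow> real"
  assumes e: "onb h e" and \<sigma>: "bilinear \<sigma>" and p: "linear p" and q: "linear q"
  shows "(\<Sum>i\<in>UNIV. \<Sum>j\<in>UNIV. p (gcross h (Lend h \<sigma> (e i)) (e j)) * q (gcross h (e i) (e j)))
     = tr2 e \<sigma> * (\<Sum>a\<in>UNIV. p (e a) * q (e a)) - (\<Sum>a\<in>UNIV. \<Sum>b\<in>UNIV. \<sigma> (e a) (e b) * p (e a) * q (e b))"
proof -
  obtain s where s: "s = 1 \<or> s = (-1::real)"
    "gcross h (e 1) (e 2) = s *\<^sub>R e 3" "gcross h (e 2) (e 3) = s *\<^sub>R e 1" "gcross h (e 3) (e 1) = s *\<^sub>R e 2"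
    "gcross h (e 2) (e 1) = - s *\<^sub>R e 3" "gcross h (e 3) (e 2) = - s *\<^sub>R e 1" "gcross h (e 1) (e 3) = - s *\<^sub>R e 2"
    by (rule gcross_frame[OF e])
  have ss: "s * (s * x) = x" for x using s(1) by auto
  have L: "Lend h \<sigma> (e i) = \<sigma> (e i) (e 1) *\<^sub>R e 1 + \<sigma> (e i) (e 2) *\<^sub>R e 2 + \<sigma> (e i) (e 3) *\<^sub>R e 3" for i
    by (subst onb3_expand[OF e, of "Lend h \<sigma> (e i)"]) (simp add: sum_3 Lend_eq[OF \<sigma>])
  have ps: "p (gcross h (Lend h \<sigma> (e i)) (e j)) = \<sigma> (e i) (e 1) * p (gcross h (e 1) (e j))
      + \<sigma> (e i) (e 2) * p (gcross h (e 2) (e j)) + \<sigma> (e i) (e 3) * p (gcross h (e 3) (e j))" for i j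
    unfolding L by (simp add: gcross_simps linear_add[OF p] linear_cmul[OF p])
  have pq: "p (gcross h (e 1) (e 2)) = s * p (e 3)" "p (gcross h (e 2) (e 3)) = s * p (e 1)" "p (gcross h (e 3) (e 1)) = s * p (e 2)"
    "p (gcross h (e 2) (e 1)) = - s * p (e 3)" "p (gcross h (e 3) (e 2)) = - s * p (e 1)" "p (gcross h (e 1) (e 3)) = - s * p (e 2)"
    "q (gcross h (e 1) (e 2)) = s * q (e 3)" "q (gcross h (e 2) (e 3)) = s * q (e 1)" "q (gcross h (e 3) (e 1)) = s * q (e 2)"
    "q (gcross h (e 2) (e 1)) = - s * q (e 3)" "q (gcross h (e 3) (e 2)) = - s * q (e 1)" "q (gcross h (e 1) (e 3)) = - s * q (e 2)"
    "p (gcross h v v) = 0" "q (gcross h v v) = 0" for v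
    unfolding s(2-) gcross_self by (simp_all add: linear_cmul[OF p] linear_cmul[OF q] linear_neg[OF p] linear_neg[OF q] linear_0[OF p] linear_0[OF q])
  show ?thesis
    unfolding ps sum_3 pq tr2_def using s(1) by (elim disjE) (simp_all add: algebra_simps)
qed

text \<open>The contraction behind the element term of \<open>a\<close>; the trace terms cancel.\<close>

lemma ip4_Lend:
  fixes e :: "3 \<Rightarrow> real^3"
  assumes e: "onb h e" and Q: "bilinear Q" "\<And>X Y. Q X Y = Q Y X" and \<sigma>: "bilinear \<sigma>" "\<And>X Y. \<sigma> X Y = \<sigma> Y X"
    and U: "bilinear U"
  shows "ip4 e (\<lambda>X Y Z W. Aop h Q (Lend h \<sigma> X) Y Z W) (Aop h U) - 1/2 * tr2 e \<sigma> * ip4 e (Aop h Q) (Aop h U)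
     = - 2 * triple e Q \<sigma> U"
proof -
  note b = bilinear_simps[OF Q(1)] bilinear_simps[OF U]
  let ?g = "gcross h"
  have 1: "(\<Sum>k\<in>UNIV. \<Sum>l\<in>UNIV. Q v (?g (e k) (e l)) * U w (?g (e k) (e l))) = 2 * (\<Sum>m\<in>UNIV. Q v (e m) * U w (e m))" for v w
    by (rule sum_gcross[OF e]) (simp_all add: b)
  have lQ: "linear (\<lambda>v. Q v w)" and lU: "linear (\<lambda>v. U v w)" for w using Q(1) U unfolding bilinear_def by blast+
  have "ip4 e (\<lambda>X Y Z W. Aop h Q (Lend h \<sigma> X) Y Z W) (Aop h U)
     = (\<Sum>i\<in>UNIV. \<Sum>j\<in>UNIV. \<Sum>k\<in>UNIV. \<Sum>l\<in>UNIV. Q (?g (Lend h \<sigma> (e i)) (e j)) (?g (e k) (e l)) * U (?g (e i) (e j)) (?g (e k) (e l)))"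
    by (simp add: ip4_def Aop_def)
  also have "\<dots> = 2 * (\<Sum>i\<in>UNIV. \<Sum>j\<in>UNIV. \<Sum>m\<in>UNIV. Q (?g (Lend h \<sigma> (e i)) (e j)) (e m) * U (?g (e i) (e j)) (e m))"
    by (simp add: 1 sum_distrib_left)
  also have "\<dots> = 2 * (\<Sum>m\<in>UNIV. \<Sum>i\<in>UNIV. \<Sum>j\<in>UNIV. Q (?g (Lend h \<sigma> (e i)) (e j)) (e m) * U (?g (e i) (e j)) (e m))"
    by (simp add: sum_3)
  also have "\<dots> = 2 * (\<Sum>m\<in>UNIV. tr2 e \<sigma> * (\<Sum>a\<in>UNIV. Q (e a) (e m) * U (e a) (e m))
       - (\<Sum>a\<in>UNIV. \<Sum>b\<in>UNIV. \<sigma> (e a) (e b) * Q (e a) (e m) * U (e b) (e m)))"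
    by (simp only: sum_Lend_gcross[OF e \<sigma>(1) lQ lU])
  finally show ?thesis
    using Q(2)[of "e 1" "e 2"] Q(2)[of "e 1" "e 3"] Q(2)[of "e 2" "e 3"]
      \<sigma>(2)[of "e 1" "e 2"] \<sigma>(2)[of "e 1" "e 3"] \<sigma>(2)[of "e 2" "e 3"]
    unfolding ip4_Aop[OF e Q(1) U]
    by (simp add: ip2_def triple_def sum_3 algebra_simps)
qed

end


section \<open>Contractions on facets and edges\<close>

context inner3
begin

lemma onb_facet:
  fixes e :: "2 \<Rightarrow> real^3"
  assumes "onb h e" "h n n = 1" "\<And>i. h n (e i) = 0"
  shows "onb h (frame3 (e 1) (e 2) n)"
  by (rule onb_frame3) (use assms hsym in \<open>auto simp: onb_def\<close>)

lemma gcross_facet: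
  fixes e :: "2 \<Rightarrow> real^3"
  assumes "onb h e" "h n n = 1" "\<And>i. h n (e i) = 0"
  obtains s where "s = 1 \<or> s = (-1::real)" "gcross h n (e 1) = s *\<^sub>R e 2" "gcross h n (e 2) = - s *\<^sub>R e 1"
    "gcross h (e 1) n = - s *\<^sub>R e 2" "gcross h (e 2) n = s *\<^sub>R e 1" "gcross h (e 1) (e 2) = s *\<^sub>R n"
proof -
  let ?f = "frame3 (e 1) (e 2) n"
  obtain s where "s = 1 \<or> s = (-1::real)"
    "gcross h (?f 1) (?f 2) = s *\<^sub>R ?f 3" "gcross h (?f 2) (?f 3) = s *\<^sub>R ?f 1" "gcross h (?f 3) (?f 1) = s *\<^sub>R ?f 2"
    "gcross h (?f 2) (?f 1) = - s *\<^sub>R ?f 3" "gcross h (?f 3) (?f 2) = - s *\<^sub>R ?f 1" "gcross h (?f 1) (?f 3) = - s *\<^sub>R ?f 2"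
    by (rule gcross_frame[OF onb_facet[OF assms]])
  then show ?thesis by (intro that[of s]) simp_all
qed

lemma Aop_facet:
  fixes e :: "2 \<Rightarrow> real^3"
  assumes e: "onb h e" "h n n = 1" "\<And>i. h n (e i) = 0" and U: "bilinear U" "\<And>X Y. U X Y = U Y X"
  shows "Aop h U (e i) n n (e j) = (if i = j then tr2 e U else 0) - U (e i) (e j)"
proof -
  obtain s where s: "s = 1 \<or> s = (-1::real)" "gcross h n (e 1) = s *\<^sub>R e 2" "gcross h n (e 2) = - s *\<^sub>R e 1"
    "gcross h (e 1) n = - s *\<^sub>R e 2" "gcross h (e 2) n = s *\<^sub>R e 1"
    by (rule gcross_facet[OF e])
  have "\<forall>i j. Aop h U (e i) n n (e j) = (if i = j then tr2 e U else 0) - U (e i) (e j)"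
    using s(1) U(2)[of "e 1" "e 2"]
    by (auto simp: forall_2 Aop_def s(2-) tr2_def sum_2 bilinear_simps[OF U(1)])
  then show ?thesis by blast
qed

text \<open>M collects the two terms of the facet integrand that contain the full derivative of
  \<sigma>. Rotation by n exchanges the diagonal entries of M and sends each off-diagonal entry to
  minus its transpose; symmetry of U on the facet undoes the transposition.\<close>

lemma ip2_curl_facet:
  fixes e :: "2 \<Rightarrow> real^3"
  assumes e: "onb h e" "h n n = 1" "\<And>i. h n (e i) = 0" and U: "U (e 1) (e 2) = U (e 2) (e 1)"
    and C: "bilinear C" "\<And>X Y Z. C X (gcross h Y Z) = D Y X Z - D Z X Y" and D: "\<And>X Y Z. D X Y Z = D X Z Y"
  defines "M \<equiv> \<lambda>X Y. D X n Y - D n X Y"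
  shows "ip2 e (tcross h (transp2 C) n) U = - ip2 e (\<lambda>X Y. M X Y - tr2 e M * h X Y) U"
proof -
  obtain s where s: "s = 1 \<or> s = (-1::real)" "gcross h n (e 1) = s *\<^sub>R e 2" "gcross h n (e 2) = - s *\<^sub>R e 1"
    "gcross h (e 1) n = - s *\<^sub>R e 2" "gcross h (e 2) n = s *\<^sub>R e 1"
    by (rule gcross_facet[OF e])
  have ss: "s * s = 1" using s(1) by auto
  have 1: "C X (e 1) = s * (D (e 2) X n - D n X (e 2))" and 2: "C X (e 2) = s * (D n X (e 1) - D (e 1) X n)" for X
  proof -
    have "s * C X (e 1) = D (e 2) X n - D n X (e 2)" "s * C X (e 2) = D n X (e 1) - D (e 1) X n"
      using C(2)[of X "e 2" n] C(2)[of X n "e 1"] s by (simp_all add: bilinear_simps[OF C(1)])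
    then show "C X (e 1) = s * (D (e 2) X n - D n X (e 2))" "C X (e 2) = s * (D n X (e 1) - D (e 1) X n)"
      using s(1) by auto
  qed
  note h11 = onb_in[OF e(1), of 1 1] onb_in[OF e(1), of 1 2] onb_in[OF e(1), of 2 1] onb_in[OF e(1), of 2 2]
  have t: "tcross h (transp2 C) n (e 1) (e 1) = M (e 2) (e 2)" "tcross h (transp2 C) n (e 2) (e 2) = M (e 1) (e 1)"
    "tcross h (transp2 C) n (e 1) (e 2) = - M (e 2) (e 1)" "tcross h (transp2 C) n (e 2) (e 1) = - M (e 1) (e 2)"
    using s(1) unfolding tcross_def transp2_def M_def s(2-) bilinear_simps[OF C(1)] unfolding 1 2
    by (auto simp: D[of _ "e 1" n] D[of _ "e 2" n] D[of n "e 2" "e 1"])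
  show ?thesis
    unfolding ip2_def sum_2 t tr2_def h11 using U by (simp add: algebra_simps)
qed

text \<open>A vector t orthogonal to n and m is a multiple of n \<times> m, and the sign of the
  multiple is invisible to U. In this form t enters only through \<open>h t t\<close> and
  \<open>U t t\<close>, which along an edge are the same for all adjacent elements.\<close>

lemma tangent_component:
  assumes "h n n = 1" "h m m = 1" "h n m = 0" "h t n = 0" "h t m = 0" and U: "bilinear U"
  shows "U (gcross h n m) (gcross h n m) * h t t = U t t"
proof (cases "t = 0")
  case True
  then show ?thesis by (simp add: bilinear_simps[OF U] h_simps)
next
  case False
  define a where "a = unit_vec h t"
  define r where "r = sqrt (h t t)"
  have r: "h t t = r * r" using nonneg[of t] by (simp add: r_def)
  have t: "t = r *\<^sub>R a" using pos[OF False] by (simp add: a_def unit_vec_def r_def)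
  have "onb h (frame3 a n m)"
    using assms unit_vec_unit[OF False] by (intro onb_frame3) (auto simp: a_def unit_vec_def h_simps)
  then obtain s where "s = 1 \<or> s = (-1::real)" "gcross h n m = s *\<^sub>R a"
    by (rule gcross_frame) auto
  then show ?thesis by (subst (2 3) t) (auto simp: r bilinear_simps[OF U])
qed

end

subsection \<open>Geometry of a curved tetrahedron\<close>

lemma has_derivative_unique_at:
  "(f has_derivative f1) (at x) \<Longrightarrow> (f has_derivative f2) (at x) \<Longrightarrow> f1 v = f2 v"
  using has_derivative_unique by metis

text \<open>The barycentric coordinate of the vertex w. It separates w from the faces that omit it,
  both for identifying the vertices of a face and for telling the inward side.\<close>

lemma barycentric:
  assumes "w \<in> ref_verts"
  obtains L :: "real^3 \<Rightarrow> real" and c where "linear L" "\<forall>v\<in>ref_verts. c + L v = (if v = w then 1 else 0)"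
proof -
  have l: "linear (\<lambda>v::real^3. v $ i)" for i by (simp add: linear_iff)
  have d: "axis i (1::real) \<noteq> 0" "(0::real^3) \<noteq> axis i 1" "axis i (1::real) = axis j 1 \<longleftrightarrow> i = j" for i j :: 3
    by (auto simp: axis_eq_axis axis_def vec_eq_iff)
  have e: "axis i (1::real) $ j = (if i = j then 1 else 0)" for i j :: 3 by (simp add: axis_def)
  consider "w = 0" | i where "w = axis i 1" using assms unfolding ref_verts_def by auto
  then show ?thesis
  proof cases
    case 1
    show ?thesis
      by (rule that[of "\<lambda>v. - (v$1 + v$2 + v$3)" 1])
         (auto simp: 1 ref_verts_def linear_iff d e algebra_simps)
  next
    case (2 i)
    show ?thesis
      by (rule that[OF l[of i], of 0]) (auto simp: 2 ref_verts_def d e)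
  qed
qed

lemma affine_hull_bound:
  fixes L :: "real^3 \<Rightarrow> real"
  assumes "linear L" "\<And>v. v \<in> V \<Longrightarrow> c + L v \<ge> 0" "p \<in> convex hull V"
  shows "c + L p \<ge> 0"
proof -
  have "convex {p. c + L p \<ge> 0}"
  proof (rule convexI)
    fix x y u v assume *: "x \<in> {p. c + L p \<ge> 0}" "y \<in> {p. c + L p \<ge> 0}" "0 \<le> u" "0 \<le> v" "u + v = (1::real)"
    have "u = 1 - v" using *(5) by simp
    then have "c + L (u *\<^sub>R x + v *\<^sub>R y) = u * (c + L x) + v * (c + L y)"
      by (simp only: linear_add[OF assms(1)] linear_cmul[OF assms(1)]) (simp add: algebra_simps)
    then show "u *\<^sub>R x + v *\<^sub>R y \<in> {p. c + L p \<ge> 0}" using * by simp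
  qed
  then have "convex hull V \<subseteq> {p. c + L p \<ge> 0}" using assms(2) by (intro hull_minimal) auto
  then show ?thesis using assms(3) by auto
qed

lemma affine_hull_zero:
  fixes L :: "real^3 \<Rightarrow> real"
  assumes "linear L" "\<And>v. v \<in> V \<Longrightarrow> c + L v = 0" "p \<in> convex hull V"
  shows "c + L p = 0"
proof -
  have "c + L p \<ge> 0" by (rule affine_hull_bound[OF assms(1) _ assms(3)]) (simp add: assms(2))
  moreover have "- c + - L p \<ge> 0"
  proof (rule affine_hull_bound[OF linear_compose_neg[OF assms(1)] _ assms(3)])
    fix v assume "v \<in> V"
    then show "0 \<le> - c + - L v" using assms(2)[of v] by linarith
  qed
  ultimately show ?thesis by linarith
qed

lemma finite_ref_verts: "finite ref_verts" "card ref_verts = 4"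
  by (auto simp: ref_verts_def axis_eq_axis card_insert_if)

text \<open>The barycentric coordinate of a vertex outside V vanishes on the hull of V but is 1 at
  that vertex. Used to recognise an edge that lies in a facet as spanned by two of its
  vertices.\<close>

lemma vertex_in_hull:
  assumes "V \<subseteq> ref_verts" "W \<subseteq> ref_verts" "convex hull W \<subseteq> convex hull V"
  shows "W \<subseteq> V"
proof
  fix w assume w: "w \<in> W"
  then have wr: "w \<in> ref_verts" using assms(2) by auto
  obtain L :: "real^3 \<Rightarrow> real" and c where L: "linear L" "\<forall>v\<in>ref_verts. c + L v = (if v = w then 1 else 0)"
    by (rule barycentric[OF wr])
  show "w \<in> V"
  proof (rule ccontr)
    assume "w \<notin> V"
    then have "c + L w = 0"
    proof (intro affine_hull_zero[OF L(1) _ subsetD[OF assms(3) hull_inc[OF w]]])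
      fix v assume "v \<in> V"
      then show "c + L v = 0" using L(2) assms(1) \<open>w \<notin> V\<close> by (metis subsetD)
    qed
    then show False using L(2) wr by fastforce
  qed
qed

lemma hull_direction:
  assumes "p \<in> convex hull V" "a \<in> V" "q \<in> convex hull V"
  shows "q - p \<in> span ((\<lambda>v. v - a) ` V)"
proof -
  have *: "q - a \<in> span ((\<lambda>v. v - a) ` V)" if "q \<in> convex hull V" for q
  proof -
    have "convex ((\<lambda>v. v + a) ` span ((\<lambda>v. v - a) ` V))"
      using convex_translation[of "span ((\<lambda>v. v - a) ` V)" a] by (simp add: subspace_imp_convex add.commute)
    moreover have "V \<subseteq> (\<lambda>v. v + a) ` span ((\<lambda>v. v - a) ` V)"
    proof
      fix v assume "v \<in> V"
      then have "v - a \<in> span ((\<lambda>v. v - a) ` V)" by (intro span_base) auto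
      then show "v \<in> (\<lambda>v. v + a) ` span ((\<lambda>v. v - a) ` V)" by (intro image_eqI[of _ _ "v - a"]) auto
    qed
    ultimately have "convex hull V \<subseteq> (\<lambda>v. v + a) ` span ((\<lambda>v. v - a) ` V)" by (rule hull_minimal[rotated])
    then show ?thesis using that by auto
  qed
  have "q - p = (q - a) - (p - a)" by simp
  then show ?thesis using *[OF assms(1)] *[OF assms(3)] span_diff by metis
qed

lemma curve_limit:
  fixes c :: "real \<Rightarrow> 'a::real_normed_vector"
  assumes "(c has_vector_derivative v) (at 0 within {0..1})"
  shows "((\<lambda>y. (c y - c 0) /\<^sub>R y) \<longlongrightarrow> v) (at 0 within {0..1})"
proof -
  have "((\<lambda>y. ((c y - c 0) - (y - 0) *\<^sub>R v) /\<^sub>R norm (y - 0)) \<longlongrightarrow> 0) (at 0 within {0..1})"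
    using assms unfolding has_vector_derivative_def has_derivative_at_within by simp
  then have "((\<lambda>y. ((c y - c 0) - y *\<^sub>R v) /\<^sub>R y) \<longlongrightarrow> 0) (at 0 within {0..1})"
    by (rule Lim_transform_eventually) (auto simp: eventually_at intro!: exI[of _ 1])
  then have "((\<lambda>y. ((c y - c 0) - y *\<^sub>R v) /\<^sub>R y + v) \<longlongrightarrow> 0 + v) (at 0 within {0..1})"
    by (intro tendsto_add tendsto_const)
  then have "((\<lambda>y. ((c y - c 0) - y *\<^sub>R v) /\<^sub>R y + v) \<longlongrightarrow> v) (at 0 within {0..1})" by simp
  then show ?thesis
    by (rule Lim_transform_eventually) (auto simp: eventually_at scaleR_diff_right intro!: exI[of _ 1])
qed

lemma curve_linear_sign:
  fixes L :: "'a::euclidean_space \<Rightarrow> real"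
  assumes "linear L" and c: "(c has_vector_derivative v) (at (0::real) within {0..1})" "\<And>t. t \<in> {0..1} \<Longrightarrow> L (c t - c 0) \<ge> 0"
  shows "L v \<ge> 0"
proof -
  have bl: "bounded_linear L" using assms(1) by (simp add: linear_conv_bounded_linear)
  have "((\<lambda>y. L ((c y - c 0) /\<^sub>R y)) \<longlongrightarrow> L v) (at 0 within {0..1})"
    by (rule bounded_linear.tendsto[OF bl curve_limit[OF c(1)]])
  moreover have "eventually (\<lambda>y. L ((c y - c 0) /\<^sub>R y) \<ge> 0) (at 0 within {0..1})"
    unfolding eventually_at
    by (rule exI[of _ 1]) (use c(2) in \<open>auto simp: linear_cmul[OF assms(1)]\<close>)
  moreover have "at (0::real) within {0..1} \<noteq> bot" by (simp add: trivial_limit_within islimpt_Icc)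
  ultimately show ?thesis by (intro tendsto_lowerbound)
qed

locale element =
  fixes \<phi> :: "real^3 \<Rightarrow> real^3" and T N \<psi>
  assumes T: "T = \<phi> ` ref_tet" and N: "open N" "ref_tet \<subseteq> N" and \<phi>: "smooth_on N \<phi>"
    and \<psi>: "open (\<phi> ` N)" "smooth_on (\<phi> ` N) \<psi>" and inv: "p \<in> N \<Longrightarrow> \<psi> (\<phi> p) = p"
begin

text \<open>The chart derivative in a fixed reference direction u, regarded as a field on the
  element. For u parallel to a reference face this field is tangent to the image of the
  face.\<close>

definition push :: "real^3 \<Rightarrow> real^3 \<Rightarrow> real^3" where
  "push u y = frechet_derivative \<phi> (at (\<psi> y)) u"

definition pull :: "real^3 \<Rightarrow> real^3 \<Rightarrow> real^3" where
  "pull y = frechet_derivative \<psi> (at y)"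

lemma d\<phi>: "p \<in> N \<Longrightarrow> (\<phi> has_derivative (\<lambda>u. push u (\<phi> p))) (at p)"
  using C_k_on_has_derivative[of 0 N \<phi> p] \<phi> unfolding smooth_on_def push_def by (simp add: inv del: C_k_on.simps)

lemma d\<psi>: "y \<in> \<phi> ` N \<Longrightarrow> (\<psi> has_derivative pull y) (at y)"
  using C_k_on_has_derivative[of 0 "\<phi> ` N" \<psi> y] \<psi>(2) unfolding smooth_on_def pull_def by blast

lemma T_sub: "T \<subseteq> \<phi> ` N" using T N by auto

lemma pull_push: assumes "y \<in> \<phi> ` N" shows "pull y (push u y) = u"
proof -
  obtain p where p: "p \<in> N" "y = \<phi> p" using assms by auto
  have "((\<lambda>q. \<psi> (\<phi> q)) has_derivative (\<lambda>u. pull y (push u y))) (at p)"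
    using has_derivative_compose[OF d\<phi>[OF p(1)] d\<psi>[of "\<phi> p"]] p by simp
  moreover have "((\<lambda>q. \<psi> (\<phi> q)) has_derivative (\<lambda>u. u)) (at p)"
    by (rule has_derivative_transform_within_open[OF has_derivative_ident N(1) p(1)]) (simp add: inv)
  ultimately show ?thesis using has_derivative_unique_at by blast
qed

lemma push_pull: assumes "y \<in> \<phi> ` N" shows "push (pull y v) y = v"
proof -
  obtain p where p: "p \<in> N" "y = \<phi> p" using assms by auto
  have "((\<lambda>z. \<phi> (\<psi> z)) has_derivative (\<lambda>v. push (pull y v) y)) (at y)"
    using has_derivative_compose[OF d\<psi>[OF assms], of \<phi> "\<lambda>u. push u y"] d\<phi>[OF p(1)] p by (simp add: inv)
  moreover have "((\<lambda>z. \<phi> (\<psi> z)) has_derivative (\<lambda>v. v)) (at y)"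
    by (rule has_derivative_transform_within_open[OF has_derivative_ident \<psi>(1) assms]) (auto simp: inv)
  ultimately show ?thesis using has_derivative_unique_at by blast
qed

lemma linear_push: assumes "y \<in> \<phi> ` N" shows "linear (\<lambda>u. push u y)"
  using assms d\<phi> has_derivative_linear by blast

lemma linear_pull: assumes "y \<in> \<phi> ` N" shows "linear (pull y)"
  using d\<psi>[OF assms] has_derivative_linear by blast

lemma smooth_push: "smooth_upto T (push u)"
proof (rule smooth_uptoI[OF \<psi>(1) T_sub])
  show "smooth_on (\<phi> ` N) (push u)"
    unfolding smooth_on_def
  proof
    fix k
    have "C_k_on k N (\<lambda>p. frechet_derivative \<phi> (at p) u)"
      using smooth_on_derivative[OF \<phi>] unfolding smooth_on_def by blast
    moreover have "C_k_on k (\<phi> ` N) \<psi>" using \<psi>(2) unfolding smooth_on_def by blast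
    ultimately have "C_k_on k (\<phi> ` N) (\<lambda>y. frechet_derivative \<phi> (at (\<psi> y)) u)"
      by (intro C_k_on_compose[OF \<psi>(1) N(1), where h=\<psi> and f="\<lambda>p. frechet_derivative \<phi> (at p) u"]) (auto simp: inv)
    then show "C_k_on k (\<phi> ` N) (push u)" unfolding push_def .
  qed
qed simp

lemma hull_sub: "V \<subseteq> ref_verts \<Longrightarrow> convex hull V \<subseteq> ref_tet"
  unfolding ref_tet_def by (rule hull_mono)

lemma face_sub: "V \<subseteq> ref_verts \<Longrightarrow> \<phi> ` (convex hull V) \<subseteq> T"
  using hull_sub T by blast

lemma curve_cone:
  assumes V: "V \<subseteq> ref_verts" and p: "p \<in> convex hull V" and q: "q \<in> convex hull V" and r: "r \<ge> 0"
  shows "r *\<^sub>R push (q - p) (\<phi> p) \<in> tangent_cone (\<phi> ` (convex hull V)) (\<phi> p)"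
proof -
  \<comment> \<open>The curve follows the segment from p towards q with speed r and stops at q, so
    it stays in the hull for all times up to 1. Near time 0 the cutoff is inactive and does not
    affect the derivative.\<close>
  define c where "c t = \<phi> (p + min (r * t) 1 *\<^sub>R (q - p))" for t :: real
  have pN: "p \<in> N" using p hull_sub[OF V] N by auto
  have "((\<lambda>t. \<phi> (p + (r * t) *\<^sub>R (q - p))) has_derivative (\<lambda>t. push ((r * t) *\<^sub>R (q - p)) (\<phi> p))) (at 0)"
  proof -
    have "((\<lambda>t. p + (r * t) *\<^sub>R (q - p)) has_derivative (\<lambda>t. (r * t) *\<^sub>R (q - p))) (at 0)"
      by (auto intro!: derivative_eq_intros)
    from has_derivative_compose[OF this, of \<phi>] d\<phi>[OF pN] show ?thesis by simp
  qed
  then have d0: "((\<lambda>t. \<phi> (p + (r * t) *\<^sub>R (q - p))) has_vector_derivative r *\<^sub>R push (q - p) (\<phi> p)) (at 0)"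
    using linear_cmul[OF linear_push[of "\<phi> p"]] pN unfolding has_vector_derivative_def by (simp add: mult.commute)
  define d where "d = 1 / (r + 1)"
  have d: "d > 0" "r * d \<le> 1" using r by (auto simp: d_def)
  have "(c has_vector_derivative r *\<^sub>R push (q - p) (\<phi> p)) (at 0)"
  proof (rule has_vector_derivative_transform_within_open[OF d0, of "{-d<..<d}"])
    fix t assume t: "t \<in> {-d<..<d}"
    have "r * t \<le> 1" using mult_left_mono[of t d r] t r d(2) by auto
    then show "\<phi> (p + (r * t) *\<^sub>R (q - p)) = c t" by (simp add: c_def min_def)
  qed (use d in auto)
  then have "(c has_vector_derivative r *\<^sub>R push (q - p) (\<phi> p)) (at 0 within {0..1})"
    by (rule has_vector_derivative_at_within)
  moreover have "c t \<in> \<phi> ` (convex hull V)" if "t \<in> {0..1}" for t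
  proof -
    have "p + u *\<^sub>R (q - p) \<in> convex hull V" if "0 \<le> u" "u \<le> 1" for u
    proof -
      have "p + u *\<^sub>R (q - p) = (1 - u) *\<^sub>R p + u *\<^sub>R q" by (simp add: algebra_simps)
      then show ?thesis using convexD_alt[OF convex_convex_hull p q that] by simp
    qed
    then show ?thesis using that r by (simp add: c_def)
  qed
  moreover have "c 0 = \<phi> p" by (simp add: c_def)
  ultimately show ?thesis unfolding tangent_cone_def by blast
qed

lemma pull_curve:
  assumes V: "V \<subseteq> ref_verts" and p: "p \<in> convex hull V" and v: "v \<in> tangent_cone (\<phi> ` (convex hull V)) (\<phi> p)"
  obtains c where "c 0 = p" "\<forall>t\<in>{0..1}. c t \<in> convex hull V"
    "(c has_vector_derivative pull (\<phi> p) v) (at (0::real) within {0..1})"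
proof -
  obtain c where c: "c 0 = \<phi> p" "\<forall>t\<in>{0..1}. c t \<in> \<phi> ` (convex hull V)" "(c has_vector_derivative v) (at (0::real) within {0..1})"
    using v unfolding tangent_cone_def by blast
  have pN: "p \<in> N" using p hull_sub[OF V] N by auto
  have in_N: "q \<in> N" if "q \<in> convex hull V" for q using that hull_sub[OF V] N by auto
  have "(\<psi> \<circ> c has_derivative pull (\<phi> p) \<circ> (\<lambda>t. t *\<^sub>R v)) (at 0 within {0..1})"
  proof (rule diff_chain_within)
    show "(c has_derivative (\<lambda>t. t *\<^sub>R v)) (at 0 within {0..1})" using c(3) unfolding has_vector_derivative_def .
    show "(\<psi> has_derivative pull (\<phi> p)) (at (c 0) within c ` {0..1})"
      using d\<psi>[of "\<phi> p"] pN c(1) by (auto intro: has_derivative_at_withinI)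
  qed
  then have "(\<psi> \<circ> c has_vector_derivative pull (\<phi> p) v) (at 0 within {0..1})"
    using linear_cmul[OF linear_pull[of "\<phi> p"]] pN unfolding has_vector_derivative_def comp_def by simp
  moreover have "(\<psi> \<circ> c) t \<in> convex hull V" if "t \<in> {0..1}" for t
    using c(2) that in_N inv by fastforce
  moreover have "(\<psi> \<circ> c) 0 = p" using c(1) pN by (simp add: inv)
  ultimately show ?thesis using that by blast
qed

text \<open>Valid also at boundary points of the face. Pulled back to the reference element, the
  difference quotients of a curve lie in a linear subspace, which is closed; conversely, the
  segments from p to the vertices already produce a spanning set.\<close>

lemma tangent_space_face:
  assumes V: "V \<subseteq> ref_verts" and a: "a \<in> V" and x: "x \<in> \<phi> ` (convex hull V)"
  shows "tangent_space (\<phi> ` (convex hull V)) x = (\<lambda>u. push u x) ` span ((\<lambda>v. v - a) ` V)"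
proof -
  obtain p where p: "p \<in> convex hull V" "x = \<phi> p" using x by auto
  let ?W = "span ((\<lambda>v. v - a) ` V)"
  have xN: "x \<in> \<phi> ` N" using p hull_sub[OF V] N by auto
  have "tangent_cone (\<phi> ` (convex hull V)) x \<subseteq> (\<lambda>u. push u x) ` ?W"
  proof
    fix v assume "v \<in> tangent_cone (\<phi> ` (convex hull V)) x"
    then obtain c where c: "c 0 = p" "\<forall>t\<in>{0..1}. c t \<in> convex hull V"
      "(c has_vector_derivative pull x v) (at (0::real) within {0..1})"
      using pull_curve[OF V p(1)] p(2) by blast
    note curve_limit[OF c(3)]
    moreover have "eventually (\<lambda>y. (c y - c 0) /\<^sub>R y \<in> ?W) (at 0 within {0..1})"
      unfolding eventually_at
      by (rule exI[of _ 1]) (use c hull_direction[OF p(1) a] in \<open>auto intro!: span_scale\<close>)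
    moreover have "at (0::real) within {0..1} \<noteq> bot" by (simp add: trivial_limit_within islimpt_Icc)
    ultimately have "pull x v \<in> ?W" by (intro Lim_in_closed_set[OF closed_span, of _ _ "at 0 within {0..1}"])
    then show "v \<in> (\<lambda>u. push u x) ` ?W" by (intro image_eqI[of _ _ "pull x v"]) (simp_all add: push_pull[OF xN])
  qed
  moreover have sub: "subspace ((\<lambda>u. push u x) ` ?W)"
    by (rule linear_subspace_image[OF linear_push[OF xN] subspace_span])
  ultimately have 1: "tangent_space (\<phi> ` (convex hull V)) x \<subseteq> (\<lambda>u. push u x) ` ?W"
    unfolding tangent_space_def by (rule span_minimal)
  have c: "push (q - p) x \<in> tangent_space (\<phi> ` (convex hull V)) x" if "q \<in> convex hull V" for q
    using curve_cone[OF V p(1) that, of 1] p(2) unfolding tangent_space_def by (auto intro: span_base)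
  have "push (v - a) x \<in> tangent_space (\<phi> ` (convex hull V)) x" if "v \<in> V" for v
  proof -
    have "push (v - a) x = push (v - p) x - push (a - p) x"
      using linear_diff[OF linear_push[OF xN], of "v - p" "a - p"] by simp
    then show ?thesis using c[of v] c[of a] that a unfolding tangent_space_def by (simp add: hull_inc span_diff)
  qed
  then have "(\<lambda>u. push u x) ` ((\<lambda>v. v - a) ` V) \<subseteq> tangent_space (\<phi> ` (convex hull V)) x" by auto
  then have "span ((\<lambda>u. push u x) ` ((\<lambda>v. v - a) ` V)) \<subseteq> tangent_space (\<phi> ` (convex hull V)) x"
    unfolding tangent_space_def by (intro span_minimal subspace_span)
  then show ?thesis using 1 linear_span_image[OF linear_push[OF xN]] by auto
qed

text \<open>By this, derivatives within an element are unique in all directions, corners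
  included.\<close>

lemma tangent_space_T: 
  assumes "x \<in> T" shows "tangent_space T x = UNIV"
proof -
  have 0: "0 \<in> ref_verts" by (simp add: ref_verts_def)
  have "span ((\<lambda>v. v - 0) ` ref_verts) = UNIV"
  proof -
    have "v \<in> span ref_verts" for v
      by (subst vec3_expand) (intro span_add span_scale span_base, auto simp: ref_verts_def)
    then show ?thesis by auto
  qed
  then have "tangent_space T x = (\<lambda>u. push u x) ` UNIV"
    using tangent_space_face[OF subset_refl 0, of x] assms unfolding T ref_tet_def by simp
  moreover have "v \<in> (\<lambda>u. push u x) ` UNIV" for v
    by (intro image_eqI[of _ _ "pull x v"]) (use push_pull[of x v] assms T_sub in auto)
  ultimately show ?thesis by auto
qed

text \<open>l is the barycentric coordinate of w pulled back by the chart. It is zero on the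
  opposite face and nonnegative on every face joined to w, so a curve starting on the opposite face
  cannot decrease it to first order.\<close>

lemma functional:
  assumes x: "x \<in> T" and w: "w \<in> ref_verts"
  obtains l :: "real^3 \<Rightarrow> real" where "linear l"
    "\<forall>v\<in>ref_verts. \<forall>a\<in>ref_verts. l (push (v - a) x) = (if v = w then 1 else 0) - (if a = w then 1 else 0)"
    "\<forall>V v. V \<subseteq> ref_verts \<longrightarrow> w \<notin> V \<longrightarrow> x \<in> \<phi> ` (convex hull V) \<longrightarrow> v \<in> tangent_cone (\<phi> ` (convex hull (insert w V))) x \<longrightarrow> l v \<ge> 0"
proof -
  obtain L :: "real^3 \<Rightarrow> real" and c where L: "linear L" "\<forall>v\<in>ref_verts. c + L v = (if v = w then 1 else 0)"
    by (rule barycentric[OF w])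
  have xN: "x \<in> \<phi> ` N" using x T_sub by auto
  have "L (v - a) = (if v = w then 1 else 0) - (if a = w then 1 else 0)" if "v \<in> ref_verts" "a \<in> ref_verts" for v a
    using L(2)[rule_format, OF that(1)] L(2)[rule_format, OF that(2)] linear_diff[OF L(1), of v a] by linarith
  moreover have "L (pull x v) \<ge> 0"
    if V: "V \<subseteq> ref_verts" "w \<notin> V" "x \<in> \<phi> ` (convex hull V)" and v: "v \<in> tangent_cone (\<phi> ` (convex hull (insert w V))) x" for V v
  proof -
    obtain p where p: "p \<in> convex hull V" "x = \<phi> p" using V by auto
    have p': "p \<in> convex hull (insert w V)" using p(1) hull_mono[of V "insert w V"] by auto
    have iV: "insert w V \<subseteq> ref_verts" using V w by auto
    obtain c' where c: "c' 0 = p" "\<forall>t\<in>{0..1}. c' t \<in> convex hull (insert w V)"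
      "(c' has_vector_derivative pull x v) (at (0::real) within {0..1})"
      using pull_curve[OF iV p'] v p(2) by blast
    have "c + L p = 0" by (rule affine_hull_zero[OF L(1) _ p(1)]) (use V L(2) in \<open>auto simp: subset_iff\<close>)
    moreover have "c + L (c' t) \<ge> 0" if "t \<in> {0..1}" for t
      by (rule affine_hull_bound[OF L(1) _ c(2)[rule_format, OF that]]) (use iV L(2) in \<open>auto simp: subset_iff\<close>)
    ultimately have "L (c' t - c' 0) \<ge> 0" if "t \<in> {0..1}" for t
      using that by (fastforce simp: linear_diff[OF L(1)] c(1))
    then show ?thesis by (rule curve_linear_sign[OF L(1) c(3)])
  qed
  moreover have "linear (\<lambda>v. L (pull x v))" using linear_compose[OF linear_pull[OF xN] L(1)] by (simp add: comp_def)
  ultimately show ?thesis by (intro that[of "\<lambda>v. L (pull x v)"]) (simp_all add: pull_push[OF xN])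
qed

lemma functional_span:
  assumes "linear (l :: real^3 \<Rightarrow> real)" "\<And>v. v \<in> B \<Longrightarrow> l v = 0" "v \<in> span B" shows "l v = 0"
  using linear_eq_0_on_span[OF assms(1,2,3)] by blast

text \<open>Unit length and orthogonality leave only n and -n. The functional l equals r > 0 at n,
  vanishes on vectors tangent to D and is nonnegative on the tangent cone, which rules out -n. The
  form with V and w covers facets of elements and edges of facets at once.\<close>

lemma inward_normal_eq:
  assumes V: "V \<subseteq> ref_verts" and w: "w \<in> ref_verts" "w \<notin> V" and a: "a \<in> V"
    and x: "x \<in> \<phi> ` (convex hull V)" and h: "inner3 h"
  defines "D \<equiv> \<phi> ` (convex hull V)" and "S \<equiv> \<phi> ` (convex hull (insert w V))"
  assumes n: "h n n = 1" "\<And>X. X \<in> tangent_space D x \<Longrightarrow> h n X = 0"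
    and r: "r > 0" "n - r *\<^sub>R push (w - a) x \<in> tangent_space D x"
  shows "inward_normal h S D x = n"
proof -
  interpret inner3 h by (rule h)
  have iV: "insert w V \<subseteq> ref_verts" using V w by auto
  have xT: "x \<in> T" using x face_sub[OF V] by auto
  have xN: "x \<in> \<phi> ` N" using xT T_sub by auto
  obtain p where p: "p \<in> convex hull V" "x = \<phi> p" using x by auto
  have p': "p \<in> convex hull (insert w V)" using p(1) hull_mono[of V "insert w V"] by auto
  have xS: "x \<in> S" unfolding S_def using p p' by auto
  have wV: "w \<in> convex hull (insert w V)" by (simp add: hull_inc)
  obtain l :: "real^3 \<Rightarrow> real" where l: "linear l"
    "\<forall>v\<in>ref_verts. \<forall>a\<in>ref_verts. l (push (v - a) x) = (if v = w then 1 else 0) - (if a = w then 1 else 0)"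
    "\<forall>V v. V \<subseteq> ref_verts \<longrightarrow> w \<notin> V \<longrightarrow> x \<in> \<phi> ` (convex hull V) \<longrightarrow> v \<in> tangent_cone (\<phi> ` (convex hull (insert w V))) x \<longrightarrow> l v \<ge> 0"
    by (rule functional[OF xT w(1)])
  have tD: "tangent_space D x = span ((\<lambda>u. push u x) ` (\<lambda>v. v - a) ` V)"
    unfolding D_def using tangent_space_face[OF V a x] linear_span_image[OF linear_push[OF xN]] by auto
  have tS: "tangent_space S x = span ((\<lambda>u. push u x) ` (\<lambda>v. v - a) ` (insert w V))"
    using tangent_space_face[OF iV _ xS[unfolded S_def], of a, folded S_def] a
    by (simp only: linear_span_image[OF linear_push[OF xN]] insertI2)
  have l0: "l v = 0" if "v \<in> tangent_space D x" for v
    by (rule functional_span[OF l(1) _ that[unfolded tD]]) (use V w a l(2) in \<open>auto simp: subset_iff\<close>)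
  have aw: "a \<in> ref_verts" "a \<noteq> w" using a V w by auto
  have ln: "l n = r"
    using l0[OF r(2)] l(2)[rule_format, OF w(1) aw(1)] aw by (simp add: linear_diff[OF l(1)] linear_cmul[OF l(1)])
  have subDS: "tangent_space D x \<subseteq> tangent_space S x" unfolding tD tS by (intro span_mono) auto
  have ps: "push (w - a) x \<in> tangent_space S x" unfolding tS by (intro span_base) auto
  have subD: "subspace (tangent_space D x)" unfolding tangent_space_def by (rule subspace_span)
  have nS: "n \<in> tangent_space S x"
  proof -
    have "n = (n - r *\<^sub>R push (w - a) x) + r *\<^sub>R push (w - a) x" by simp
    then show ?thesis using r(2) subDS ps unfolding tangent_space_def[of S] by (metis span_add span_scale subsetD)
  qed
  show ?thesis
    unfolding inward_normal_def
  proof (rule the_equality)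
    \<comment> \<open>The direction from the point p itself to w lies in the cone, as it belongs to
      a segment inside the face; it differs from the direction w - a only by a vector tangent to
      D.\<close>
    let ?v = "r *\<^sub>R push (w - p) x"
    have v: "?v \<in> tangent_cone S x"
      unfolding S_def p(2) by (rule curve_cone[OF iV p' wV]) (use r in simp)
    have "push (w - p) x = push (w - a) x + push (a - p) x"
      using linear_add[OF linear_push[OF xN], of "w - a" "a - p"] by simp
    then have eq: "n - ?v = (n - r *\<^sub>R push (w - a) x) - r *\<^sub>R push (a - p) x" by (simp add: algebra_simps)
    have "push (a - p) x \<in> tangent_space D x"
      unfolding D_def tangent_space_face[OF V a x] using hull_direction[OF p(1) a] a by (auto simp: hull_inc)
    then have "n - ?v \<in> tangent_space D x"
      unfolding eq by (intro subspace_diff[OF subD] subspace_scale[OF subD] r(2))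
    with v show "n \<in> tangent_space S x \<and> h n n = 1 \<and> (\<forall>X\<in>tangent_space D x. h n X = 0) \<and> (\<exists>v\<in>tangent_cone S x. n - v \<in> tangent_space D x)"
      using n nS by blast
  next
    fix m assume m: "m \<in> tangent_space S x \<and> h m m = 1 \<and> (\<forall>X\<in>tangent_space D x. h m X = 0) \<and> (\<exists>v\<in>tangent_cone S x. m - v \<in> tangent_space D x)"
    have "m \<in> span (insert (push (w - a) x) ((\<lambda>u. push u x) ` (\<lambda>v. v - a) ` V))" using m tS by simp
    then obtain k where k: "m - k *\<^sub>R push (w - a) x \<in> tangent_space D x"
      unfolding tD span_breakdown_eq by blast
    \<comment> \<open>d is tangent to D and also orthogonal to everything tangent to D, hence zero;
      so m is a multiple of n.\<close>
    define d where "d = m - (k / r) *\<^sub>R n"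
    have eq: "d = (m - k *\<^sub>R push (w - a) x) - (k / r) *\<^sub>R (n - r *\<^sub>R push (w - a) x)"
      using r(1) by (simp add: d_def algebra_simps)
    have d: "d \<in> tangent_space D x"
      unfolding eq by (intro subspace_diff[OF subD] subspace_scale[OF subD] k r(2))
    have "h d d = 0" using m n(2)[OF d] d by (subst (1) d_def) (simp add: h_simps)
    then have "m = (k / r) *\<^sub>R n" using eq_0_iff[of d] by (simp add: d_def)
    then obtain t where t: "m = t *\<^sub>R n" by blast
    have "t * t = 1" using m n(1) by (simp add: t h_simps)
    then have "t = 1 \<or> t = -1" by (metis power2_eq_square power2_eq_1_iff)
    moreover have "t \<noteq> -1"
    proof
      assume "t = -1"
      obtain v where v: "v \<in> tangent_cone S x" "m - v \<in> tangent_space D x" using m by blast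
      have "l v \<ge> 0" using l(3)[rule_format, OF V w(2) x] v(1) unfolding S_def by blast
      moreover have "l m = - r" using ln \<open>t = -1\<close> by (simp add: t linear_neg[OF l(1)])
      ultimately show False using l0[OF v(2)] r(1) by (simp add: linear_diff[OF l(1)])
    qed
    ultimately show "m = n" using t by simp
  qed
qed

lemma push_independent:
  assumes x: "x \<in> T" and v: "a \<in> ref_verts" "b \<in> ref_verts" "c \<in> ref_verts" "w \<in> ref_verts" "distinct [a, b, c, w]"
  shows "push (b - a) x \<noteq> 0" "push (c - a) x \<notin> span {push (b - a) x}"
    "push (w - a) x \<notin> span {push (b - a) x, push (c - a) x}"
proof -
  have e: "\<exists>l :: real^3 \<Rightarrow> real. linear l \<and> (\<forall>v\<in>ref_verts. \<forall>a\<in>ref_verts. l (push (v - a) x) = (if v = q then 1 else 0) - (if a = q then 1 else 0))"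
    if "q \<in> ref_verts" for q
    by (rule functional[OF x that]) (rule exI, rule conjI)
  then obtain l :: "real^3 \<Rightarrow> real^3 \<Rightarrow> real" where l: "\<And>q. q \<in> ref_verts \<Longrightarrow> linear (l q)"
    "\<And>q v a. q \<in> ref_verts \<Longrightarrow> v \<in> ref_verts \<Longrightarrow> a \<in> ref_verts \<Longrightarrow> l q (push (v - a) x) = (if v = q then 1 else 0) - (if a = q then 1 else 0)"
    by metis
  show "push (b - a) x \<noteq> 0" using l(2)[of b b a] linear_0[OF l(1)[of b]] v by auto
  show "push (c - a) x \<notin> span {push (b - a) x}"
    using l(2)[of c c a] functional_span[OF l(1)[of c], of "{push (b - a) x}" "push (c - a) x"] l(2)[of c b a] v by auto
  show "push (w - a) x \<notin> span {push (b - a) x, push (c - a) x}"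
    using l(2)[of w w a] functional_span[OF l(1)[of w], of "{push (b - a) x, push (c - a) x}" "push (w - a) x"] l(2)[of w b a] l(2)[of w c a] v by auto
qed

end


subsection \<open>Calculus of tensor fields on an element\<close>

lemmas smooth_intros = smooth_upto_add smooth_upto_diff smooth_upto_minus smooth_upto_mult smooth_upto_scaleR
  smooth_upto_const smooth_upto_sum smooth_upto_nth

lemma smooth_upto_det:
  fixes A :: "real^3 \<Rightarrow> real^3^3"
  assumes "\<And>i j. smooth_upto D (\<lambda>x. A x $ i $ j)"
  shows "smooth_upto D (\<lambda>x. det (A x))"
  unfolding det_3 by (intro smooth_intros assms)

lemma bilinear_axis:
  fixes B :: tensor2
  assumes "bilinear B"
  shows "B u v = (\<Sum>i\<in>UNIV. \<Sum>j\<in>UNIV. u $ i * v $ j * B (axis i 1) (axis j 1))"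
  by (subst vec3_expand[of u], subst vec3_expand[of v])
     (simp add: sum_3 bilinear_simps[OF assms] algebra_simps)

lemma smooth_upto_bil:
  assumes "\<And>x. x \<in> D \<Longrightarrow> bilinear (B x)" "\<And>X Y. smooth_upto D (\<lambda>x. B x X Y :: real)"
    "smooth_upto D u" "smooth_upto D v"
  shows "smooth_upto D (\<lambda>x. B x (u x :: real^3) (v x :: real^3))"
proof (rule smooth_upto_cong)
  show "smooth_upto D (\<lambda>x. \<Sum>i\<in>UNIV. \<Sum>j\<in>UNIV. u x $ i * v x $ j * B x (axis i 1) (axis j 1))"
    by (intro smooth_intros assms)
qed (rule bilinear_axis[OF assms(1), symmetric])

text \<open>Full tangent spaces at all points make \<open>dD\<close> unique, and thereby additive
  and subject to the product rule.\<close>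

locale full_domain =
  fixes T :: "(real^3) set"
  assumes full: "x \<in> T \<Longrightarrow> tangent_space T x = UNIV"
begin

lemma has_dD: "smooth_upto T f \<Longrightarrow> x \<in> T \<Longrightarrow> (f has_derivative dD T f x) (at x within T)"
  by (rule smooth_upto_has_derivative)

lemma dD_unique: "(f has_derivative f') (at x within T) \<Longrightarrow> x \<in> T \<Longrightarrow> dD T f x v = f' v"
  by (rule dD_eq) (use full in auto)

lemma dD_same: "(\<And>y. y \<in> T \<Longrightarrow> f y = f' y) \<Longrightarrow> smooth_upto T f' \<Longrightarrow> x \<in> T \<Longrightarrow> dD T f x v = dD T f' x v"
  by (rule dD_cong) (use full in auto)

lemma smooth_dD: "smooth_upto T f \<Longrightarrow> smooth_upto T (\<lambda>x. dD T f x v)"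
  by (rule smooth_upto_dD) (use full in auto)

lemma dD_const: "x \<in> T \<Longrightarrow> dD T (\<lambda>_. c) x v = 0"
  by (rule dD_unique) auto

lemma dD_add: "smooth_upto T f \<Longrightarrow> smooth_upto T f' \<Longrightarrow> x \<in> T \<Longrightarrow>
    dD T (\<lambda>y. f y + f' y) x v = dD T f x v + dD T f' x v"
  by (rule dD_unique) (auto intro: has_derivative_add has_dD)

lemma dD_diff: "smooth_upto T f \<Longrightarrow> smooth_upto T f' \<Longrightarrow> x \<in> T \<Longrightarrow>
    dD T (\<lambda>y. f y - f' y) x v = dD T f x v - dD T f' x v"
  by (rule dD_unique) (auto intro: has_derivative_diff has_dD)

lemma dD_mult: 
  fixes f f' :: "real^3 \<Rightarrow> real"
  shows "smooth_upto T f \<Longrightarrow> smooth_upto T f' \<Longrightarrow> x \<in> T \<Longrightarrow>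
    dD T (\<lambda>y. f y * f' y) x v = f x * dD T f' x v + dD T f x v * f' x"
  by (rule dD_unique) (auto intro: has_derivative_mult has_dD)

lemma dD_cmul: 
  fixes f :: "real^3 \<Rightarrow> real"
  shows "smooth_upto T f \<Longrightarrow> x \<in> T \<Longrightarrow> dD T (\<lambda>y. c * f y) x v = c * dD T f x v"
  using dD_mult[OF smooth_upto_const, of f x c v] by (simp add: dD_const)

lemma dD_sum:
  assumes "finite I" "\<And>i. i \<in> I \<Longrightarrow> smooth_upto T (f i)" "x \<in> T"
  shows "dD T (\<lambda>y. \<Sum>i\<in>I. f i y) x v = (\<Sum>i\<in>I. dD T (f i) x v)"
  by (rule dD_unique[OF has_derivative_sum[OF has_dD]]) (use assms in auto)

lemma dD_nth: "smooth_upto T f \<Longrightarrow> x \<in> T \<Longrightarrow> dD T (\<lambda>y. f y $ i) x v = dD T f x v $ i"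
  by (rule dD_unique) (auto intro: bounded_linear.has_derivative[OF bounded_linear_vec_nth] has_dD)

lemma dD_linear: "smooth_upto T f \<Longrightarrow> x \<in> T \<Longrightarrow> linear (dD T f x)"
  using has_dD has_derivative_linear by blast

text \<open>Leibniz rule for a tensor field evaluated on two vector fields. Smoothness of B is known
  only for fixed arguments, so the rule is derived from products of components in the coordinate
  basis.\<close>

lemma dD_bil:
  assumes B: "\<And>x. x \<in> T \<Longrightarrow> bilinear (B x)" "\<And>X Y. smooth_upto T (\<lambda>x. B x X Y :: real)"
    and u: "smooth_upto T u" and v: "smooth_upto T v" and x: "x \<in> T"
  shows "dD T (\<lambda>y. B y (u y :: real^3) (v y :: real^3)) x w
     = dD T (\<lambda>y. B y (u x) (v x)) x w + B x (dD T u x w) (v x) + B x (u x) (dD T v x w)"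
proof -
  let ?b = "\<lambda>i j y. B y (axis i 1) (axis j 1)"
  have 1: "dD T (\<lambda>y. B y (u y) (v y)) x w = dD T (\<lambda>y. \<Sum>i\<in>UNIV. \<Sum>j\<in>UNIV. u y $ i * v y $ j * ?b i j y) x w"
    by (rule dD_same[OF _ _ x]) (rule bilinear_axis[OF B(1)], assumption, intro smooth_intros B(2) u v)
  have 2: "dD T (\<lambda>y. B y a c) x w = (\<Sum>i\<in>UNIV. \<Sum>j\<in>UNIV. a $ i * c $ j * dD T (?b i j) x w)" for a c
  proof -
    have "dD T (\<lambda>y. B y a c) x w = dD T (\<lambda>y. \<Sum>i\<in>UNIV. \<Sum>j\<in>UNIV. (a $ i * c $ j) * ?b i j y) x w"
      by (rule dD_same[OF _ _ x]) (rule bilinear_axis[OF B(1)], assumption, intro smooth_intros B(2))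
    also have "\<dots> = (\<Sum>i\<in>UNIV. \<Sum>j\<in>UNIV. a $ i * c $ j * dD T (?b i j) x w)"
      by (simp add: dD_sum dD_cmul x smooth_intros B(2))
    finally show ?thesis .
  qed
  have 3: "dD T (\<lambda>y. u y $ i * v y $ j * ?b i j y) x w
     = u x $ i * v x $ j * dD T (?b i j) x w + (u x $ i * dD T v x w $ j + dD T u x w $ i * v x $ j) * ?b i j x" for i j
    by (simp add: dD_mult dD_nth x smooth_intros B(2) u v)
  have "dD T (\<lambda>y. \<Sum>i\<in>UNIV. \<Sum>j\<in>UNIV. u y $ i * v y $ j * ?b i j y) x w
     = (\<Sum>i\<in>UNIV. \<Sum>j\<in>UNIV. dD T (\<lambda>y. u y $ i * v y $ j * ?b i j y) x w)"
    by (simp add: dD_sum x smooth_intros B(2) u v)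
  also have "\<dots> = dD T (\<lambda>y. B y (u x) (v x)) x w + B x (dD T u x w) (v x) + B x (u x) (dD T v x w)"
    unfolding 2[of "u x" "v x"] 3 bilinear_axis[OF B(1)[OF x], of "dD T u x w"] bilinear_axis[OF B(1)[OF x], of "u x"]
    by (simp only: sum.distrib[symmetric]) (intro sum.cong refl, simp add: algebra_simps)
  finally show ?thesis using 1 by simp
qed

end

section \<open>Levi-Civita connection of a metric that is smooth up to the boundary\<close>

locale riem = full_domain +
  fixes G :: "real^3 \<Rightarrow> tensor2"
  assumes inner: "x \<in> T \<Longrightarrow> inner3 (G x)" and smooth: "smooth_upto T (\<lambda>x. G x X Y)"
begin

abbreviation "\<Gamma> \<equiv> christoffel T G"

definition koszul :: "real^3 \<Rightarrow> real^3 \<Rightarrow> real^3 \<Rightarrow> real^3 \<Rightarrow> real" where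
  "koszul x X Y Z = (dD T (\<lambda>y. G y Y Z) x X + dD T (\<lambda>y. G y X Z) x Y - dD T (\<lambda>y. G y X Y) x Z) / 2"

lemma bilG: "x \<in> T \<Longrightarrow> bilinear (G x)" and symG: "x \<in> T \<Longrightarrow> G x X Y = G x Y X"
  using inner inner3.bil inner3.hsym by auto

lemma dD_bilinear:
  fixes B :: "real^3 \<Rightarrow> tensor2"
  assumes "\<And>x. x \<in> T \<Longrightarrow> bilinear (B x)" "\<And>X Y. smooth_upto T (\<lambda>x. B x X Y :: real)" "x \<in> T"
  shows "bilinear (\<lambda>X Y. dD T (\<lambda>y. B y X Y) x v)"
proof -
  have "dD T (\<lambda>y. B y (X + X') Y) x v = dD T (\<lambda>y. B y X Y) x v + dD T (\<lambda>y. B y X' Y) x v"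
    "dD T (\<lambda>y. B y Y (X + X')) x v = dD T (\<lambda>y. B y Y X) x v + dD T (\<lambda>y. B y Y X') x v"
    "dD T (\<lambda>y. B y (c *\<^sub>R X) Y) x v = c * dD T (\<lambda>y. B y X Y) x v"
    "dD T (\<lambda>y. B y Y (c *\<^sub>R X)) x v = c * dD T (\<lambda>y. B y Y X) x v" for X X' Y c
  proof -
    show "dD T (\<lambda>y. B y (X + X') Y) x v = dD T (\<lambda>y. B y X Y) x v + dD T (\<lambda>y. B y X' Y) x v"
      unfolding dD_add[OF assms(2,2,3), symmetric]
      by (rule dD_same) (use assms in \<open>auto simp: bilinear_ladd intro!: smooth_intros\<close>)
    show "dD T (\<lambda>y. B y Y (X + X')) x v = dD T (\<lambda>y. B y Y X) x v + dD T (\<lambda>y. B y Y X') x v"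
      unfolding dD_add[OF assms(2,2,3), symmetric]
      by (rule dD_same) (use assms in \<open>auto simp: bilinear_radd intro!: smooth_intros\<close>)
    show "dD T (\<lambda>y. B y (c *\<^sub>R X) Y) x v = c * dD T (\<lambda>y. B y X Y) x v"
      unfolding dD_cmul[OF assms(2,3), symmetric]
      by (rule dD_same) (use assms in \<open>auto simp: bilinear_lmul intro!: smooth_intros\<close>)
    show "dD T (\<lambda>y. B y Y (c *\<^sub>R X)) x v = c * dD T (\<lambda>y. B y Y X) x v"
      unfolding dD_cmul[OF assms(2,3), symmetric]
      by (rule dD_same) (use assms in \<open>auto simp: bilinear_rmul intro!: smooth_intros\<close>)
  qed
  then show ?thesis by (simp add: bilinear_def linear_iff)
qed

lemma dDG_bilinear: "x \<in> T \<Longrightarrow> bilinear (\<lambda>X Y. dD T (\<lambda>y. G y X Y) x v)"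
  by (rule dD_bilinear[OF bilG smooth])

lemma dDG_linear: "x \<in> T \<Longrightarrow> linear (dD T (\<lambda>y. G y X Y) x)"
  by (rule dD_linear[OF smooth])

lemma dDG_sym: "x \<in> T \<Longrightarrow> dD T (\<lambda>y. G y X Y) x v = dD T (\<lambda>y. G y Y X) x v"
  by (rule dD_same) (use symG smooth in auto)

lemma koszul_linear:
  assumes x: "x \<in> T"
  shows "linear (koszul x X Y)" "bilinear (\<lambda>X Y. koszul x X Y Z)"
proof -
  note b = bilinear_simps[OF dDG_bilinear[OF x]] linear_add[OF dDG_linear[OF x]] linear_cmul[OF dDG_linear[OF x]]
  show "linear (koszul x X Y)"
    by (rule linearI) (simp_all add: koszul_def b field_simps)
  show "bilinear (\<lambda>X Y. koszul x X Y Z)"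
    unfolding bilinear_def by (auto intro!: linearI simp: koszul_def b field_simps)
qed

lemma christoffel_riesz: "x \<in> T \<Longrightarrow> \<Gamma> x X Y = riesz (G x) (koszul x X Y)"
  unfolding christoffel_def koszul_def[symmetric]
  by (rule inner3.riesz_the[OF inner koszul_linear(1)])

lemma christoffel: "x \<in> T \<Longrightarrow> G x (\<Gamma> x X Y) Z = koszul x X Y Z"
  unfolding christoffel_riesz by (rule inner3.riesz[OF inner koszul_linear(1)])

lemma bilinear_christoffel: assumes x: "x \<in> T" shows "bilinear (\<Gamma> x)"
proof -
  interpret inner3 "G x" by (rule inner[OF x])
  note k = bilinear_simps[OF koszul_linear(2)[OF x]]
  have "\<Gamma> x (X + X') Y = \<Gamma> x X Y + \<Gamma> x X' Y" "\<Gamma> x Y (X + X') = \<Gamma> x Y X + \<Gamma> x Y X'"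
    "\<Gamma> x (c *\<^sub>R X) Y = c *\<^sub>R \<Gamma> x X Y" "\<Gamma> x Y (c *\<^sub>R X) = c *\<^sub>R \<Gamma> x Y X" for X X' Y c
    by (rule nondeg, simp add: h_simps christoffel[OF x] k)+
  then show ?thesis unfolding bilinear_def linear_iff by blast
qed

text \<open>Metric compatibility. In the sum of the two Koszul expressions the derivatives along X
  and Y cancel and the one along V appears twice.\<close>

lemma compat: assumes x: "x \<in> T"
  shows "dD T (\<lambda>y. G y X Y) x V = G x (\<Gamma> x V X) Y + G x X (\<Gamma> x V Y)"
  unfolding christoffel[OF x] symG[OF x, of X "\<Gamma> x V Y"] koszul_def
  using dDG_sym[OF x] by (simp add: field_simps)

lemma smooth_metric_det: "smooth_upto T (\<lambda>x. metric_det (G x))"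
  unfolding metric_det_def by (rule smooth_upto_det) (simp add: smooth)

lemma det_pos: "x \<in> T \<Longrightarrow> metric_det (G x) > 0"
  by (rule inner3.metric_det_pos[OF inner])

lemma smooth_riesz:
  assumes "\<And>Z. smooth_upto T (\<lambda>x. L x Z)"
  shows "smooth_upto T (\<lambda>x. riesz (G x) (L x))"
proof (rule smooth_upto_vec)
  fix k
  have "smooth_upto T (\<lambda>x. det (\<chi> i j. if j = k then L x (axis i 1) else G x (axis i 1) (axis j 1) :: real^3^3) / metric_det (G x))"
  proof (rule smooth_upto_divide[OF smooth_upto_det smooth_metric_det])
    fix i j show "smooth_upto T (\<lambda>x. (\<chi> i j. if j = k then L x (axis i 1) else G x (axis i 1) (axis j 1)) $ i $ j)"
      by (cases "j = k") (simp_all add: assms smooth)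
  qed (use det_pos in force)
  then show "smooth_upto T (\<lambda>x. riesz (G x) (L x) $ k)" by (simp add: riesz_def)
qed

lemma smooth_koszul: "smooth_upto T (\<lambda>x. koszul x X Y Z)"
  unfolding koszul_def by (intro smooth_upto_divide smooth_intros smooth_dD smooth) auto

lemma smooth_christoffel: "smooth_upto T (\<lambda>x. \<Gamma> x X Y)"
  by (rule smooth_upto_cong[OF _ smooth_riesz[OF smooth_koszul]]) (simp add: christoffel_riesz)

lemma smooth_vol: "smooth_upto T (\<lambda>x. vol (G x) X Y Z)"
  unfolding vol_def by (intro smooth_intros smooth_upto_sqrt smooth_metric_det det_pos)

lemma smooth_gcross: "smooth_upto T (\<lambda>x. gcross (G x) X Y)"
  by (rule smooth_upto_cong[OF _ smooth_riesz[OF smooth_vol]]) (simp add: inner3.gcross_riesz[OF inner])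

subsubsection \<open>The curvature tensor\<close>

lemma nabla_const: "y \<in> T \<Longrightarrow> nabla_vec T G (\<lambda>_. Y) (\<lambda>_. Z) y = \<Gamma> y Y Z"
  by (simp add: nabla_vec_def cov_vec_def dD_const)

text \<open>Constant fields have vanishing bracket. Metric compatibility moves the derivative of a
  Christoffel vector onto its Koszul form, so that only second derivatives of the metric and
  products of two Christoffel vectors remain.\<close>

lemma riemann_eq:
  assumes x: "x \<in> T"
  shows "riemann T G x X Y Z W = dD T (\<lambda>y. koszul y Y Z W) x X - dD T (\<lambda>y. koszul y X Z W) x Y
     - G x (\<Gamma> x Y Z) (\<Gamma> x X W) + G x (\<Gamma> x X Z) (\<Gamma> x Y W)"
proof -
  have n: "nabla_vec T G (\<lambda>_. X) (nabla_vec T G (\<lambda>_. Y) (\<lambda>_. Z)) x = dD T (\<lambda>y. \<Gamma> y Y Z) x X + \<Gamma> x X (\<Gamma> x Y Z)" for X Y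
  proof -
    have "dD T (nabla_vec T G (\<lambda>_. Y) (\<lambda>_. Z)) x X = dD T (\<lambda>y. \<Gamma> y Y Z) x X"
      by (rule dD_same[OF nabla_const smooth_christoffel x])
    then show ?thesis by (simp add: nabla_vec_def[of T G "\<lambda>_. X"] cov_vec_def nabla_const[OF x])
  qed
  have l: "nabla_vec T G (lie_bracket T (\<lambda>_. X) (\<lambda>_. Y)) (\<lambda>_. Z) x = 0"
    by (simp add: nabla_vec_def cov_vec_def lie_bracket_def dD_const x bilinear_lzero[OF bilinear_christoffel[OF x]])
  have d: "G x (dD T (\<lambda>y. \<Gamma> y Y Z) x X) W = dD T (\<lambda>y. koszul y Y Z W) x X
     - G x (\<Gamma> x X (\<Gamma> x Y Z)) W - G x (\<Gamma> x Y Z) (\<Gamma> x X W)" for X Y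
  proof -
    have "dD T (\<lambda>y. koszul y Y Z W) x X = dD T (\<lambda>y. G y (\<Gamma> y Y Z) W) x X"
      by (rule dD_same[OF _ _ x])
         (use christoffel smooth_upto_bil[OF bilG smooth smooth_christoffel smooth_upto_const] in auto)
    also have "\<dots> = dD T (\<lambda>y. G y (\<Gamma> x Y Z) W) x X + G x (dD T (\<lambda>y. \<Gamma> y Y Z) x X) W"
      by (subst dD_bil[OF bilG smooth smooth_christoffel smooth_upto_const x])
         (simp_all add: dD_const x bilinear_rzero[OF bilG[OF x]])
    finally show ?thesis by (simp add: compat[OF x])
  qed
  note b = bilinear_simps[OF bilG[OF x]]
  show ?thesis
    unfolding riemann_def curv_op_def n l by (simp add: b d)
qed

lemma dD_koszul:
  assumes x: "x \<in> T"
  shows "dD T (\<lambda>y. koszul y X Y Z) x V = (dD T (\<lambda>y. dD T (\<lambda>z. G z Y Z) y X) x V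
    + dD T (\<lambda>y. dD T (\<lambda>z. G z X Z) y Y) x V - dD T (\<lambda>y. dD T (\<lambda>z. G z X Y) y Z) x V) / 2"
proof -
  have s: "smooth_upto T (\<lambda>y. dD T (\<lambda>z. G z A B) y C)" for A B C by (intro smooth_dD smooth)
  have "dD T (\<lambda>y. koszul y X Y Z) x V = dD T (\<lambda>y. (1/2) * (dD T (\<lambda>z. G z Y Z) y X
    + dD T (\<lambda>z. G z X Z) y Y - dD T (\<lambda>z. G z X Y) y Z)) x V"
    by (rule dD_same[OF _ _ x], simp add: koszul_def, intro smooth_intros s)
  also have "\<dots> = (1/2) * (dD T (\<lambda>y. dD T (\<lambda>z. G z Y Z) y X) x V
    + dD T (\<lambda>y. dD T (\<lambda>z. G z X Z) y Y) x V - dD T (\<lambda>y. dD T (\<lambda>z. G z X Y) y Z) x V)"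
    by (subst dD_cmul, intro smooth_intros s, rule x, subst dD_diff, intro smooth_intros s, rule s, rule x,
        subst dD_add, rule s, rule s, rule x, rule refl)
  finally show ?thesis by simp
qed

text \<open>With H for second derivatives of the metric and K for products of Christoffel vectors,
  all three identities are formal consequences of commuting partial derivatives, the symmetry of the
  metric and the absence of torsion.\<close>

lemma riemann_symmetries:
  assumes x: "x \<in> T"
  shows "riemann T G x X Y Z W = - riemann T G x Y X Z W" "riemann T G x X Y Z W = - riemann T G x X Y W Z"
    "riemann T G x X Y Z W = riemann T G x Z W X Y"
proof -
  define H where "H A B C D = dD T (\<lambda>y. dD T (\<lambda>z. G z A B) y C) x D" for A B C D
  have H1: "H A B C D = H A B D C" for A B C D
    unfolding H_def by (rule dD_commute[OF smooth]) (use full x in auto)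
  have H2: "H A B C D = H B A C D" for A B C D
    unfolding H_def by (rule dD_same[OF _ _ x]) (auto simp: dDG_sym intro: smooth_dD smooth)
  define K where "K A B C D = G x (\<Gamma> x A B) (\<Gamma> x C D)" for A B C D
  have g: "\<Gamma> x A B = \<Gamma> x B A" for A B
    unfolding christoffel_riesz[OF x] koszul_def by (simp add: add.commute dDG_sym[OF x, of A B])
  have K1: "K A B C D = K B A C D" "K A B C D = K C D A B" for A B C D
    unfolding K_def using g symG[OF x] by auto
  have K2: "K A B C D = K A B D C" for A B C D
    unfolding K_def using g[of C D] by simp
  \<comment> \<open>The two terms that differentiate \<open>G z Z W\<close> along X and Y in either
    order cancel by \<open>H1\<close>; four of the six terms survive.\<close>
  have R: "riemann T G x X Y Z W = (H Y W Z X - H Y Z W X - H X W Z Y + H X Z W Y) / 2 - K Y Z X W + K X Z Y W" for X Y Z W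
    unfolding riemann_eq[OF x] dD_koszul[OF x] H_def[symmetric] K_def[symmetric]
    using H1[of Z W Y X] by (simp add: field_simps)
  show "riemann T G x X Y Z W = - riemann T G x Y X Z W"
    unfolding R by (simp add: field_simps)
  show "riemann T G x X Y Z W = - riemann T G x X Y W Z"
    unfolding R using K1(2)[of Y Z X W] K1(2)[of X Z Y W] by (simp add: field_simps)
  show "riemann T G x X Y Z W = riemann T G x Z W X Y"
    unfolding R
    using H1[of Y W Z X] H2[of Y W X Z] H1[of Y Z W X] H2[of Y Z X W] H1[of X W Z Y] H2[of X W Y Z]
      H1[of X Z W Y] H2[of X Z Y W] K1(1)[of Y Z X W] K1(2)[of Z Y X W] K2[of Z Y X W] K1(1)[of X Z Y W] K2[of Z X Y W] K2[of X W Z Y]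
      K1(1)[of X W Z Y] 
    by (simp add: field_simps)
qed

lemma riemann_bilinear:
  assumes x: "x \<in> T"
  shows "bilinear (riemann T G x X Y)" "bilinear (\<lambda>X Y. riemann T G x X Y Z W)"
proof -
  have k: "bilinear (\<lambda>X Y. dD T (\<lambda>y. koszul y X Y Z) x V)" for Z V
    by (rule dD_bilinear[where B="\<lambda>y X Y. koszul y X Y Z"]) (auto intro: koszul_linear smooth_koszul x)
  have kl: "bilinear (\<lambda>Y Z. koszul y X Y Z)" if "y \<in> T" for X y
    using koszul_linear[OF that] by (simp add: bilinear_def)
  have k2: "bilinear (\<lambda>Y Z. dD T (\<lambda>y. koszul y X Y Z) x V)" for X V
    by (rule dD_bilinear[where B="\<lambda>y Y Z. koszul y X Y Z"]) (auto intro: kl smooth_koszul x)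
  have G: "bilinear (G x)" and g: "bilinear (\<Gamma> x)" using bilG bilinear_christoffel x by auto
  show b: "bilinear (riemann T G x X Y)" for X Y
    unfolding bilinear_def riemann_eq[OF x]
    by (auto intro!: linearI simp: bilinear_simps[OF k2] bilinear_simps[OF G] bilinear_simps[OF g] algebra_simps)
  then show "bilinear (\<lambda>X Y. riemann T G x X Y Z W)"
    by (subst riemann_symmetries(3)[OF x])
qed

lemma Q_curv:
  assumes x: "x \<in> T"
  shows "bilinear (Q_curv T G x)" "Q_curv T G x X Y = Q_curv T G x Y X" "Aop (G x) (Q_curv T G x) = riemann T G x"
proof -
  interpret inner3 "G x" by (rule inner[OF x])
  obtain Q where Q: "bilinear Q" "\<forall>X Y. Q X Y = Q Y X" "Aop (G x) Q = riemann T G x"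
    using Aop_exists[OF riemann_bilinear(2,1)[OF x] riemann_symmetries[OF x]] by blast
  have "Q_curv T G x = Q"
    unfolding Q_curv_def
  proof (rule the_equality)
    fix Q' assume "bilinear Q' \<and> (\<forall>X Y. Q' X Y = Q' Y X) \<and> Aop (G x) Q' = riemann T G x"
    then show "Q' = Q" using Aop_unique[of Q' Q] Q by simp
  qed (use Q in auto)
  then show "bilinear (Q_curv T G x)" "Q_curv T G x X Y = Q_curv T G x Y X" "Aop (G x) (Q_curv T G x) = riemann T G x"
    using Q by auto
qed

end


context riem
begin

subsubsection \<open>The covariant derivative of the cross product\<close>

lemma dD_sqrt:
  assumes f: "smooth_upto T f" "\<And>y. y \<in> T \<Longrightarrow> f y > 0" and x: "x \<in> T"
  shows "dD T (\<lambda>y. sqrt (f y)) x v = dD T f x v / (2 * sqrt (f x))"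
proof -
  have p: "f x > 0" using f(2) x by simp
  have "((\<lambda>y. sqrt (f y)) has_derivative (\<lambda>v. dD T f x v / (2 * sqrt (f x)))) (at x within T)"
    using has_derivative_real_sqrt[OF p has_dD[OF f(1) x]] by (simp add: field_simps)
  then show ?thesis by (rule dD_unique[OF _ x])
qed

text \<open>Jacobi's formula. Metric compatibility writes the derivative of each matrix entry
  through the coefficients of \<open>\<Gamma> x V\<close>, once for each index, whence twice their
  trace; what is left is a polynomial identity for 3-by-3 determinants.\<close>

lemma dD_metric_det:
  assumes x: "x \<in> T"
  shows "dD T (\<lambda>y. metric_det (G y)) x V = 2 * (\<Sum>i\<in>UNIV. \<Gamma> x V (axis i 1) $ i) * metric_det (G x)"
proof -
  let ?g = "\<lambda>i j y. G y (axis i 1) (axis j 1)"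
  let ?c = "\<lambda>i m. \<Gamma> x V (axis i 1) $ m"
  have d: "dD T (?g i j) x V = (\<Sum>m\<in>UNIV. ?c i m * ?g m j x) + (\<Sum>m\<in>UNIV. ?c j m * ?g i m x)" for i j
    unfolding compat[OF x] sum_3
    by (subst (1) vec3_expand[of "\<Gamma> x V (axis i 1)"], subst (1) vec3_expand[of "\<Gamma> x V (axis j 1)"])
       (simp add: bilinear_simps[OF bilG[OF x]])
  have s: "smooth_upto T (?g i j)" for i j by (rule smooth)
  have sm: "?g 2 1 x = ?g 1 2 x" "?g 3 1 x = ?g 1 3 x" "?g 3 2 x = ?g 2 3 x" using symG[OF x] by auto
  have m: "metric_det (G y) = ?g 1 1 y * ?g 2 2 y * ?g 3 3 y + ?g 1 2 y * ?g 2 3 y * ?g 3 1 y + ?g 1 3 y * ?g 2 1 y * ?g 3 2 y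
    - ?g 1 1 y * ?g 2 3 y * ?g 3 2 y - ?g 1 2 y * ?g 2 1 y * ?g 3 3 y - ?g 1 3 y * ?g 2 2 y * ?g 3 1 y" for y
    by (simp add: metric_det_def det_3)
  have p3: "dD T (\<lambda>y. f1 y * f2 y * f3 y) x V = dD T f1 x V * f2 x * f3 x + f1 x * dD T f2 x V * f3 x + f1 x * f2 x * dD T f3 x V"
    and sp3: "smooth_upto T (\<lambda>y. f1 y * f2 y * f3 y)"
    if "smooth_upto T f1" "smooth_upto T f2" "smooth_upto T f3" for f1 f2 f3 :: "real^3 \<Rightarrow> real"
  proof -
    show "smooth_upto T (\<lambda>y. f1 y * f2 y * f3 y)" by (intro smooth_intros that)
    have "dD T (\<lambda>y. f1 y * f2 y * f3 y) x V = f1 x * f2 x * dD T f3 x V + dD T (\<lambda>y. f1 y * f2 y) x V * f3 x"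
      by (rule dD_mult[OF smooth_upto_mult[OF that(1,2)] that(3) x])
    then show "dD T (\<lambda>y. f1 y * f2 y * f3 y) x V = dD T f1 x V * f2 x * f3 x + f1 x * dD T f2 x V * f3 x + f1 x * f2 x * dD T f3 x V"
      by (simp add: dD_mult[OF that(1,2) x] algebra_simps)
  qed
  note s3 = sp3[OF s s s]
  have "dD T (\<lambda>y. metric_det (G y)) x V =
      dD T (\<lambda>y. ?g 1 1 y * ?g 2 2 y * ?g 3 3 y) x V + dD T (\<lambda>y. ?g 1 2 y * ?g 2 3 y * ?g 3 1 y) x V
    + dD T (\<lambda>y. ?g 1 3 y * ?g 2 1 y * ?g 3 2 y) x V
    - dD T (\<lambda>y. ?g 1 1 y * ?g 2 3 y * ?g 3 2 y) x V - dD T (\<lambda>y. ?g 1 2 y * ?g 2 1 y * ?g 3 3 y) x V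
    - dD T (\<lambda>y. ?g 1 3 y * ?g 2 2 y * ?g 3 1 y) x V"
    unfolding m
    by (simp only: dD_diff[OF smooth_upto_diff[OF smooth_upto_diff[OF smooth_upto_add[OF smooth_upto_add[OF s3 s3] s3] s3] s3] s3 x]
      dD_diff[OF smooth_upto_diff[OF smooth_upto_add[OF smooth_upto_add[OF s3 s3] s3] s3] s3 x]
      dD_diff[OF smooth_upto_add[OF smooth_upto_add[OF s3 s3] s3] s3 x]
      dD_add[OF smooth_upto_add[OF s3 s3] s3 x] dD_add[OF s3 s3 x])
  also have "\<dots> = 2 * (\<Sum>i\<in>UNIV. ?c i i) * metric_det (G x)"
    unfolding p3[OF s s s] d sum_3 m sm by algebra
  finally show ?thesis .
qed

text \<open>The first-order part in t of the multiplicativity of the determinant under 1 + t L,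
  verified in components.\<close>

lemma vol_trace:
  fixes L :: "real^3 \<Rightarrow> real^3"
  assumes L: "linear L"
  shows "vol h (L X) Y Z + vol h X (L Y) Z + vol h X Y (L Z) = (\<Sum>i\<in>UNIV. L (axis i 1) $ i) * vol h X Y Z"
proof -
  let ?c = "\<lambda>i m. L (axis i 1) $ m"
  have l: "L v $ m = v$1 * ?c 1 m + v$2 * ?c 2 m + v$3 * ?c 3 m" for v m
    by (subst linear_vec3[OF L]) simp
  have "det (vector [L X, Y, Z] :: real^3^3) + det (vector [X, L Y, Z] :: real^3^3) + det (vector [X, Y, L Z] :: real^3^3)
      = (\<Sum>i\<in>UNIV. ?c i i) * det (vector [X, Y, Z] :: real^3^3)"
    unfolding det_rows l[of X] l[of Y] l[of Z] sum_3 by (simp add: algebra_simps)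
  then show ?thesis unfolding vol_def by (simp only: distrib_left[symmetric] mult.left_commute)
qed

text \<open>The volume form is parallel. The square root halves the factor 2 in Jacobi's formula,
  and \<open>vol_trace\<close> distributes the remaining trace over the three slots.\<close>

lemma dD_vol:
  assumes x: "x \<in> T"
  shows "dD T (\<lambda>y. vol (G y) X Y Z) x V = vol (G x) (\<Gamma> x V X) Y Z + vol (G x) X (\<Gamma> x V Y) Z + vol (G x) X Y (\<Gamma> x V Z)"
proof -
  have lin: "linear (\<Gamma> x V)" using bilinear_christoffel[OF x] by (simp add: bilinear_def)
  have "dD T (\<lambda>y. sqrt (metric_det (G y))) x V = dD T (\<lambda>y. metric_det (G y)) x V / (2 * sqrt (metric_det (G x)))"
    by (rule dD_sqrt[OF smooth_metric_det det_pos x])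
  also have "\<dots> = (\<Sum>i\<in>UNIV. \<Gamma> x V (axis i 1) $ i) * (metric_det (G x) / sqrt (metric_det (G x)))"
    unfolding dD_metric_det[OF x] by simp
  also have "metric_det (G x) / sqrt (metric_det (G x)) = sqrt (metric_det (G x))"
    using det_pos[OF x] by (intro real_div_sqrt) simp
  finally have "dD T (\<lambda>y. sqrt (metric_det (G y))) x V = (\<Sum>i\<in>UNIV. \<Gamma> x V (axis i 1) $ i) * sqrt (metric_det (G x))" .
  moreover have "dD T (\<lambda>y. vol (G y) X Y Z) x V = dD T (\<lambda>y. det (vector [X, Y, Z] :: real^3^3) * sqrt (metric_det (G y))) x V"
    by (simp add: vol_def mult.commute)
  ultimately show ?thesis
    unfolding vol_trace[OF lin]
    by (simp add: dD_cmul smooth_upto_sqrt smooth_metric_det det_pos x vol_def)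
qed

text \<open>Tested against an arbitrary W, this combines the parallelism of the metric with that of
  the volume form.\<close>

lemma dD_gcross:
  assumes x: "x \<in> T"
  shows "dD T (\<lambda>y. gcross (G y) Y Z) x V + \<Gamma> x V (gcross (G x) Y Z)
     = gcross (G x) (\<Gamma> x V Y) Z + gcross (G x) Y (\<Gamma> x V Z)"
proof -
  interpret inner3 "G x" by (rule inner[OF x])
  show ?thesis
  proof (rule nondeg)
    fix W
    have "dD T (\<lambda>y. vol (G y) Y Z W) x V = dD T (\<lambda>y. G y (gcross (G y) Y Z) W) x V"
      by (rule dD_same[OF _ _ x])
         (simp add: inner3.gcross[OF inner], rule smooth_upto_bil[OF bilG smooth smooth_gcross smooth_upto_const])
    also have "\<dots> = dD T (\<lambda>y. G y (gcross (G x) Y Z) W) x V + G x (dD T (\<lambda>y. gcross (G y) Y Z) x V) W"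
      by (subst dD_bil[OF bilG smooth smooth_gcross smooth_upto_const x]) (simp_all add: dD_const x h_simps)
    finally show "G x (dD T (\<lambda>y. gcross (G y) Y Z) x V + \<Gamma> x V (gcross (G x) Y Z)) W
       = G x (gcross (G x) (\<Gamma> x V Y) Z + gcross (G x) Y (\<Gamma> x V Z)) W"
      unfolding compat[OF x] dD_vol[OF x] by (simp add: h_simps gcross)
  qed
qed

subsubsection \<open>Curl and incompatibility\<close>

definition tensor_field :: "(real^3 \<Rightarrow> tensor2) \<Rightarrow> bool" where
  "tensor_field \<sigma> \<longleftrightarrow> (\<forall>x\<in>T. bilinear (\<sigma> x)) \<and> (\<forall>X Y. smooth_upto T (\<lambda>x. \<sigma> x X Y))"

lemma tensor_fieldD:
  assumes "tensor_field \<sigma>"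
  shows "x \<in> T \<Longrightarrow> bilinear (\<sigma> x)" "smooth_upto T (\<lambda>x. \<sigma> x X Y)"
  using assms by (auto simp: tensor_field_def)

lemma smooth_tensor:
  assumes "tensor_field \<sigma>" "smooth_upto T u" "smooth_upto T v"
  shows "smooth_upto T (\<lambda>x. \<sigma> x (u x) (v x))"
  by (rule smooth_upto_bil[OF tensor_fieldD[OF assms(1)] assms(2,3)])

lemma smooth_nab2:
  assumes "tensor_field \<sigma>" shows "smooth_upto T (\<lambda>x. nab2 T G \<sigma> x X Y Z)"
  unfolding nab2_def
  by (intro smooth_intros smooth_dD tensor_fieldD[OF assms] smooth_tensor[OF assms] smooth_christoffel)

lemma nab2_linear:
  assumes s: "tensor_field \<sigma>" and x: "x \<in> T"
  shows "linear (\<lambda>X. nab2 T G \<sigma> x X Y Z)" "bilinear (nab2 T G \<sigma> x X)"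
proof -
  note g = bilinear_simps[OF bilinear_christoffel[OF x]] bilinear_simps[OF tensor_fieldD(1)[OF s x]]
    bilinear_simps[OF dD_bilinear[OF tensor_fieldD[OF s] x]]
  have l: "linear (dD T (\<lambda>y. \<sigma> y Y Z) x)" for Y Z by (rule dD_linear[OF tensor_fieldD(2)[OF s] x])
  show "linear (\<lambda>X. nab2 T G \<sigma> x X Y Z)"
    by (rule linearI) (simp_all add: nab2_def g linear_add[OF l] linear_cmul[OF l] algebra_simps)
  show "bilinear (nab2 T G \<sigma> x X)"
    unfolding bilinear_def by (auto intro!: linearI simp: nab2_def g algebra_simps)
qed

text \<open>The defining expression alternates in Y and Z, so \<open>cross_dual\<close> produces a
  solution, and cross products span, so it is the only one. The explicit formula is the source of
  the smoothness of curl.\<close>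

lemma curl_eq:
  assumes s: "tensor_field \<sigma>" and x: "x \<in> T"
  shows "curl T G \<sigma> x X V = cross_dual (G x) (\<lambda>Y Z. nab2 T G \<sigma> x Y X Z - nab2 T G \<sigma> x Z X Y) V"
    "bilinear (curl T G \<sigma> x)"
    "curl T G \<sigma> x X (gcross (G x) Y Z) = nab2 T G \<sigma> x Y X Z - nab2 T G \<sigma> x Z X Y"
proof -
  interpret inner3 "G x" by (rule inner[OF x])
  let ?N = "nab2 T G \<sigma> x"
  define C where "C X V = cross_dual (G x) (\<lambda>Y Z. ?N Y X Z - ?N Z X Y) V" for X V
  note n = bilinear_simps[OF nab2_linear(2)[OF s x]] linear_add[OF nab2_linear(1)[OF s x]] linear_cmul[OF nab2_linear(1)[OF s x]]
  have C2: "C X (gcross (G x) Y Z) = ?N Y X Z - ?N Z X Y" for X Y Z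
    unfolding C_def by (rule cross_dual) (auto simp: bilinear_def n algebra_simps intro!: linearI)
  have C1: "bilinear C"
  proof -
    have "linear (\<lambda>X. C X V)" for V
      unfolding C_def cross_dual_def by (rule linearI) (simp_all add: n add_divide_distrib diff_divide_distrib algebra_simps)
    moreover have "linear (C X)" for X
      unfolding C_def[abs_def] using linear_cross_dual[of "\<lambda>Y Z. ?N Y X Z - ?N Z X Y"] by simp
    ultimately show ?thesis unfolding bilinear_def by blast
  qed
  have "curl T G \<sigma> x = C"
    unfolding curl_def
  proof (rule the_equality)
    fix D assume D: "bilinear D \<and> (\<forall>X Y Z. D X (gcross (G x) Y Z) = ?N Y X Z - ?N Z X Y)"
    show "D = C"
    proof (intro ext)
      fix X V show "D X V = C X V"
        by (rule linear_eq_gcross) (use C1 C2 D in \<open>auto simp: bilinear_def\<close>)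
    qed
  qed (use C1 C2 in auto)
  then show "curl T G \<sigma> x X V = cross_dual (G x) (\<lambda>Y Z. ?N Y X Z - ?N Z X Y) V" "bilinear (curl T G \<sigma> x)"
    "curl T G \<sigma> x X (gcross (G x) Y Z) = ?N Y X Z - ?N Z X Y"
    using C1 C2 C_def by auto
qed

lemma tensor_field_curl:
  assumes s: "tensor_field \<sigma>" shows "tensor_field (curl T G \<sigma>)"
  unfolding tensor_field_def
proof (intro conjI ballI allI)
  fix X Y
  show "smooth_upto T (\<lambda>x. curl T G \<sigma> x X Y)"
  proof (rule smooth_upto_cong)
    show "smooth_upto T (\<lambda>x. cross_dual (G x) (\<lambda>Y Z. nab2 T G \<sigma> x Y X Z - nab2 T G \<sigma> x Z X Y) Y)"
      unfolding cross_dual_def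
      by (intro smooth_upto_divide smooth_upto_sqrt smooth_metric_det smooth_intros smooth smooth_nab2 s) (use det_pos in force)+
  qed (rule curl_eq(1)[OF s, symmetric])
qed (rule curl_eq(2)[OF s])

lemma tensor_field_transp2: "tensor_field \<sigma> \<Longrightarrow> tensor_field (\<lambda>x. transp2 (\<sigma> x))"
  by (auto simp: tensor_field_def transp2_def bilinear_def)

lemma nab2_transp2: "nab2 T G (\<lambda>x. transp2 (\<sigma> x)) x V X Y = nab2 T G \<sigma> x V Y X"
  by (simp add: nab2_def transp2_def)

lemma dD_tensor:
  assumes s: "tensor_field \<sigma>" and u: "smooth_upto T u" and x: "x \<in> T"
  shows "dD T (\<lambda>y. \<sigma> y X (u y)) x V = dD T (\<lambda>y. \<sigma> y X (u x)) x V + \<sigma> x X (dD T u x V)"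
  using dD_bil[of \<sigma> "\<lambda>_. X" u x V, OF tensor_fieldD[OF s] smooth_upto_const u x]
    dD_const[OF x, of X V] bilinear_lzero[OF tensor_fieldD(1)[OF s x], of "u x"] by simp

text \<open>The cross product is parallel, so \<open>\<nabla>\<close> can be taken inside the defining relation of \<open>curl\<close>.\<close>

lemma nab2_curl:
  assumes s: "tensor_field \<sigma>" and x: "x \<in> T"
  shows "nab2 T G (curl T G \<sigma>) x V X (gcross (G x) Y Z) = nabnab2 T G \<sigma> x V Y X Z - nabnab2 T G \<sigma> x V Z X Y"
proof -
  let ?C = "curl T G \<sigma>" and ?N = "nab2 T G \<sigma>"
  note sc = tensor_field_curl[OF s]
  note c = curl_eq(3)[OF s x] bilinear_simps[OF curl_eq(2)[OF s x]]
  have "dD T (\<lambda>y. ?N y Y X Z - ?N y Z X Y) x V = dD T (\<lambda>y. ?C y X (gcross (G y) Y Z)) x V"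
    by (rule dD_same[OF _ _ x]) (simp add: curl_eq(3)[OF s], rule smooth_tensor[OF sc smooth_upto_const smooth_gcross])
  also have "\<dots> = dD T (\<lambda>y. ?C y X (gcross (G x) Y Z)) x V + ?C x X (dD T (\<lambda>y. gcross (G y) Y Z) x V)"
    by (rule dD_tensor[OF sc smooth_gcross x])
  also have "dD T (\<lambda>y. gcross (G y) Y Z) x V = gcross (G x) (\<Gamma> x V Y) Z + gcross (G x) Y (\<Gamma> x V Z) - \<Gamma> x V (gcross (G x) Y Z)"
    using dD_gcross[OF x, of Y Z V] by (simp add: eq_diff_eq)
  finally have "dD T (\<lambda>y. ?C y X (gcross (G x) Y Z)) x V = dD T (\<lambda>y. ?N y Y X Z) x V - dD T (\<lambda>y. ?N y Z X Y) x V
     - (?N x (\<Gamma> x V Y) X Z - ?N x Z X (\<Gamma> x V Y)) - (?N x Y X (\<Gamma> x V Z) - ?N x (\<Gamma> x V Z) X Y)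
     + ?C x X (\<Gamma> x V (gcross (G x) Y Z))"
    by (simp add: c dD_diff smooth_nab2 s x)
  then show ?thesis
    unfolding nab2_def[of T G ?C] nabnab2_def by (simp add: c)
qed

lemma inc_gcross:
  assumes s: "tensor_field \<sigma>" and x: "x \<in> T"
  shows "inc T G \<sigma> x (gcross (G x) V W) (gcross (G x) Y Z) =
    nabnab2 T G \<sigma> x Y V Z W - nabnab2 T G \<sigma> x Y W Z V - nabnab2 T G \<sigma> x Z V Y W + nabnab2 T G \<sigma> x Z W Y V"
  unfolding inc_def curl_eq(3)[OF tensor_field_transp2[OF tensor_field_curl[OF s]] x] nab2_transp2 nab2_curl[OF s x]
  by simp

lemma bilinear_inc:
  assumes s: "tensor_field \<sigma>" and x: "x \<in> T"
  shows "bilinear (inc T G \<sigma> x)"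
  unfolding inc_def by (rule curl_eq(2)[OF tensor_field_transp2[OF tensor_field_curl[OF s]] x])

definition sum4 :: "(3 \<Rightarrow> 3 \<Rightarrow> 3 \<Rightarrow> 3 \<Rightarrow> real) \<Rightarrow> real" where
  "sum4 f = (\<Sum>i\<in>UNIV. \<Sum>j\<in>UNIV. \<Sum>k\<in>UNIV. \<Sum>l\<in>UNIV. f i j k l)"

lemma sum4_swap:
  "sum4 (\<lambda>i j k l. f j i k l) = sum4 f" "sum4 (\<lambda>i j k l. f i j l k) = sum4 f" "sum4 (\<lambda>i j k l. f i k j l) = sum4 f"
  unfolding sum4_def
  by (rule sum.swap, rule sum.cong[OF refl], rule sum.cong[OF refl], rule sum.swap, rule sum.cong[OF refl], rule sum.swap)

lemma sum4_rotate: "sum4 (\<lambda>i j k l. f k i l j) = sum4 f"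
  by (rule trans[OF sum4_swap(3)[of "\<lambda>i j k l. f j i l k"] trans[OF sum4_swap(1)[of "\<lambda>i j k l. f i j l k"] sum4_swap(2)]])

text \<open>Exchanging two summation indices of n costs the sign of u. Consequently all terms of an
  alternating sum over such exchanges contribute equally once they are contracted with u.\<close>

lemma sum4_antisym:
  assumes "\<And>i j k l. u i j k l = - u j i k l" "\<And>i j k l. u i j k l = - u i j l k"
  shows "sum4 (\<lambda>i j k l. n j i k l * u i j k l) = - sum4 (\<lambda>i j k l. n i j k l * u i j k l)"
    "sum4 (\<lambda>i j k l. n i j l k * u i j k l) = - sum4 (\<lambda>i j k l. n i j k l * u i j k l)"
    "sum4 (\<lambda>i j k l. n j i l k * u i j k l) = sum4 (\<lambda>i j k l. n i j k l * u i j k l)"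
proof -
  have neg: "sum4 (\<lambda>i j k l. - f i j k l) = - sum4 f" for f by (simp add: sum4_def sum_negf)
  have 1: "sum4 (\<lambda>i j k l. n j i k l * u i j k l) = - sum4 (\<lambda>i j k l. n i j k l * u i j k l)" for n
    unfolding neg[symmetric] sum4_swap(1)[of "\<lambda>i j k l. n j i k l * u i j k l", symmetric] by (subst assms(1)) simp
  have 2: "sum4 (\<lambda>i j k l. n i j l k * u i j k l) = - sum4 (\<lambda>i j k l. n i j k l * u i j k l)" for n
    unfolding neg[symmetric] sum4_swap(2)[of "\<lambda>i j k l. n i j l k * u i j k l", symmetric] by (subst assms(2)) simp
  show "sum4 (\<lambda>i j k l. n j i k l * u i j k l) = - sum4 (\<lambda>i j k l. n i j k l * u i j k l)" by (rule 1)
  show "sum4 (\<lambda>i j k l. n i j l k * u i j k l) = - sum4 (\<lambda>i j k l. n i j k l * u i j k l)" by (rule 2)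
  show "sum4 (\<lambda>i j k l. n j i l k * u i j k l) = sum4 (\<lambda>i j k l. n i j k l * u i j k l)"
    using 1[of "\<lambda>i j k l. n i j l k"] 2[of n] by simp
qed

text \<open>The four terms of \<open>inc_gcross\<close> contribute equally against the antisymmetric
  u, which cancels the factor 4 of \<open>ip2_gcross\<close>. A relabelling of indices together with
  the pair symmetry of u then produces the slot exchange of \<open>Sop\<close>.\<close>

lemma ip4_inc:
  fixes e :: "3 \<Rightarrow> real^3"
  assumes s: "tensor_field \<sigma>" and x: "x \<in> T" and e: "onb (G x) e" and U: "bilinear U" "\<And>X Y. U X Y = U Y X"
  shows "ip4 e (nabnab2 T G \<sigma> x) (Sop (Aop (G x) U)) = - ip2 e (inc T G \<sigma> x) U"
proof -
  interpret inner3 "G x" by (rule inner[OF x])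
  define n where "n i j k l = nabnab2 T G \<sigma> x (e i) (e j) (e k) (e l)" for i j k l
  define u where "u i j k l = U (gcross (G x) (e i) (e j)) (gcross (G x) (e k) (e l))" for i j k l
  have u: "u i j k l = - u j i k l" "u i j k l = - u i j l k" "u i j k l = u k l i j" for i j k l
    unfolding u_def using gcross_antisym[of "e i" "e j"] gcross_antisym[of "e k" "e l"] U
    by (auto simp: bilinear_simps[OF U(1)])
  \<comment> \<open>The slot order of the first term in \<open>inc_gcross\<close>, with V, W, Y, Z
    the frame vectors of index i, j, k, l. The other three terms are m with i, j or k, l
    exchanged.\<close>
  define m where "m i j k l = n k i l j" for i j k l
  have "4 * ip2 e (inc T G \<sigma> x) U = sum4 (\<lambda>i j k l. (m i j k l - m j i k l - m i j l k + m j i l k) * u i j k l)"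
    unfolding ip2_gcross[OF e bilinear_inc[OF s x] U(1), symmetric] inc_gcross[OF s x] n_def m_def u_def sum4_def ..
  also have "\<dots> = sum4 (\<lambda>i j k l. m i j k l * u i j k l) - sum4 (\<lambda>i j k l. m j i k l * u i j k l)
      - sum4 (\<lambda>i j k l. m i j l k * u i j k l) + sum4 (\<lambda>i j k l. m j i l k * u i j k l)"
    unfolding sum4_def by (simp only: left_diff_distrib distrib_right sum_subtractf sum.distrib)
  also have "\<dots> = 4 * sum4 (\<lambda>i j k l. m i j k l * u i j k l)"
    unfolding sum4_antisym[of u m, OF u(1,2)] by simp
  finally have "ip2 e (inc T G \<sigma> x) U = sum4 (\<lambda>i j k l. m i j k l * u i j k l)" by simp
  also have "\<dots> = sum4 (\<lambda>i j k l. n i j k l * u i k j l)"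
    unfolding sum4_rotate[of "\<lambda>i j k l. n i j k l * u i k j l", symmetric] m_def by (subst u(3)) (rule refl)
  finally show ?thesis
    by (simp add: ip4_def Sop_def Aop_def n_def u_def sum4_def sum_negf)
qed

lemma ip4_Inc:
  fixes e :: "3 \<Rightarrow> real^3"
  assumes x: "x \<in> T" and U: "bilinear U" "\<And>X Y. U X Y = U Y X"
  shows "ip4 e (Inc T G \<sigma> x) (Aop (G x) U) = - ip4 e (nabnab2 T G \<sigma> x) (Sop (Aop (G x) U))"
proof -
  interpret inner3 "G x" by (rule inner[OF x])
  define m where "m i j k l = nabnab2 T G \<sigma> x (e i) (e k) (e j) (e l)" for i j k l
  define a where "a i j k l = Aop (G x) U (e i) (e j) (e k) (e l)" for i j k l
  have a: "a i j k l = - a j i k l" "a i j k l = - a i j l k" for i j k l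
    unfolding a_def Aop_def using gcross_antisym[of "e i" "e j"] gcross_antisym[of "e k" "e l"]
    by (auto simp: bilinear_simps[OF U(1)])
  \<comment> \<open>\<open>P\<close> is self-adjoint and fixes \<open>SA\<close>: each of its four terms contributes the same sum.\<close>
  have "ip4 e (Inc T G \<sigma> x) (Aop (G x) U) = - sum4 (\<lambda>i j k l. (m i j k l - m j i k l + m j i l k - m i j l k) * a i j k l) / 4"
    unfolding ip4_def Inc_def Sop_def Pop_def m_def a_def sum4_def
    by (simp add: sum_negf sum_divide_distrib)
  also have "sum4 (\<lambda>i j k l. (m i j k l - m j i k l + m j i l k - m i j l k) * a i j k l) = sum4 (\<lambda>i j k l. m i j k l * a i j k l)
      - sum4 (\<lambda>i j k l. m j i k l * a i j k l) + sum4 (\<lambda>i j k l. m j i l k * a i j k l) - sum4 (\<lambda>i j k l. m i j l k * a i j k l)"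
    unfolding sum4_def by (simp only: left_diff_distrib distrib_right sum_subtractf sum.distrib)
  also have "\<dots> = 4 * sum4 (\<lambda>i j k l. m i j k l * a i j k l)"
    unfolding sum4_antisym[of a m, OF a] by simp
  also have "sum4 (\<lambda>i j k l. m i j k l * a i j k l) = sum4 (\<lambda>i j k l. m i k j l * a i k j l)"
    by (rule sum4_swap(3)[symmetric])
  finally show ?thesis by (simp add: ip4_def Sop_def m_def a_def sum4_def)
qed

end


subsection \<open>Adapted frames on facets and edges\<close>

locale elem_metric = element \<phi> T N \<psi> for \<phi> T N \<psi> +
  fixes g :: pw2
  assumes inner_g: "x \<in> T \<Longrightarrow> inner3 (g T x)" and smooth_g: "smooth_upto T (\<lambda>x. g T x X Y)"
begin

sublocale riem T "g T"
  by (intro riem.intro full_domain.intro riem_axioms.intro tangent_space_T inner_g smooth_g)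

lemma smooth_unit_vec:
  assumes "smooth_upto T u" "\<And>x. x \<in> T \<Longrightarrow> u x \<noteq> 0"
  shows "smooth_upto T (\<lambda>x. unit_vec (g T x) (u x))"
  unfolding unit_vec_def
  by (intro smooth_intros smooth_upto_divide smooth_upto_sqrt smooth_upto_bil[OF bilG smooth] assms)
     (use inner3.pos[OF inner assms(2)] in force)+

lemma smooth_gcross_field:
  assumes "smooth_upto T u" "smooth_upto T v"
  shows "smooth_upto T (\<lambda>x. gcross (g T x) (u x) (v x))"
proof (rule smooth_upto_vec)
  fix i
  have "bilinear (\<lambda>X Y. gcross (g T x) X Y $ i)" if "x \<in> T" for x
    using inner3.bilinear_gcross[OF inner[OF that]] by (auto simp: bilinear_def linear_iff)
  then show "smooth_upto T (\<lambda>x. gcross (g T x) (u x) (v x) $ i)"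
    by (rule smooth_upto_bil[OF _ smooth_upto_nth[OF smooth_gcross] assms])
qed

end

text \<open>a and b span the edge, c completes the facet and w the element. Gram-Schmidt in this
  order yields the edge tangent \<open>e1\<close>, the conormal \<open>e2\<close> and the normal
  \<open>e3\<close>, all as smooth fields on the whole element.\<close>

locale facet_frame = elem_metric \<phi> T N \<psi> g for \<phi> T N \<psi> g +
  fixes a b c w :: "real^3"
  assumes verts: "a \<in> ref_verts" "b \<in> ref_verts" "c \<in> ref_verts" "w \<in> ref_verts" "distinct [a, b, c, w]"
begin

definition "e1 x = unit_vec (g T x) (push (b - a) x)"
definition "e2 x = gs2 (g T x) (push (b - a) x) (push (c - a) x)"
definition "e3 x = gs3 (g T x) (push (b - a) x) (push (c - a) x) (push (w - a) x)"
definition F where "F = \<phi> ` (convex hull {a, b, c})"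
definition E where "E = \<phi> ` (convex hull {a, b})"
definition fr :: "real^3 \<Rightarrow> 2 \<Rightarrow> real^3" where "fr x i = (if i = 1 then e1 x else e2 x)"

lemma ref_verts_eq: "ref_verts = {a, b, c, w}"
proof -
  have "card {a, b, c, w} = 4" using verts by (simp add: card_insert_if)
  then show ?thesis using card_subset_eq[OF finite_ref_verts(1), of "{a, b, c, w}"] verts finite_ref_verts(2) by auto
qed

lemma T_eq: "T = \<phi> ` (convex hull (insert w {a, b, c}))"
  unfolding T ref_tet_def ref_verts_eq by (simp add: insert_commute)

lemma F_eq: "F = \<phi> ` (convex hull (insert c {a, b}))"
  unfolding F_def by (simp add: insert_commute)

lemma F_sub: "F \<subseteq> T" unfolding F_def by (rule face_sub) (use verts in auto)

lemma E_sub: "E \<subseteq> F" unfolding F_def E_def by (intro image_mono hull_mono) auto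

lemma E_sub_T: "E \<subseteq> T" using E_sub F_sub by auto

lemmas indep = push_independent[OF _ verts]

lemma smooth_e1: "smooth_upto T e1"
  unfolding e1_def by (rule smooth_unit_vec[OF smooth_push indep(1)])

lemma smooth_e2: "smooth_upto T e2"
proof -
  have *: "e2 x = unit_vec (g T x) (push (c - a) x - g T x (push (c - a) x) (e1 x) *\<^sub>R e1 x)" for x
    unfolding e2_def gs2_def e1_def Let_def ..
  show ?thesis unfolding *[abs_def]
  proof (rule smooth_unit_vec)
    show "smooth_upto T (\<lambda>x. push (c - a) x - g T x (push (c - a) x) (e1 x) *\<^sub>R e1 x)"
      by (intro smooth_intros smooth_upto_bil[OF bilG smooth] smooth_push smooth_e1)
    show "push (c - a) x - g T x (push (c - a) x) (e1 x) *\<^sub>R e1 x \<noteq> 0" if "x \<in> T" for x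
      unfolding e1_def by (rule inner3.gs2(5)[OF inner indep(1,2)]) (use that in auto)
  qed
qed

lemma smooth_e3: "smooth_upto T e3"
proof -
  have *: "e3 x = unit_vec (g T x) (push (w - a) x - g T x (push (w - a) x) (e1 x) *\<^sub>R e1 x - g T x (push (w - a) x) (e2 x) *\<^sub>R e2 x)" for x
    unfolding e3_def gs3_def e1_def e2_def Let_def ..
  show ?thesis unfolding *[abs_def]
  proof (rule smooth_unit_vec)
    show "smooth_upto T (\<lambda>x. push (w - a) x - g T x (push (w - a) x) (e1 x) *\<^sub>R e1 x - g T x (push (w - a) x) (e2 x) *\<^sub>R e2 x)"
      by (intro smooth_intros smooth_upto_bil[OF bilG smooth] smooth_push smooth_e1 smooth_e2)
    show "push (w - a) x - g T x (push (w - a) x) (e1 x) *\<^sub>R e1 x - g T x (push (w - a) x) (e2 x) *\<^sub>R e2 x \<noteq> 0" if "x \<in> T" for x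
      unfolding e1_def e2_def by (rule inner3.gs3(5)[OF inner indep]) (use that in auto)
  qed
qed

lemma orthonormal:
  assumes "x \<in> T"
  shows "g T x (e1 x) (e1 x) = 1" "g T x (e2 x) (e2 x) = 1" "g T x (e3 x) (e3 x) = 1"
    "g T x (e1 x) (e2 x) = 0" "g T x (e2 x) (e1 x) = 0" "g T x (e1 x) (e3 x) = 0" "g T x (e3 x) (e1 x) = 0"
    "g T x (e2 x) (e3 x) = 0" "g T x (e3 x) (e2 x) = 0"
  using inner3.unit_vec_unit[OF inner[OF assms] indep(1)[OF assms]] inner3.gs2(1,2)[OF inner[OF assms] indep(1,2)[OF assms]]
    inner3.gs3(1,2,3)[OF inner[OF assms] indep[OF assms]] symG[OF assms]
  unfolding e1_def e2_def e3_def by metis+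

lemma onb_fr: assumes "x \<in> T" shows "onb (g T x) (fr x)"
  unfolding onb_def forall_2 using orthonormal[OF assms] by (simp add: fr_def)

lemma e3_fr: assumes "x \<in> T" shows "g T x (e3 x) (fr x i) = 0"
  using orthonormal[OF assms] by (simp add: fr_def)

lemma tangent_F:
  assumes x: "x \<in> F"
  shows "tangent_space F x = span {push (b - a) x, push (c - a) x}"
proof -
  have xT: "x \<in> T" using x F_sub by auto
  have l: "linear (\<lambda>u. push u x)" by (rule linear_push) (use xT T_sub in auto)
  have "tangent_space F x = span ((\<lambda>u. push u x) ` (\<lambda>v. v - a) ` {a, b, c})"
    unfolding F_def linear_span_image[OF l]
    by (rule tangent_space_face) (use verts x F_def in auto)
  then show ?thesis by (simp add: linear_0[OF l])
qed

lemma tangent_E: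
  assumes x: "x \<in> E"
  shows "tangent_space E x = span {push (b - a) x}"
proof -
  have xT: "x \<in> T" using x E_sub F_sub by auto
  have l: "linear (\<lambda>u. push u x)" by (rule linear_push) (use xT T_sub in auto)
  have "tangent_space E x = span ((\<lambda>u. push u x) ` (\<lambda>v. v - a) ` {a, b})"
    unfolding E_def linear_span_image[OF l]
    by (rule tangent_space_face) (use verts x E_def in auto)
  then show ?thesis by (simp add: linear_0[OF l])
qed

lemma e1_E: "x \<in> E \<Longrightarrow> e1 x \<in> tangent_space E x"
  unfolding tangent_E e1_def using inner3.unit_vec_span[OF inner] E_sub_T by blast

lemma fr_F: assumes "x \<in> F" shows "fr x i \<in> tangent_space F x"
proof -
  have xT: "x \<in> T" using assms F_sub by auto
  have "e1 x \<in> span {push (b - a) x, push (c - a) x}"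
    unfolding e1_def using inner3.unit_vec_span[OF inner[OF xT]] span_mono[of "{push (b - a) x}" "{push (b - a) x, push (c - a) x}"] by auto
  moreover have "e2 x \<in> span {push (b - a) x, push (c - a) x}"
    unfolding e2_def by (rule inner3.gs2(4)[OF inner[OF xT] indep(1,2)[OF xT]])
  ultimately show ?thesis unfolding tangent_F[OF assms] fr_def by simp
qed

lemma dim_F: "x \<in> F \<Longrightarrow> dim (tangent_space F x) \<le> CARD(2)"
  unfolding tangent_F dim_span
  using dim_le_card'[of "{push (b - a) x, push (c - a) x}"] card_insert_le_m1[of 2 "{push (c - a) x}" "push (b - a) x"] by simp

lemma e3_orth: assumes "x \<in> F" "X \<in> tangent_space F x" shows "g T x (e3 x) X = 0"
proof -
  have xT: "x \<in> T" using assms F_sub by auto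
  interpret inner3 "g T x" by (rule inner[OF xT])
  have "X = (\<Sum>i\<in>UNIV. g T x X (fr x i) *\<^sub>R fr x i)"
    by (rule onb_expand[OF onb_fr[OF xT] fr_F[OF assms(1)] dim_F[OF assms(1)] assms(2)])
  then have "g T x (e3 x) X = g T x (e3 x) (\<Sum>i\<in>UNIV. g T x X (fr x i) *\<^sub>R fr x i)" by (rule arg_cong)
  then show ?thesis by (simp add: h_simps e3_fr[OF xT])
qed

lemma nrm_eq: assumes x: "x \<in> F" shows "nrm g T F x = e3 x"
proof -
  have xT: "x \<in> T" using x F_sub by auto
  obtain r where r: "r > 0" "e3 x - r *\<^sub>R push (w - a) x \<in> span {push (b - a) x, push (c - a) x}"
    using inner3.gs3(4)[OF inner[OF xT] indep[OF xT]] unfolding e3_def by blast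
  have "inward_normal (g T x) (\<phi> ` (convex hull (insert w {a, b, c}))) (\<phi> ` (convex hull {a, b, c})) x = e3 x"
    by (rule inward_normal_eq[OF _ _ _ _ _ inner[OF xT], of "{a, b, c}" w a _ _ r])
       (use verts x e3_orth[OF x] orthonormal[OF xT] r tangent_F[OF x] in \<open>auto simp: F_def\<close>)
  then show ?thesis unfolding nrm_def T_eq[symmetric] F_def[symmetric] .
qed

lemma conrm_eq: assumes x: "x \<in> E" shows "conrm g T F E x = e2 x"
proof -
  have xT: "x \<in> T" using x E_sub_T by auto
  interpret inner3 "g T x" by (rule inner[OF xT])
  obtain r where r: "r > 0" "e2 x - r *\<^sub>R push (c - a) x \<in> span {push (b - a) x}"
    using gs2(3)[OF indep(1,2)[OF xT]] unfolding e2_def by blast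
  have o: "g T x (e2 x) X = 0" if "X \<in> tangent_space E x" for X
  proof -
    obtain k where k: "X = k *\<^sub>R push (b - a) x" using \<open>X \<in> tangent_space E x\<close>[unfolded tangent_E[OF x]] by (auto simp: span_singleton)
    have "push (b - a) x = sqrt (g T x (push (b - a) x) (push (b - a) x)) *\<^sub>R e1 x"
      using pos[OF indep(1)[OF xT]] by (simp add: e1_def unit_vec_def)
    then show ?thesis unfolding k using orthonormal(5)[OF xT] by (metis bilinear_rmul[OF bil] mult_zero_right real_scaleR_def)
  qed
  have "inward_normal (g T x) (\<phi> ` (convex hull (insert c {a, b}))) (\<phi> ` (convex hull {a, b})) x = e2 x"
    by (rule inward_normal_eq[OF _ _ _ _ _ inner3_axioms, of "{a, b}" c a _ _ r])
       (use verts x o orthonormal[OF xT] r tangent_E[OF x] in \<open>auto simp: E_def\<close>)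
  then show ?thesis unfolding conrm_def F_eq[symmetric] E_def[symmetric] .
qed

text \<open>The extension is \<open>push u\<close> for a fixed direction u of the reference facet.
  Its existence gives the \<open>SOME\<close> in \<open>II\<close> an admissible field to
  pick.\<close>

lemma tangent_extension:
  assumes x: "x \<in> F" and v: "v \<in> tangent_space F x"
  shows "\<exists>X\<in>tangent_fields F. X x = v"
proof -
  let ?V = "{a, b, c}"
  have t: "tangent_space F y = (\<lambda>u. push u y) ` span ((\<lambda>v. v - a) ` ?V)" if "y \<in> F" for y
    unfolding F_def by (rule tangent_space_face) (use verts that F_def in auto)
  then obtain u where u: "u \<in> span ((\<lambda>v. v - a) ` ?V)" "v = push u x" using x v by blast
  have "push u \<in> tangent_fields F"
    unfolding tangent_fields_def using t u(1) smooth_upto_subset[OF smooth_push F_sub] by auto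
  then show ?thesis using u(2) by blast
qed

lemma frame_exists: "x \<in> F \<Longrightarrow> \<exists>e :: 2 \<Rightarrow> real^3. (\<forall>i. e i \<in> tangent_space F x) \<and> (\<forall>i j. g T x (e i) (e j) = (if i = j then 1 else 0))"
  using fr_F onb_fr F_sub unfolding onb_def by blast

lemma frameF:
  assumes "x \<in> F"
  shows "frameF (g T x) F x i \<in> tangent_space F x" "onb (g T x) (frameF (g T x) F x)"
  using someI_ex[OF frame_exists[OF assms]] unfolding frameF_def oframe_def onb_def by auto

lemma frameE:
  assumes x: "x \<in> E"
  shows "frameE (g T x) E x 1 \<in> tangent_space E x" "g T x (frameE (g T x) E x 1) (frameE (g T x) E x 1) = 1"
proof -
  have xT: "x \<in> T" using x E_sub_T by auto
  have "\<exists>e :: 1 \<Rightarrow> real^3. (\<forall>i. e i \<in> tangent_space E x) \<and> (\<forall>i j. g T x (e i) (e j) = (if i = j then 1 else 0))"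
    by (rule exI[of _ "\<lambda>_. e1 x"]) (use e1_E[OF x] orthonormal[OF xT] in auto)
  from someI_ex[OF this] show "frameE (g T x) E x 1 \<in> tangent_space E x" "g T x (frameE (g T x) E x 1) (frameE (g T x) E x 1) = 1"
    unfolding frameE_def oframe_def by auto
qed

lemma tau:
  assumes x: "x \<in> E" and t: "t \<in> tangent_space E x" and U: "bilinear U"
  shows "U (gcross (g T x) (nrm g T F x) (conrm g T F E x)) (gcross (g T x) (nrm g T F x) (conrm g T F E x)) * g T x t t = U t t"
proof -
  have xT: "x \<in> T" and xF: "x \<in> F" using x E_sub F_sub by auto
  interpret inner3 "g T x" by (rule inner[OF xT])
  obtain k where k: "t = k *\<^sub>R push (b - a) x" using t tangent_E[OF x] by (auto simp: span_singleton)
  have "push (b - a) x = sqrt (g T x (push (b - a) x) (push (b - a) x)) *\<^sub>R e1 x"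
    using pos[OF indep(1)[OF xT]] by (simp add: e1_def unit_vec_def)
  then obtain l where l: "t = l *\<^sub>R e1 x" using k by (metis scaleR_scaleR)
  show ?thesis
    unfolding nrm_eq[OF xF] conrm_eq[OF x]
    by (rule tangent_component) (use orthonormal[OF xT] U in \<open>auto simp: l h_simps\<close>)
qed

subsubsection \<open>The second fundamental form and the facet integrand\<close>

text \<open>An extension of \<open>B_nu\<close> from the facet to the element: \<open>\<nu>\<close>
  is replaced by \<open>e3\<close> and every derivative is taken on T. The two agree on tangent
  vectors of F, but this one is bilinear in X, Y and smooth on T.\<close>

definition Bt :: "(real^3 \<Rightarrow> tensor2) \<Rightarrow> real^3 \<Rightarrow> tensor2" where
  "Bt \<sigma> x X Y = \<sigma> x (e3 x) (e3 x) * (g T x (e3 x) (\<Gamma> x X Y) - dD T (\<lambda>y. g T y (e3 y) Y) x X)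
     + nab2 T (g T) \<sigma> x X (e3 x) Y
     + (dD T (\<lambda>y. \<sigma> y (e3 y) Y) x X - \<sigma> x (e3 x) (\<Gamma> x X Y))
     - nab2 T (g T) \<sigma> x (e3 x) X Y"

text \<open>Differentiating \<open>g(\<nu>,Y) = 0\<close> along \<open>F\<close> removes the extension of \<open>Y\<close>.\<close>

lemma II_eq:
  assumes x: "x \<in> F" and X: "X \<in> tangent_space F x" and Y: "Y \<in> tangent_space F x"
  shows "II g T F x X Y = g T x (e3 x) (\<Gamma> x X Y) - dD T (\<lambda>y. g T y (e3 y) Y) x X"
proof -
  have xT: "x \<in> T" using x F_sub by auto
  define Y' where "Y' = (SOME Y'. Y' \<in> tangent_fields F \<and> Y' x = Y)"
  have Y': "Y' \<in> tangent_fields F" "Y' x = Y"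
    using someI_ex[of "\<lambda>Y'. Y' \<in> tangent_fields F \<and> Y' x = Y"] tangent_extension[OF x Y] unfolding Y'_def by auto
  have sY: "smooth_upto F Y'" "\<And>y. y \<in> F \<Longrightarrow> Y' y \<in> tangent_space F y" using Y'(1) unfolding tangent_fields_def by auto
  \<comment> \<open>Components of the covector g(\<nu>,.). The chosen field Y' is known to be smooth
    only up to F, so the product rule is applied componentwise within F.\<close>
  define k where "k j y = g T y (e3 y) (axis j 1)" for j y
  have k: "smooth_upto T (k j)" for j
    unfolding k_def by (intro smooth_upto_bil[OF bilG smooth] smooth_e3 smooth_upto_const)
  have gk: "g T y (e3 y) v = (\<Sum>j\<in>UNIV. k j y * v $ j)" if "y \<in> T" for y v
    using linear_vec3[of "g T y (e3 y)" v] bilG[OF that] by (simp add: bilinear_def k_def sum_3 mult.commute)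
  have dY: "(Y' has_derivative dD F Y' x) (at x within F)" by (rule smooth_upto_has_derivative[OF sY(1) x])
  have dk: "(k j has_derivative dD T (k j) x) (at x within F)" for j
    by (rule has_derivative_subset[OF has_dD[OF k xT] F_sub])
  have "((\<lambda>y. \<Sum>j\<in>UNIV. k j y * Y' y $ j) has_derivative (\<lambda>v. \<Sum>j\<in>UNIV. k j x * dD F Y' x v $ j + dD T (k j) x v * Y' x $ j)) (at x within F)"
    by (intro has_derivative_sum has_derivative_mult dk bounded_linear.has_derivative[OF bounded_linear_vec_nth dY])
  moreover have "((\<lambda>y. \<Sum>j\<in>UNIV. k j y * Y' y $ j) has_derivative (\<lambda>v. 0)) (at x within F)"
  proof (rule has_derivative_transform[OF x _ has_derivative_const])
    show "(\<Sum>j\<in>UNIV. k j y * Y' y $ j) = 0" if "y \<in> F" for y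
      using gk[of y "Y' y"] e3_orth[OF that sY(2)[OF that]] that F_sub by auto
  qed
  ultimately have "(\<Sum>j\<in>UNIV. k j x * dD F Y' x X $ j + dD T (k j) x X * Y' x $ j) = 0"
    by (rule has_derivative_tangent_unique[OF _ _ X])
  moreover have "dD T (\<lambda>y. g T y (e3 y) Y) x X = (\<Sum>j\<in>UNIV. dD T (k j) x X * Y $ j)"
  proof -
    have "dD T (\<lambda>y. g T y (e3 y) Y) x X = dD T (\<lambda>y. \<Sum>j\<in>UNIV. k j y * Y $ j) x X"
      by (rule dD_same[OF gk _ xT]) (assumption, intro smooth_intros k)
    also have "\<dots> = (\<Sum>j\<in>UNIV. dD T (\<lambda>y. k j y * Y $ j) x X)"
      by (rule dD_sum[OF _ _ xT]) (auto intro: smooth_intros k)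
    also have "\<dots> = (\<Sum>j\<in>UNIV. dD T (k j) x X * Y $ j)"
      by (simp add: dD_mult[OF k smooth_upto_const xT] dD_const[OF xT])
    finally show ?thesis .
  qed
  ultimately have "g T x (e3 x) (dD F Y' x X) = - dD T (\<lambda>y. g T y (e3 y) Y) x X"
    by (simp add: gk[OF xT] Y'(2) sum.distrib)
  then show ?thesis
    unfolding II_def cov_vec_def Y'_def[symmetric] nrm_eq[OF x] Y'(2) by (simp add: bilinear_radd[OF bilG[OF xT]])
qed

lemma nab_nu_eq:
  assumes s: "tensor_field (\<sigma> T)" and x: "x \<in> F" and X: "X \<in> tangent_space F x"
  shows "nab_nu g T F \<sigma> x X Y = dD T (\<lambda>y. \<sigma> T y (e3 y) Y) x X - \<sigma> T x (e3 x) (\<Gamma> x X Y)"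
proof -
  have "dD F (\<lambda>y. \<sigma> T y (nrm g T F y) Y) x X = dD T (\<lambda>y. \<sigma> T y (e3 y) Y) x X"
    by (rule dD_cong[OF _ smooth_tensor[OF s smooth_e3 smooth_upto_const] F_sub x X])
       (use nrm_eq tangent_space_T x F_sub in auto)
  then show ?thesis unfolding nab_nu_def nrm_eq[OF x] by simp
qed

lemma B_nu_eq:
  assumes s: "tensor_field (\<sigma> T)" and x: "x \<in> F" and X: "X \<in> tangent_space F x" and Y: "Y \<in> tangent_space F x"
  shows "B_nu g T F \<sigma> x X Y = Bt (\<sigma> T) x X Y"
  unfolding B_nu_def Let_def nrm_eq[OF x] II_eq[OF x X Y] nab_nu_eq[of \<sigma>, OF s x X] Bt_def ..

text \<open>Freezing the normal at x in the first term makes the derivative visibly bilinear in X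
  and Y, as \<open>bilinear_Bt\<close> requires.\<close>

lemma dD_normal:
  assumes s: "tensor_field \<sigma>" and x: "x \<in> T"
  shows "dD T (\<lambda>y. \<sigma> y (e3 y) Y) x X = dD T (\<lambda>y. \<sigma> y (e3 x) Y) x X + \<sigma> x (dD T e3 x X) Y"
  using dD_bil[of \<sigma> e3 "\<lambda>_. Y" x X, OF tensor_fieldD[OF s] smooth_e3 smooth_upto_const x]
    dD_const[OF x, of Y X] bilinear_rzero[OF tensor_fieldD(1)[OF s x], of "e3 x"] by simp

lemma tensor_field_g: "tensor_field (g T)"
  unfolding tensor_field_def using bilG smooth by blast

lemma bilinear_Bt:
  assumes s: "tensor_field \<sigma>" and x: "x \<in> T"
  shows "bilinear (Bt \<sigma> x)"
proof -
  note 1 = bilinear_simps[OF bilinear_christoffel[OF x]] bilinear_simps[OF tensor_fieldD(1)[OF s x]]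
    bilinear_simps[OF bilG[OF x]]
    bilinear_simps[OF dD_bilinear[OF tensor_fieldD[OF s] x]] bilinear_simps[OF dD_bilinear[OF tensor_fieldD[OF tensor_field_g] x]]
    linear_add[OF dD_linear[OF tensor_fieldD(2)[OF s] x]] linear_cmul[OF dD_linear[OF tensor_fieldD(2)[OF s] x]]
    linear_add[OF dD_linear[OF smooth x]] linear_cmul[OF dD_linear[OF smooth x]]
    linear_add[OF dD_linear[OF smooth_e3 x]] linear_cmul[OF dD_linear[OF smooth_e3 x]]
    bilinear_simps[OF nab2_linear(2)[OF s x]] linear_add[OF nab2_linear(1)[OF s x]] linear_cmul[OF nab2_linear(1)[OF s x]]
  show ?thesis
    unfolding bilinear_def Bt_def dD_normal[OF s x] dD_normal[OF tensor_field_g x]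
    by (intro conjI allI linearI) (simp_all add: 1 algebra_simps)
qed

lemma smooth_Bt:
  assumes s: "tensor_field \<sigma>"
  shows "smooth_upto T (\<lambda>x. Bt \<sigma> x X Y)"
proof -
  have n1: "smooth_upto T (\<lambda>x. nab2 T (g T) \<sigma> x X (e3 x) Y)"
    by (rule smooth_upto_bil[of T "\<lambda>x. nab2 T (g T) \<sigma> x X" e3 "\<lambda>_. Y"])
       (auto intro: nab2_linear[OF s] smooth_nab2[OF s] smooth_e3 smooth_upto_const)
  have "bilinear (\<lambda>A C. nab2 T (g T) \<sigma> x A X C)" if "x \<in> T" for x
    using nab2_linear[OF s that] by (simp add: bilinear_def)
  then have n2: "smooth_upto T (\<lambda>x. nab2 T (g T) \<sigma> x (e3 x) X Y)"
    by (rule smooth_upto_bil[of T "\<lambda>x A C. nab2 T (g T) \<sigma> x A X C" e3 "\<lambda>_. Y"])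
       (auto intro: smooth_nab2[OF s] smooth_e3 smooth_upto_const)
  show ?thesis
    unfolding Bt_def
    by (intro smooth_intros n1 n2 smooth_dD smooth_tensor[OF s] smooth_tensor[OF tensor_field_g] smooth_e3 smooth_christoffel)
qed

definition At :: "(real^3 \<Rightarrow> tensor2) \<Rightarrow> real^3 \<Rightarrow> tensor2" where
  "At U x X Y = - U x (gcross (g T x) X (e3 x)) (gcross (g T x) (e3 x) Y)"

lemma A_FnnF_eq: "x \<in> F \<Longrightarrow> A_FnnF g T F (A_g g U) x X Y = At (U T) x X Y"
  by (simp add: A_FnnF_def nrm_eq A_g_def Aop_def At_def)

lemma bilinear_At: 
  assumes s: "tensor_field U" and x: "x \<in> T" shows "bilinear (At U x)"
  unfolding bilinear_def At_def
  by (intro conjI allI linearI)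
     (simp_all add: bilinear_simps[OF inner3.bilinear_gcross[OF inner[OF x]]] bilinear_simps[OF tensor_fieldD(1)[OF s x]])

text \<open>The frame chosen at each point in \<open>frameF\<close> need not vary continuously; here
  the smooth Gram-Schmidt frame \<open>fr\<close> takes its place.\<close>

definition integrand :: "(real^3 \<Rightarrow> tensor2) \<Rightarrow> (real^3 \<Rightarrow> tensor2) \<Rightarrow> real^3 \<Rightarrow> real" where
  "integrand \<sigma> U x = ip2 (fr x) (Bt \<sigma> x) (At U x)"

lemma integrand_eq:
  assumes s: "tensor_field (\<sigma> T)" and u: "tensor_field (U T)" and x: "x \<in> F"
  shows "ip2 (frameF (g T x) F x) (B_nu g T F \<sigma> x) (A_FnnF g T F (A_g g U) x) = integrand (\<sigma> T) (U T) x"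
proof -
  have xT: "x \<in> T" using x F_sub by auto
  have "ip2 (frameF (g T x) F x) (B_nu g T F \<sigma> x) (A_FnnF g T F (A_g g U) x)
     = ip2 (frameF (g T x) F x) (Bt (\<sigma> T) x) (At (U T) x)"
    unfolding ip2_def by (simp add: B_nu_eq[of \<sigma>, OF s x] frameF[OF x] A_FnnF_eq[OF x])
  also have "\<dots> = integrand (\<sigma> T) (U T) x"
    unfolding integrand_def
    by (rule inner3.ip2_frame[OF inner[OF xT] frameF(2,1)[OF x] onb_fr[OF xT] fr_F[OF x] dim_F[OF x]
          bilinear_Bt[OF s xT] bilinear_At[OF u xT]])
  finally show ?thesis .
qed

lemma smooth_fr: "smooth_upto T (\<lambda>x. fr x i)"
  by (cases "i = 1") (simp_all add: fr_def smooth_e1 smooth_e2)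

lemma continuous_integrand:
  assumes s: "tensor_field \<sigma>" and u: "tensor_field U"
  shows "continuous_on F (integrand \<sigma> U)"
proof -
  have "smooth_upto T (integrand \<sigma> U)"
    unfolding integrand_def ip2_def At_def
    by (intro smooth_intros smooth_upto_bil[OF bilinear_Bt[OF s] smooth_Bt[OF s]] smooth_fr smooth_tensor[OF u]
        smooth_gcross_field smooth_e3)
  then show ?thesis using smooth_upto_continuous_on smooth_upto_subset F_sub by blast
qed

lemma continuous_edge_jump:
  assumes "tensor_field (\<sigma> T)"
  shows "continuous_on E (\<lambda>x. \<sigma> T x (nrm g T F x) (conrm g T F E x))"
proof -
  have "smooth_upto E (\<lambda>x. \<sigma> T x (e3 x) (e2 x))"
    by (rule smooth_upto_subset[OF smooth_tensor[OF assms smooth_e3 smooth_e2] E_sub_T])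
  from smooth_upto_continuous_on[OF this] show ?thesis
    by (rule continuous_on_eq) (use nrm_eq conrm_eq E_sub in auto)
qed

lemma continuous_A_mnnm:
  assumes "tensor_field (U T)"
  shows "continuous_on E (\<lambda>x. A_mnnm g T F E (A_g g U) x)"
proof -
  have "smooth_upto T (\<lambda>x. - U T x (gcross (g T x) (e2 x) (e3 x)) (gcross (g T x) (e3 x) (e2 x)))"
    by (intro smooth_intros smooth_tensor[OF assms] smooth_gcross_field smooth_e3 smooth_e2)
  from smooth_upto_continuous_on[OF smooth_upto_subset[OF this E_sub_T]] show ?thesis
    by (rule continuous_on_eq) (use nrm_eq conrm_eq E_sub in \<open>auto simp: A_mnnm_def A_g_def Aop_def subset_iff\<close>)
qed

end


subsection \<open>Parametrizations and integrals\<close>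

lemma smooth_on_compose:
  assumes "open S" "open R" "h ` S \<subseteq> R" "smooth_on R f" "\<And>k. C_k_on k S h"
  shows "smooth_on S (\<lambda>x. f (h x))"
  unfolding smooth_on_def
proof
  fix k
  have "C_k_on k R f" using assms(4) unfolding smooth_on_def by blast
  then show "C_k_on k S (\<lambda>x. f (h x))" by (rule C_k_on_compose[OF assms(1-3) _ assms(5)])
qed

text \<open>The parametrizations in \<open>facet_int\<close> and \<open>edge_int\<close> are chosen
  by \<open>SOME\<close>, so nothing can be said about these integrals before one exists. A chart
  composed with an affine injection of the parameter domain provides it.\<close>

lemma regular_paramI:
  fixes h :: "'a::euclidean_space \<Rightarrow> real^3" and L :: "'a \<Rightarrow> real^3"
  assumes N: "open N" "smooth_on N \<phi>" and inv: "\<And>p. p \<in> N \<Longrightarrow> \<psi> (\<phi> p) = p"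
    and d\<phi>: "\<And>p. p \<in> N \<Longrightarrow> (\<phi> has_derivative D p) (at p)" "\<And>p. p \<in> N \<Longrightarrow> inj (D p)"
    and L: "linear L" "inj L" "\<And>p. h p = a + L p" and K: "h ` K \<subseteq> N"
  shows "regular_param K (\<phi> ` h ` K) (\<lambda>p. \<phi> (h p))"
proof -
  have bl: "bounded_linear L" using L(1) by (simp add: linear_conv_bounded_linear)
  have dh: "(h has_derivative L) (at p)" for p
    unfolding L(3)[abs_def] by (auto intro!: derivative_eq_intros bounded_linear.has_derivative[OF bl])
  have Ck: "C_k_on k S h" if "open S" for k S
    unfolding L(3)[abs_def] by (intro C_k_on_add C_k_on_const C_k_on_bounded_linear[OF bl] C_k_on_id that)
  have ih: "inj h" by (rule injI) (use L(3) injD[OF L(2)] in auto)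
  have d: "((\<lambda>p. \<phi> (h p)) has_derivative (\<lambda>v. D (h p) (L v))) (at p)" if "h p \<in> N" for p
    by (rule has_derivative_compose[OF dh d\<phi>(1)[OF that]])
  have op: "open (h -` N)" using N(1) Ck[OF open_UNIV, of 0] by (simp add: continuous_on_open_vimage)
  have "inj_on (\<lambda>p. \<phi> (h p)) K"
  proof (rule inj_onI)
    fix p q assume *: "p \<in> K" "q \<in> K" "\<phi> (h p) = \<phi> (h q)"
    then have N: "h p \<in> N" "h q \<in> N" using K by auto
    have "h p = \<psi> (\<phi> (h p))" using inv[OF N(1)] by (rule sym)
    also have "\<dots> = h q" unfolding *(3) by (rule inv[OF N(2)])
    finally have "h p = h q" .
    then show "p = q" by (rule injD[OF ih])
  qed
  moreover have "inj (frechet_derivative (\<lambda>p. \<phi> (h p)) (at p))" if "p \<in> K" for p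
  proof -
    have hp: "h p \<in> N" using K that by auto
    have "frechet_derivative (\<lambda>p. \<phi> (h p)) (at p) = (\<lambda>v. D (h p) (L v))"
      using frechet_derivative_at[OF d[OF hp]] by simp
    then show ?thesis using inj_compose[OF d\<phi>(2)[OF hp] L(2)] by (simp add: comp_def)
  qed
  moreover have "smooth_on (h -` N) (\<lambda>p. \<phi> (h p))"
    by (rule smooth_on_compose[OF op N(1) _ N(2) Ck[OF op]]) auto
  ultimately show ?thesis
    unfolding regular_param_def using op K by (intro conjI exI[of _ "h -` N"] ballI) (auto simp: image_image)
qed

lemma regular_param:
  assumes "regular_param K D \<gamma>"
  shows "p \<in> K \<Longrightarrow> \<gamma> p \<in> D" "continuous_on K \<gamma>"
    "continuous_on K (\<lambda>p. frechet_derivative \<gamma> (at p) v)"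
    "p \<in> K \<Longrightarrow> (\<gamma> has_derivative frechet_derivative \<gamma> (at p)) (at p)"
proof -
  obtain N where N: "open N" "K \<subseteq> N" "smooth_on N \<gamma>" using assms unfolding regular_param_def by blast
  have C: "C_k_on (Suc 0) N \<gamma>" using N(3) unfolding smooth_on_def by blast
  show "p \<in> K \<Longrightarrow> \<gamma> p \<in> D" using assms unfolding regular_param_def by auto
  show "continuous_on K \<gamma>" using C_k_on_SucD[OF C] N(2) by (auto intro: continuous_on_subset)
  show "continuous_on K (\<lambda>p. frechet_derivative \<gamma> (at p) v)" using C N(2) by (auto intro: continuous_on_subset)
  show "p \<in> K \<Longrightarrow> (\<gamma> has_derivative frechet_derivative \<gamma> (at p)) (at p)"
    using C_k_on_has_derivative[OF C] N(2) by auto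
qed

lemma compact_ref_tri: "compact ref_tri"
proof -
  have "closed ref_tri"
    unfolding ref_tri_def
    by (intro closed_Collect_conj closed_Collect_le continuous_intros)
  moreover have "bounded ref_tri"
    unfolding bounded_iff
  proof (intro exI ballI)
    fix p :: "real^2" assume "p \<in> ref_tri"
    then show "norm p \<le> 1" using norm_le_l1_cart[of p] by (auto simp: ref_tri_def sum_2)
  qed
  ultimately show ?thesis by (simp add: compact_eq_bounded_closed)
qed

text \<open>The area element evaluates the metric on these vectors only. Metrics that agree
  tangentially, such as those of the two elements at a facet, therefore give the same facet
  integral.\<close>

lemma regular_param_tangent:
  assumes r: "regular_param ref_tri D \<gamma>" and p: "p \<in> ref_tri"
  shows "frechet_derivative \<gamma> (at p) (axis i 1) \<in> tangent_space D (\<gamma> p)"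
proof -
  let ?d = "frechet_derivative \<gamma> (at p)"
  note d = regular_param(4)[OF r p]
  have lin: "linear ?d" using d has_derivative_linear by blast
  have c: "?d (q - p) \<in> tangent_space D (\<gamma> p)" if q: "q \<in> ref_tri" for q
  proof -
    have "((\<lambda>t. p + t *\<^sub>R (q - p)) has_derivative (\<lambda>t. t *\<^sub>R (q - p))) (at 0)"
      by (auto intro!: derivative_eq_intros)
    from has_derivative_compose[OF this, of \<gamma> ?d] d
    have "((\<lambda>t. \<gamma> (p + t *\<^sub>R (q - p))) has_vector_derivative ?d (q - p)) (at (0::real))"
      unfolding has_vector_derivative_def by (simp add: linear_cmul[OF lin])
    then have "((\<lambda>t. \<gamma> (p + t *\<^sub>R (q - p))) has_vector_derivative ?d (q - p)) (at (0::real) within {0..1})"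
      by (rule has_vector_derivative_at_within)
    moreover have "\<gamma> (p + t *\<^sub>R (q - p)) \<in> D" if t: "t \<in> {0..1}" for t
    proof (rule regular_param(1)[OF r])
      have "p $ j + t * (q $ j - p $ j) = (1 - t) * p $ j + t * q $ j" for j by (simp add: algebra_simps)
      moreover have "(1 - t) * p $ 1 + t * q $ 1 + ((1 - t) * p $ 2 + t * q $ 2)
          = (1 - t) * (p $ 1 + p $ 2) + t * (q $ 1 + q $ 2)" by (simp add: algebra_simps)
      moreover have "\<dots> \<le> (1 - t) * 1 + t * 1"
        using p q t by (intro add_mono mult_left_mono) (auto simp: ref_tri_def)
      ultimately show "p + t *\<^sub>R (q - p) \<in> ref_tri"
        using p q t by (auto simp: ref_tri_def)
    qed
    ultimately have "?d (q - p) \<in> tangent_cone D (\<gamma> p)"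
      unfolding tangent_cone_def by (intro CollectI exI[of _ "\<lambda>t. \<gamma> (p + t *\<^sub>R (q - p))"]) auto
    then show ?thesis unfolding tangent_space_def by (rule span_base)
  qed
  \<comment> \<open>The axis direction itself may point out of the triangle at p, but it is the
    difference of the directions from p to two vertices, to which \<open>c\<close> applies.\<close>
  have "axis i (1::real) \<in> ref_tri" "0 \<in> ref_tri"
    using exhaust_2[of i] by (auto simp: ref_tri_def axis_def)
  from this[THEN c] have "?d (axis i 1 - p) - ?d (0 - p) \<in> tangent_space D (\<gamma> p)"
    unfolding tangent_space_def by (rule span_diff)
  then show ?thesis by (simp add: linear_diff[OF lin, symmetric])
qed

lemma elem_int_cong: "(\<And>x. x \<in> T \<Longrightarrow> f x = f' x) \<Longrightarrow> elem_int T h f = elem_int T h f'"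
  unfolding elem_int_def set_lebesgue_integral_def
  by (intro Bochner_Integration.integral_cong refl) (auto simp: indicator_def)

lemma elem_int_cmul: "elem_int T h (\<lambda>x. c * f x) = c * elem_int T h f"
  unfolding elem_int_def by (simp add: mult.assoc)

lemma facet_int_cong:
  assumes r: "\<exists>\<gamma>. regular_param ref_tri F \<gamma>" and f: "\<And>x. x \<in> F \<Longrightarrow> f x = f' x"
    and h: "\<And>x X Y. x \<in> F \<Longrightarrow> X \<in> tangent_space F x \<Longrightarrow> Y \<in> tangent_space F x \<Longrightarrow> h x X Y = h' x X Y"
  shows "facet_int F h f = facet_int F h' f'"
proof -
  have r: "regular_param ref_tri F (facet_param F)" unfolding facet_param_def using r by (rule someI_ex)
  show ?thesis
    unfolding facet_int_def Let_def set_lebesgue_integral_def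
    by (intro Bochner_Integration.integral_cong refl)
       (auto simp: indicator_def f[OF regular_param(1)[OF r]]
          h[OF regular_param(1)[OF r] regular_param_tangent[OF r] regular_param_tangent[OF r]])
qed

lemma facet_int_cmul: "facet_int F h (\<lambda>x. c * f x) = c * facet_int F h f"
  unfolding facet_int_def Let_def by (simp add: mult.assoc)

text \<open>Additivity of the Bochner integral requires integrable summands. Here this follows from
  continuity on the compact reference triangle.\<close>

lemma facet_int_sum:
  assumes r: "\<exists>\<gamma>. regular_param ref_tri F \<gamma>" and f: "\<And>i. i \<in> I \<Longrightarrow> continuous_on F (f i)"
    and h: "\<And>x. x \<in> F \<Longrightarrow> bilinear (h x)" "\<And>X Y. continuous_on F (\<lambda>x. h x X Y)"
  shows "facet_int F h (\<lambda>x. \<Sum>i\<in>I. f i x) = (\<Sum>i\<in>I. facet_int F h (f i))"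
proof -
  define \<gamma> where "\<gamma> = facet_param F"
  have r: "regular_param ref_tri F \<gamma>" unfolding \<gamma>_def facet_param_def using r by (rule someI_ex)
  let ?d = "\<lambda>i p. frechet_derivative \<gamma> (at p) (axis i 1)"
  have hh: "continuous_on ref_tri (\<lambda>p. h (\<gamma> p) (?d i p) (?d j p))" for i j
  proof (rule continuous_on_eq)
    show "continuous_on ref_tri (\<lambda>p. \<Sum>k\<in>UNIV. \<Sum>l\<in>UNIV. ?d i p $ k * ?d j p $ l * h (\<gamma> p) (axis k 1) (axis l 1))"
      by (intro continuous_intros regular_param(3)[OF r] continuous_on_compose2[OF h(2) regular_param(2)[OF r]])
         (use regular_param(1)[OF r] in auto)
  qed (rule bilinear_axis[OF h(1)[OF regular_param(1)[OF r]], symmetric])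
  have "integrable lborel (\<lambda>p. indicator ref_tri p *\<^sub>R (f i (\<gamma> p) *
     sqrt (h (\<gamma> p) (?d 1 p) (?d 1 p) * h (\<gamma> p) (?d 2 p) (?d 2 p) - (h (\<gamma> p) (?d 1 p) (?d 2 p))\<^sup>2)))" if "i \<in> I" for i
    by (intro borel_integrable_compact[OF compact_ref_tri] continuous_intros hh
       continuous_on_compose2[OF f[OF that] regular_param(2)[OF r]]) (use regular_param(1)[OF r] in auto)
  from Bochner_Integration.integral_sum[of I, OF this]
  show ?thesis
    unfolding facet_int_def Let_def set_lebesgue_integral_def \<gamma>_def[symmetric]
    by (simp add: sum_distrib_right sum_distrib_left)
qed

lemma edge_int_cong:
  assumes r: "\<exists>\<gamma> :: real \<Rightarrow> real^3. regular_param {0..1} E \<gamma>" and f: "\<And>x. x \<in> E \<Longrightarrow> f x = f' x"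
  shows "edge_int E h f = edge_int E h f'"
proof -
  have r: "regular_param {0..1} E (edge_param E)" unfolding edge_param_def using r by (rule someI_ex)
  show ?thesis
    unfolding edge_int_def Let_def set_lebesgue_integral_def
    by (intro Bochner_Integration.integral_cong refl) (auto simp: indicator_def f[OF regular_param(1)[OF r]])
qed

lemma edge_int_sum:
  assumes r: "\<exists>\<gamma> :: real \<Rightarrow> real^3. regular_param {0..1} E \<gamma>" and f: "\<And>i. i \<in> I \<Longrightarrow> continuous_on E (f i)"
    and h: "\<And>x. x \<in> E \<Longrightarrow> bilinear (h x)" "\<And>X Y. continuous_on E (\<lambda>x. h x X Y)"
  shows "edge_int E h (\<lambda>x. \<Sum>i\<in>I. f i x) = (\<Sum>i\<in>I. edge_int E h (f i))"
proof -
  define \<gamma> where "\<gamma> = edge_param E"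
  have r: "regular_param {0..1} E \<gamma>" unfolding \<gamma>_def edge_param_def using r by (rule someI_ex)
  let ?d = "\<lambda>p. frechet_derivative \<gamma> (at p) 1"
  have hh: "continuous_on {0..1} (\<lambda>p. h (\<gamma> p) (?d p) (?d p))"
  proof (rule continuous_on_eq)
    show "continuous_on {0..1} (\<lambda>p. \<Sum>k\<in>UNIV. \<Sum>l\<in>UNIV. ?d p $ k * ?d p $ l * h (\<gamma> p) (axis k 1) (axis l 1))"
      by (intro continuous_intros regular_param(3)[OF r] continuous_on_compose2[OF h(2) regular_param(2)[OF r]])
         (use regular_param(1)[OF r] in auto)
  qed (rule bilinear_axis[OF h(1)[OF regular_param(1)[OF r]], symmetric])
  have "integrable lborel (\<lambda>p. indicator {0..1} p *\<^sub>R (f i (\<gamma> p) * sqrt (h (\<gamma> p) (?d p) (?d p))))" if "i \<in> I" for i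
    by (intro borel_integrable_compact compact_Icc continuous_intros hh
       continuous_on_compose2[OF f[OF that] regular_param(2)[OF r]]) (use regular_param(1)[OF r] in auto)
  from Bochner_Integration.integral_sum[of I, OF this]
  show ?thesis
    unfolding edge_int_def Let_def set_lebesgue_integral_def \<gamma>_def[symmetric]
    by (simp add: sum_distrib_right sum_distrib_left)
qed

context element
begin

lemma inj_push: assumes "p \<in> N" shows "inj (\<lambda>u. push u (\<phi> p))"
  using pull_push[of "\<phi> p"] assms by (metis imageI injI)

end

context facet_frame
begin

text \<open>Any linear relation between these edge directions is carried by the chart derivative to
  the pushed vectors, whose independence is already known.\<close>

lemma affine_independent:
  assumes "s *\<^sub>R (b - a) + t *\<^sub>R (c - a) = 0" shows "s = 0" "t = 0"
proof -
  have x: "\<phi> a \<in> T" using T_eq verts by (auto simp: hull_inc)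
  have l: "linear (\<lambda>u. push u (\<phi> a))" by (rule linear_push) (use x T_sub in auto)
  have 0: "s *\<^sub>R push (b - a) (\<phi> a) + t *\<^sub>R push (c - a) (\<phi> a) = 0"
    using linear_0[OF l] unfolding assms[symmetric] linear_add[OF l] linear_cmul[OF l] .
  show t: "t = 0"
  proof (rule ccontr)
    assume t: "t \<noteq> 0"
    have "push (c - a) (\<phi> a) = (1 / t) *\<^sub>R (t *\<^sub>R push (c - a) (\<phi> a))" using t by simp
    also have "t *\<^sub>R push (c - a) (\<phi> a) = - (s *\<^sub>R push (b - a) (\<phi> a))"
      using 0 by (simp add: eq_neg_iff_add_eq_0 add.commute)
    finally have eq: "push (c - a) (\<phi> a) = (- s / t) *\<^sub>R push (b - a) (\<phi> a)" by simp
    have "push (c - a) (\<phi> a) \<in> span {push (b - a) (\<phi> a)}"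
      unfolding eq by (intro span_scale span_base) simp
    then show False using indep(2)[OF x] by blast
  qed
  show "s = 0" using 0 t indep(1)[OF x] by simp
qed

lemma regular_facet: "\<exists>\<gamma>. regular_param ref_tri F \<gamma>"
proof -
  define L where "L p = p $ 1 *\<^sub>R (b - a) + p $ 2 *\<^sub>R (c - a)" for p :: "real^2"
  have L: "linear L" by (rule linearI) (simp_all add: L_def algebra_simps)
  have "inj L"
    unfolding linear_injective_0[OF L]
  proof (intro allI impI)
    fix p assume "L p = 0"
    then have "p $ 1 = 0" "p $ 2 = 0" unfolding L_def by (rule affine_independent)+
    then show "p = 0" by (simp add: vec_eq_iff forall_2)
  qed
  moreover have hull: "(\<lambda>p. a + L p) ` ref_tri = convex hull {a, b, c}"
  proof
    show "(\<lambda>p. a + L p) ` ref_tri \<subseteq> convex hull {a, b, c}"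
    proof clarify
      fix p assume "p \<in> ref_tri"
      then show "a + L p \<in> convex hull {a, b, c}"
        unfolding convex_hull_3_alt
        by (intro CollectI exI[of _ "p $ 1"] exI[of _ "p $ 2"]) (auto simp: ref_tri_def L_def)
    qed
    show "convex hull {a, b, c} \<subseteq> (\<lambda>p. a + L p) ` ref_tri"
    proof
      fix q assume "q \<in> convex hull {a, b, c}"
      then obtain u v where q: "q = a + u *\<^sub>R (b - a) + v *\<^sub>R (c - a)" "0 \<le> u" "0 \<le> v" "u + v \<le> 1"
        unfolding convex_hull_3_alt by blast
      have "q = a + L (vector [u, v])" by (simp add: q(1) L_def add.assoc)
      moreover have "vector [u, v] \<in> ref_tri" using q(2-) by (simp add: ref_tri_def)
      ultimately show "q \<in> (\<lambda>p. a + L p) ` ref_tri" by blast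
    qed
  qed
  ultimately have "regular_param ref_tri (\<phi> ` (\<lambda>p. a + L p) ` ref_tri) (\<lambda>p. \<phi> (a + L p))"
    using N hull_sub[of "{a, b, c}"] verts
    by (intro regular_paramI[OF N(1) \<phi> inv d\<phi> inj_push L]) auto
  then show ?thesis unfolding hull F_def by blast
qed

lemma regular_edge: "\<exists>\<gamma> :: real \<Rightarrow> real^3. regular_param {0..1} E \<gamma>"
proof -
  define L where "L t = t *\<^sub>R (b - a)" for t :: real
  have L: "linear L" by (rule linearI) (simp_all add: L_def algebra_simps)
  have "inj L" using verts by (auto simp: inj_def L_def)
  moreover have hull: "(\<lambda>p. a + L p) ` {0..1} = convex hull {a, b}"
    unfolding convex_hull_2_alt L_def by (auto simp: image_def)
  ultimately have "regular_param {0..1} (\<phi> ` (\<lambda>p. a + L p) ` {0..1}) (\<lambda>p. \<phi> (a + L p))"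
    using N hull_sub[of "{a, b}"] verts
    by (intro regular_paramI[OF N(1) \<phi> inv d\<phi> inj_push L]) auto
  then show ?thesis unfolding hull E_def by blast
qed

end


subsection \<open>The triangulation\<close>

lemma ip2_jump: "ip2 e (jump M F B) W = (\<Sum>T\<in>facet_elems M F. ip2 e (B T) W)"
proof -
  have "ip2 e (jump M F B) W = (\<Sum>i\<in>UNIV. \<Sum>T\<in>facet_elems M F. \<Sum>j\<in>UNIV. B T (e i) (e j) * W (e i) (e j))"
    unfolding ip2_def jump_def sum_distrib_right by (rule sum.cong[OF refl], rule sum.swap)
  also have "\<dots> = (\<Sum>T\<in>facet_elems M F. ip2 e (B T) W)"
    unfolding ip2_def by (rule sum.swap)
  finally show ?thesis .
qed

lemma ip2_cong: "(\<And>i j. V (e i) (e j) = V' (e i) (e j)) \<Longrightarrow> (\<And>i j. W (e i) (e j) = W' (e i) (e j)) \<Longrightarrow> ip2 e V W = ip2 e V' W'"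
  by (simp add: ip2_def)

text \<open>Only values on V enter the predicate under \<open>SOME\<close>, so both metrics have the
  same set of admissible frames and the choice returns literally the same one. This makes frames on
  a facet agree from both sides.\<close>

lemma oframe_cong:
  assumes "\<And>X Y. X \<in> V \<Longrightarrow> Y \<in> V \<Longrightarrow> h X Y = h' X Y"
  shows "(oframe h V :: 'n::finite \<Rightarrow> real^3) = oframe h' V"
proof -
  have "((\<forall>i. e i \<in> V) \<and> (\<forall>i j. h (e i) (e j) = (if i = j then 1 else 0)))
      = ((\<forall>i. e i \<in> V) \<and> (\<forall>i j. h' (e i) (e j) = (if i = j then 1 else 0)))" for e :: "'n \<Rightarrow> real^3"
    using assms by auto
  then show ?thesis by (simp only: oframe_def)
qed

locale regge =
  fixes M :: mesh and g :: pw2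
  assumes tri: "triangulated_domain M" and gM: "g \<in> Reg_plus M"
begin

lemma triD:
  "T \<in> m_elems M \<Longrightarrow> curved_tet (m_chart M T) T"
  "T \<in> m_elems M \<Longrightarrow> T' \<in> m_elems M \<Longrightarrow> k \<le> 2 \<Longrightarrow> D \<in> faces M k T \<Longrightarrow> D \<subseteq> T' \<Longrightarrow> D \<in> faces M k T'"
  "F \<in> int_facets M \<Longrightarrow> card (facet_elems M F) = 2"
  "E \<in> int_edges M \<Longrightarrow> T \<in> m_elems M \<Longrightarrow> T' \<in> m_elems M \<Longrightarrow> E \<subseteq> T \<and> E \<subseteq> T' \<Longrightarrow>
        (T, T') \<in> {(T1, T2). T1 \<in> m_elems M \<and> T2 \<in> m_elems M \<and> (\<exists>F \<in> faces M 2 T1 \<inter> faces M 2 T2. E \<subseteq> F)}\<^sup>*"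
proof -
  note t = tri[unfolded triangulated_domain_def]
  show "T \<in> m_elems M \<Longrightarrow> curved_tet (m_chart M T) T" using t by (elim conjE) (erule (1) bspec)
  have a: "\<forall>T\<in>m_elems M. \<forall>T'\<in>m_elems M. \<forall>k\<le>2. \<forall>G\<in>faces M k T. G \<subseteq> T' \<longrightarrow> G \<in> faces M k T'"
    using t by (elim conjE)
  show "T \<in> m_elems M \<Longrightarrow> T' \<in> m_elems M \<Longrightarrow> k \<le> 2 \<Longrightarrow> D \<in> faces M k T \<Longrightarrow> D \<subseteq> T' \<Longrightarrow> D \<in> faces M k T'"
    using a by blast
  show "F \<in> int_facets M \<Longrightarrow> card (facet_elems M F) = 2" using t by (elim conjE) (erule (1) bspec)
  have b: "\<forall>E\<in>int_edges M. \<forall>T\<in>m_elems M. \<forall>T'\<in>m_elems M. E \<subseteq> T \<and> E \<subseteq> T' \<longrightarrow>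
        (T, T') \<in> {(T1, T2). T1 \<in> m_elems M \<and> T2 \<in> m_elems M \<and> (\<exists>F \<in> faces M 2 T1 \<inter> faces M 2 T2. E \<subseteq> F)}\<^sup>*"
    using t by (elim conjE)
  show "(T, T') \<in> {(T1, T2). T1 \<in> m_elems M \<and> T2 \<in> m_elems M \<and> (\<exists>F \<in> faces M 2 T1 \<inter> faces M 2 T2. E \<subseteq> F)}\<^sup>*"
    if "E \<in> int_edges M" "T \<in> m_elems M" "T' \<in> m_elems M" "E \<subseteq> T \<and> E \<subseteq> T'"
    by (rule b[rule_format, OF that])
qed

lemma gReg: "g \<in> Reg M" using gM by (simp add: Reg_plus_def)

lemma finite_elems: "finite (m_elems M)" using tri by (simp add: triangulated_domain_def)

lemma RegD:
  assumes "\<sigma> \<in> Reg M" "T \<in> m_elems M"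
  shows "x \<in> T \<Longrightarrow> bilinear (\<sigma> T x)" "x \<in> T \<Longrightarrow> \<sigma> T x X Y = \<sigma> T x Y X" "smooth_upto T (\<lambda>x. \<sigma> T x X Y)"
proof -
  have *: "(\<forall>x\<in>T. bilinear (\<sigma> T x) \<and> (\<forall>X Y. \<sigma> T x X Y = \<sigma> T x Y X)) \<and> (\<forall>X Y. smooth_upto T (\<lambda>x. \<sigma> T x X Y))"
    using assms unfolding Reg_def mem_Collect_eq by (elim conjE) (rule bspec)
  show "x \<in> T \<Longrightarrow> bilinear (\<sigma> T x)" using * by simp
  show "\<sigma> T x X Y = \<sigma> T x Y X" if "x \<in> T" using conjunct1[OF *] that by (elim ballE) auto
  show "smooth_upto T (\<lambda>x. \<sigma> T x X Y)" using * by simp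
qed

lemma inner_g:
  assumes "T \<in> m_elems M" "x \<in> T" shows "inner3 (g T x)"
  using RegD[OF gReg assms(1)] assms gM unfolding Reg_plus_def by (intro inner3.intro) auto

lemma elem:
  assumes T: "T \<in> m_elems M"
  shows "\<exists>N \<psi>. elem_metric (m_chart M T) T N \<psi> g"
proof -
  obtain N \<psi> where N: "T = m_chart M T ` ref_tet" "open N" "ref_tet \<subseteq> N" "smooth_on N (m_chart M T)"
    "open (m_chart M T ` N)" "smooth_on (m_chart M T ` N) \<psi>" "\<forall>p\<in>N. \<psi> (m_chart M T p) = p"
    using triD(1)[OF T] unfolding curved_tet_def by (elim conjE exE)
  have "elem_metric (m_chart M T) T N \<psi> g"
    by (intro elem_metric.intro element.intro elem_metric_axioms.intro) (use N inner_g[OF T] RegD[OF gReg T] in auto)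
  then show ?thesis by blast
qed

lemma riem: assumes T: "T \<in> m_elems M" shows "riem T (g T)"
proof -
  obtain N \<psi> where "elem_metric (m_chart M T) T N \<psi> g" using elem[OF T] by blast
  then interpret elem_metric "m_chart M T" T N \<psi> g .
  show ?thesis by (rule riem_axioms)
qed

lemma tensor_field:
  assumes "\<sigma> \<in> Reg M" and T: "T \<in> m_elems M" shows "riem.tensor_field T (\<sigma> T)"
  unfolding riem.tensor_field_def[OF riem[OF T]] using RegD[OF assms] by blast

lemma facet_sub: "T \<in> facet_elems M F \<Longrightarrow> F \<subseteq> T"
  and facet_elemD: "T \<in> facet_elems M F \<Longrightarrow> T \<in> m_elems M" "T \<in> facet_elems M F \<Longrightarrow> F \<in> faces M 2 T"
proof -
  assume T: "T \<in> facet_elems M F"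
  then show e: "T \<in> m_elems M" "F \<in> faces M 2 T" by (auto simp: facet_elems_def)
  obtain N \<psi> where "elem_metric (m_chart M T) T N \<psi> g" using elem[OF e(1)] by blast
  then interpret elem_metric "m_chart M T" T N \<psi> g .
  show "F \<subseteq> T" using e(2) face_sub unfolding faces_def by auto
qed

lemma card_4_remove:
  assumes "V \<subseteq> ref_verts" "card V = 3" shows "\<exists>w. w \<in> ref_verts - V"
proof (rule ccontr)
  assume "\<not> ?thesis"
  then have "ref_verts = V" using assms(1) by auto
  then show False using assms(2) finite_ref_verts(2) by simp
qed

lemma facet_frame:
  assumes T: "T \<in> facet_elems M F"
  obtains N \<psi> a b c w where "facet_frame (m_chart M T) T N \<psi> g a b c w" "F = facet_frame.F (m_chart M T) a b c"
proof -
  note e = facet_elemD[OF T]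
  obtain N \<psi> where em: "elem_metric (m_chart M T) T N \<psi> g" using elem[OF e(1)] by blast
  obtain V where V: "F = m_chart M T ` (convex hull V)" "V \<subseteq> ref_verts" "card V = 3"
    using e(2) unfolding faces_def by auto
  obtain a b c where abc: "V = {a, b, c}" "a \<noteq> b" "b \<noteq> c" "a \<noteq> c" using V(3) by (auto simp: card_3_iff)
  obtain w where w: "w \<in> ref_verts" "w \<notin> V" using card_4_remove[OF V(2,3)] by auto
  have ff: "facet_frame (m_chart M T) T N \<psi> g a b c w"
    by (intro facet_frame.intro em facet_frame_axioms.intro) (use V w abc in auto)
  have "F = facet_frame.F (m_chart M T) a b c"
    unfolding facet_frame.F_def[OF ff] using V(1) abc(1) by simp
  with ff show ?thesis by (rule that)
qed

text \<open>E comes as an edge of some element, with that element's chart. Conformity makes it an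
  edge of T; injectivity of the chart of T and \<open>vertex_in_hull\<close> then place its two
  vertices among those of F, which fixes the order a, b, c.\<close>

lemma edge_frame:
  assumes TF: "T \<in> facet_elems M F" and E: "E \<in> edges M" "E \<subseteq> F"
  obtains N \<psi> a b c w where "facet_frame (m_chart M T) T N \<psi> g a b c w" "F = facet_frame.F (m_chart M T) a b c"
    "E = facet_frame.E (m_chart M T) a b"
proof -
  note e = facet_elemD[OF TF]
  obtain N \<psi> where em: "elem_metric (m_chart M T) T N \<psi> g" using elem[OF e(1)] by blast
  interpret elem_metric "m_chart M T" T N \<psi> g by (rule em)
  obtain V where V: "F = m_chart M T ` (convex hull V)" "V \<subseteq> ref_verts" "card V = 3"
    using e(2) unfolding faces_def by auto
  obtain w where w: "w \<in> ref_verts" "w \<notin> V" using card_4_remove[OF V(2,3)] by auto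
  obtain T' where T': "T' \<in> m_elems M" "E \<in> faces M 1 T'" using E(1) unfolding edges_def by auto
  have ET: "E \<subseteq> T" using E(2) facet_sub[OF TF] by auto
  have "E \<in> faces M 1 T"
    by (rule triD(2)[OF T'(1) e(1) _ T'(2) ET]) simp
  then obtain W where W: "E = m_chart M T ` (convex hull W)" "W \<subseteq> ref_verts" "card W = 2"
    unfolding faces_def by auto
  have "convex hull W \<subseteq> convex hull V"
  proof
    fix p assume p: "p \<in> convex hull W"
    then have "m_chart M T p \<in> F" using E(2) W(1) by auto
    then obtain q where q: "q \<in> convex hull V" "m_chart M T p = m_chart M T q" unfolding V(1) by auto
    have pN: "p \<in> N" using p hull_sub[OF W(2)] N(2) by blast
    have qN: "q \<in> N" using q(1) hull_sub[OF V(2)] N(2) by blast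
    have "p = \<psi> (m_chart M T p)" using inv[OF pN] by (rule sym)
    also have "\<dots> = q" unfolding q(2) by (rule inv[OF qN])
    finally show "p \<in> convex hull V" using q(1) by simp
  qed
  then have "W \<subseteq> V" by (rule vertex_in_hull[OF V(2) W(2)])
  obtain a b where ab: "W = {a, b}" "a \<noteq> b" using W(3) by (auto simp: card_2_iff)
  have "card (V - W) = 1" using \<open>W \<subseteq> V\<close> V(3) W(3) by (simp add: card_Diff_subset ab)
  then obtain c where c: "V - W = {c}" by (auto simp: card_1_singleton_iff)
  have Vabc: "V = {a, b, c}" "c \<noteq> a" "c \<noteq> b" using c \<open>W \<subseteq> V\<close> ab(1) by auto
  have ff: "facet_frame (m_chart M T) T N \<psi> g a b c w"
    by (intro facet_frame.intro em facet_frame_axioms.intro) (use V w Vabc ab in auto)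
  have F: "F = facet_frame.F (m_chart M T) a b c"
    unfolding facet_frame.F_def[OF ff] using V(1) Vabc(1) by simp
  have "E = facet_frame.E (m_chart M T) a b"
    unfolding facet_frame.E_def[OF ff] using W(1) ab(1) by simp
  with ff F show ?thesis by (rule that)
qed

lemma side: assumes "F \<in> int_facets M" shows "side M F \<in> facet_elems M F"
proof -
  have "facet_elems M F \<noteq> {}" using triD(3)[OF assms] by auto
  then show ?thesis unfolding side_def by (simp add: some_in_eq)
qed

lemma tangent_ext:
  assumes T: "T \<in> facet_elems M F" and x: "x \<in> F" and X: "X \<in> tangent_space F x"
  shows "\<exists>X'\<in>tangent_fields F. X' x = X"
proof -
  obtain N \<psi> a b c w where f: "facet_frame (m_chart M T) T N \<psi> g a b c w" "F = facet_frame.F (m_chart M T) a b c"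
    by (rule facet_frame[OF T])
  show ?thesis using facet_frame.tangent_extension[OF f(1)] x X unfolding f(2) by blast
qed

text \<open>\<open>Reg\<close> compares values on tangent fields. Since each tangent vector extends
  to such a field, the comparison holds pointwise.\<close>

lemma tt_continuous:
  assumes "\<sigma> \<in> Reg M" "F \<in> int_facets M" "T \<in> facet_elems M F" "T' \<in> facet_elems M F"
    and "x \<in> F" "X \<in> tangent_space F x" "Y \<in> tangent_space F x"
  shows "\<sigma> T x X Y = \<sigma> T' x X Y"
proof -
  obtain X' Y' where X: "X' \<in> tangent_fields F" "X' x = X" and Y: "Y' \<in> tangent_fields F" "Y' x = Y"
    using tangent_ext[OF assms(3,5,6)] tangent_ext[OF assms(3,5,7)] by blast
  have "\<forall>F\<in>int_facets M. \<forall>T\<in>facet_elems M F. \<forall>T'\<in>facet_elems M F.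
        \<forall>X\<in>tangent_fields F. \<forall>Y\<in>tangent_fields F. \<forall>x\<in>F. \<sigma> T x (X x) (Y x) = \<sigma> T' x (X x) (Y x)"
    using assms(1) unfolding Reg_def mem_Collect_eq by (rule conjunct2)
  from this[rule_format, OF assms(2-4) X(1) Y(1) assms(5)] show ?thesis unfolding X(2) Y(2) .
qed

lemma tt_boundary:
  assumes "U \<in> Reg0 M" "F \<in> bd_facets M" "T \<in> facet_elems M F"
    and "x \<in> F" "X \<in> tangent_space F x" "Y \<in> tangent_space F x"
  shows "U T x X Y = 0"
proof -
  obtain X' Y' where X: "X' \<in> tangent_fields F" "X' x = X" and Y: "Y' \<in> tangent_fields F" "Y' x = Y"
    using tangent_ext[OF assms(3,4,5)] tangent_ext[OF assms(3,4,6)] by blast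
  have "\<forall>F\<in>bd_facets M. \<forall>T\<in>facet_elems M F.
     \<forall>X\<in>tangent_fields F. \<forall>Y\<in>tangent_fields F. \<forall>x\<in>F. U T x (X x) (Y x) = 0"
    using assms(1) unfolding Reg0_def mem_Collect_eq by (rule conjunct2)
  from this[rule_format, OF assms(2,3) X(1) Y(1) assms(4)] show ?thesis unfolding X(2) Y(2) .
qed

lemma frameF_eq:
  assumes "F \<in> int_facets M" "T \<in> facet_elems M F" "x \<in> F"
  shows "frameF (g T x) F x = gF_frame M g F x"
  unfolding gF_frame_def frameF_def
  by (rule oframe_cong) (use tt_continuous[OF gReg assms(1,2) side[OF assms(1)] assms(3)] in blast)

lemma frameF_props:
  assumes T: "T \<in> facet_elems M F" and x: "x \<in> F"
  shows "frameF (g T x) F x i \<in> tangent_space F x" "onb (g T x) (frameF (g T x) F x)"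
    "g T x (nrm g T F x) (nrm g T F x) = 1" "g T x (nrm g T F x) (frameF (g T x) F x i) = 0"
proof -
  obtain N \<psi> a b c w where f: "facet_frame (m_chart M T) T N \<psi> g a b c w" "F = facet_frame.F (m_chart M T) a b c"
    by (rule facet_frame[OF T])
  interpret facet_frame "m_chart M T" T N \<psi> g a b c w by (rule f(1))
  have x: "x \<in> facet_frame.F (m_chart M T) a b c" using x f(2) by simp
  have xT: "x \<in> T" using x F_sub by auto
  show "frameF (g T x) F x i \<in> tangent_space F x" "onb (g T x) (frameF (g T x) F x)"
    "g T x (nrm g T F x) (nrm g T F x) = 1" "g T x (nrm g T F x) (frameF (g T x) F x i) = 0"
    unfolding f(2) using frameF[OF x] nrm_eq[OF x] orthonormal(3)[OF xT] e3_orth[OF x frameF(1)[OF x]] by auto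
qed

lemma gF_frame_props:
  assumes F: "F \<in> int_facets M" and T: "T \<in> facet_elems M F" and x: "x \<in> F"
  shows "gF_frame M g F x i \<in> tangent_space F x" "onb (g T x) (gF_frame M g F x)"
    "g T x (nrm g T F x) (nrm g T F x) = 1" "g T x (nrm g T F x) (gF_frame M g F x i) = 0"
  using frameF_props[OF T x] unfolding frameF_eq[OF assms] by auto

lemma A_FnnF_frame:
  assumes U: "U \<in> Reg M" and T: "T \<in> facet_elems M F" and x: "x \<in> F"
  defines "e \<equiv> frameF (g T x) F x"
  shows "A_FnnF g T F (A_g g U) x (e i) (e j) = (if i = j then tr2 e (U T x) else 0) - U T x (e i) (e j)"
proof -
  have xT: "x \<in> T" and Te: "T \<in> m_elems M" using x facet_sub[OF T] facet_elemD[OF T] by auto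
  show ?thesis
    unfolding A_FnnF_def A_g_def e_def
    by (rule inner3.Aop_facet[OF inner_g[OF Te xT] frameF_props(2,3,4)[OF T x] RegD(1,2)[OF U Te xT]])
qed

text \<open>The normal and the cross product depend on the full metric of T and may differ from side
  to side. The tangential components involve only tangential values of U and g, and so do
  not.\<close>

lemma A_FnnF_side:
  assumes U: "U \<in> Reg M" and F: "F \<in> int_facets M" and T: "T \<in> facet_elems M F" and x: "x \<in> F"
  defines "e \<equiv> gF_frame M g F x"
  shows "A_FnnF g T F (A_g g U) x (e i) (e j) = (if i = j then tr2 e (U (side M F) x) else 0) - U (side M F) x (e i) (e j)"
proof -
  have "U T x (e k) (e l) = U (side M F) x (e k) (e l)" for k l
    unfolding e_def by (rule tt_continuous[OF U F T side[OF F] x gF_frame_props(1,1)[OF F T x]])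
  then show ?thesis using A_FnnF_frame[OF U T x, unfolded frameF_eq[OF F T x]] unfolding e_def tr2_def by simp
qed

abbreviation flux :: "pw2 \<Rightarrow> pw2 \<Rightarrow> (real^3) set \<Rightarrow> (real^3) set \<Rightarrow> real^3 \<Rightarrow> real" where
  "flux \<sigma> U T F x \<equiv> ip2 (frameF (g T x) F x) (B_nu g T F \<sigma> x) (A_FnnF g T F (A_g g U) x)"

subsection \<open>Comparison of the integrals\<close>

lemma elem_int_cmul_cong: "(\<And>x. x \<in> T \<Longrightarrow> f x = c * f' x) \<Longrightarrow> elem_int T h f = c * elem_int T h f'"
  unfolding elem_int_cmul[symmetric] by (rule elem_int_cong)

lemma elem_int_Rw:
  assumes U: "U \<in> Reg M" and T: "T \<in> m_elems M"
  shows "elem_int T (g T) (\<lambda>x. ip4 (frameT (g T x)) (riemann T (g T) x) (A_g g U T x))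
     = 4 * elem_int T (g T) (\<lambda>x. ip2 (frameT (g T x)) (Q_curv T (g T) x) (U T x))"
proof (rule elem_int_cmul_cong, goal_cases)
  case x: (1 x)
  interpret riem T "g T" by (rule riem[OF T])
  interpret inner3 "g T x" by (rule inner[OF x])
  show ?case unfolding A_g_def Q_curv(3)[OF x, symmetric] by (rule ip4_Aop[OF onb_frameT Q_curv(1)[OF x] RegD(1)[OF U T x]])
qed

lemma elem_int_a:
  assumes s: "\<sigma> \<in> Reg M" and U: "U \<in> Reg M" and T: "T \<in> m_elems M"
  shows "elem_int T (g T) (\<lambda>x.
        ip4 (frameT (g T x)) (\<lambda>X Y Z W. riemann T (g T) x (Lend (g T x) (\<sigma> T x) X) Y Z W) (A_g g U T x)
        - 1/2 * tr2 (frameT (g T x)) (\<sigma> T x) * ip4 (frameT (g T x)) (riemann T (g T) x) (A_g g U T x))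
     = - 2 * elem_int T (g T) (\<lambda>x. triple (frameT (g T x)) (Q_curv T (g T) x) (\<sigma> T x) (U T x))"
proof (rule elem_int_cmul_cong, goal_cases)
  case x: (1 x)
  interpret riem T "g T" by (rule riem[OF T])
  interpret inner3 "g T x" by (rule inner[OF x])
  show ?case unfolding A_g_def Q_curv(3)[OF x, symmetric]
    by (rule ip4_Lend[OF onb_frameT Q_curv(1,2)[OF x] RegD(1,2)[OF s T x] RegD(1)[OF U T x]])
qed

lemma elem_int_b:
  assumes s: "\<sigma> \<in> Reg M" and U: "U \<in> Reg M" and T: "T \<in> m_elems M"
  shows "elem_int T (g T) (\<lambda>x. ip4 (frameT (g T x)) (nabnab2 T (g T) (\<sigma> T) x) (Sop (A_g g U T x)))
     = - 1 * elem_int T (g T) (\<lambda>x. ip2 (frameT (g T x)) (inc T (g T) (\<sigma> T) x) (U T x))"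
proof (rule elem_int_cmul_cong, goal_cases)
  case x: (1 x)
  interpret riem T "g T" by (rule riem[OF T])
  interpret inner3 "g T x" by (rule inner[OF x])
  show ?case unfolding A_g_def ip4_inc[OF tensor_field[OF s T] x onb_frameT RegD(1,2)[OF U T x]] by simp
qed

lemma elem_int_Inc:
  assumes U: "U \<in> Reg M" and T: "T \<in> m_elems M"
  shows "elem_int T (g T) (\<lambda>x. ip4 (frameT (g T x)) (Inc T (g T) (\<sigma> T) x) (A_g g U T x))
     = - 1 * elem_int T (g T) (\<lambda>x. ip4 (frameT (g T x)) (nabnab2 T (g T) (\<sigma> T) x) (Sop (A_g g U T x)))"
proof (rule elem_int_cmul_cong, goal_cases)
  case x: (1 x)
  interpret riem T "g T" by (rule riem[OF T])
  show ?case unfolding A_g_def ip4_Inc[OF x RegD(1,2)[OF U T x]] by simp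
qed

text \<open>T may be either element at F, because both lead to the same frame. Each summand of a
  jump can thus be treated with its own metric although A and U are taken from
  \<open>side M F\<close>.\<close>

lemma facet_adjoint:
  assumes U: "U \<in> Reg M" and F: "F \<in> int_facets M" and T: "T \<in> facet_elems M F" and x: "x \<in> F"
  defines "e \<equiv> gF_frame M g F x"
  shows "ip2 e V (A_FnnF g (side M F) F (A_g g U) x) = - ip2 e (SF (g T x) F x V) (U (side M F) x)"
proof -
  note h = gF_frame_props[OF F T x, folded e_def]
  show ?thesis
    unfolding ip2_def A_FnnF_side[OF U F side[OF F] x, folded e_def] SF_def frameF_eq[OF F T x, folded e_def] onb_in[OF h(2)] tr2_def sum_2
    by (simp add: algebra_simps)
qed

lemma regular_facet: assumes T: "T \<in> facet_elems M F" shows "\<exists>\<gamma>. regular_param ref_tri F \<gamma>"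
proof -
  obtain N \<psi> a b c w where f: "facet_frame (m_chart M T) T N \<psi> g a b c w" "F = facet_frame.F (m_chart M T) a b c"
    by (rule facet_frame[OF T])
  show ?thesis using facet_frame.regular_facet[OF f(1)] f(2) by simp
qed

lemma int_F_cong:
  assumes "F \<in> int_facets M" "\<And>x. x \<in> F \<Longrightarrow> f x = f' x" shows "int_F M g F f = int_F M g F f'"
  unfolding int_F_def by (rule facet_int_cong[OF regular_facet[OF side[OF assms(1)]]]) (use assms(2) in auto)

lemma int_F_neg_cong: "F \<in> int_facets M \<Longrightarrow> (\<And>x. x \<in> F \<Longrightarrow> f x = - f' x) \<Longrightarrow> int_F M g F f = - int_F M g F f'"
  using int_F_cong[of F f "\<lambda>x. - 1 * f' x"] facet_int_cmul[of F "g (side M F)" "- 1" f'] by (simp add: int_F_def)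

lemma int_F_Rw:
  assumes U: "U \<in> Reg M" and F: "F \<in> int_facets M"
  shows "int_F M g F (\<lambda>x. ip2 (gF_frame M g F x) (jump M F (\<lambda>T. II g T F x)) (A_FnnF g (side M F) F (A_g g U) x))
      = - int_F M g F (\<lambda>x. ip2 (gF_frame M g F x) (jump M F (\<lambda>T. IIbar g T F x)) (U (side M F) x))"
  by (rule int_F_neg_cong[OF F]) (simp add: ip2_jump facet_adjoint[OF U F] IIbar_def sum_negf)

lemma int_F_a:
  assumes U: "U \<in> Reg M" and F: "F \<in> int_facets M"
  shows "int_F M g F (\<lambda>x. triple (gF_frame M g F x) (J x) (S x) (A_FnnF g (side M F) F (A_g g U) x))
      = - int_F M g F (\<lambda>x. triple (gF_frame M g F x) (J x) (S x) (SF (g (side M F) x) F x (U (side M F) x)))"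
proof (rule int_F_neg_cong[OF F])
  fix x assume x: "x \<in> F"
  note T = side[OF F]
  have "A_FnnF g (side M F) F (A_g g U) x (gF_frame M g F x i) (gF_frame M g F x j)
      = - SF (g (side M F) x) F x (U (side M F) x) (gF_frame M g F x i) (gF_frame M g F x j)" for i j
    unfolding A_FnnF_side[OF U F T x] SF_def frameF_eq[OF F T x] onb_in[OF gF_frame_props(2)[OF F T x]] by simp
  then show "triple (gF_frame M g F x) (J x) (S x) (A_FnnF g (side M F) F (A_g g U) x)
      = - triple (gF_frame M g F x) (J x) (S x) (SF (g (side M F) x) F x (U (side M F) x))"
    by (simp add: triple_def sum_negf)
qed

lemma nab2_sym:
  assumes s: "\<sigma> \<in> Reg M" and T: "T \<in> m_elems M" and x: "x \<in> T"
  shows "nab2 T (g T) (\<sigma> T) x X Y Z = nab2 T (g T) (\<sigma> T) x X Z Y"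
proof -
  interpret riem T "g T" by (rule riem[OF T])
  have "dD T (\<lambda>y. \<sigma> T y Y Z) x X = dD T (\<lambda>y. \<sigma> T y Z Y) x X"
    by (rule dD_same[OF RegD(2)[OF s T] RegD(3)[OF s T] x])
  then show ?thesis unfolding nab2_def
    using RegD(2)[OF s T x, of "\<Gamma> x X Y" Z] RegD(2)[OF s T x, of "\<Gamma> x X Z" Y] by simp
qed

text \<open>The jump is opened and each side treated alone. After \<open>facet_adjoint\<close>, the
  term with II gives its trace-reversed form, the covariant derivative of
  \<open>\<nu>\<lrcorner>\<sigma>\<close> stays under the trace reversal, and the other two terms
  form the tensor M of \<open>ip2_curl_facet\<close>, hence the curl term.\<close>

lemma int_F_b:
  assumes s: "\<sigma> \<in> Reg M" and U: "U \<in> Reg M" and F: "F \<in> int_facets M"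
  shows "int_F M g F (\<lambda>x. ip2 (gF_frame M g F x) (jump M F (\<lambda>T. B_nu g T F \<sigma> x)) (A_FnnF g (side M F) F (A_g g U) x))
      = int_F M g F (\<lambda>x. ip2 (gF_frame M g F x) (jump M F (\<lambda>T X Y.
                  tcross (g T x) (transp2 (curl T (g T) (\<sigma> T) x)) (nrm g T F x) X Y
                  - \<sigma> T x (nrm g T F x) (nrm g T F x) * IIbar g T F x X Y
                  - SF (g T x) F x (nab_nu g T F \<sigma> x) X Y)) (U (side M F) x))"
proof (rule int_F_cong[OF F], unfold ip2_jump, rule sum.cong[OF refl], goal_cases)
  case (1 x T)
  then have x: "x \<in> F" and T: "T \<in> facet_elems M F" by auto
  define e where "e = gF_frame M g F x"
  have Te: "T \<in> m_elems M" and xT: "x \<in> T" using facet_elemD[OF T] facet_sub[OF T] x by auto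
  have Se: "side M F \<in> m_elems M" "x \<in> side M F" using facet_elemD[OF side[OF F]] facet_sub[OF side[OF F]] x by auto
  interpret riem T "g T" by (rule riem[OF Te])
  interpret inner3 "g T x" by (rule inner[OF xT])
  note h = gF_frame_props[OF F T x, folded e_def]
  let ?n = "nrm g T F x" and ?U = "U (side M F) x" and ?D = "nab2 T (g T) (\<sigma> T) x"
  note tf = tensor_field[OF s Te]
  have c: "ip2 e (tcross (g T x) (transp2 (curl T (g T) (\<sigma> T) x)) ?n) ?U
      = - ip2 e (\<lambda>X Y. (?D X ?n Y - ?D ?n X Y) - tr2 e (\<lambda>X Y. ?D X ?n Y - ?D ?n X Y) * g T x X Y) ?U"
    by (rule ip2_curl_facet[OF h(2,3,4) RegD(2)[OF U Se] curl_eq(2,3)[OF tf xT] nab2_sym[OF s Te xT]])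
  have "ip2 e (B_nu g T F \<sigma> x) (A_FnnF g (side M F) F (A_g g U) x)
      = - ip2 e (SF (g T x) F x (B_nu g T F \<sigma> x)) ?U"
    unfolding e_def by (rule facet_adjoint[OF U F T x])
  also have "\<dots> = ip2 e (tcross (g T x) (transp2 (curl T (g T) (\<sigma> T) x)) ?n) ?U
      - \<sigma> T x ?n ?n * ip2 e (IIbar g T F x) ?U - ip2 e (SF (g T x) F x (nab_nu g T F \<sigma> x)) ?U"
    unfolding c
    unfolding ip2_def IIbar_def SF_def frameF_eq[OF F T x, folded e_def] onb_in[OF h(2)] B_nu_def Let_def tr2_def sum_2
    by (simp add: algebra_simps)
  also have "\<dots> = ip2 e (\<lambda>X Y. tcross (g T x) (transp2 (curl T (g T) (\<sigma> T) x)) ?n X Y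
                  - \<sigma> T x ?n ?n * IIbar g T F x X Y - SF (g T x) F x (nab_nu g T F \<sigma> x) X Y) ?U"
    unfolding ip2_def sum_2 by (simp add: algebra_simps)
  finally show ?case unfolding e_def .
qed

section \<open>Edge terms\<close>

lemma edge_facet:
  assumes E: "E \<in> int_edges M" and F: "F \<in> edge_facets M E"
  shows "F \<in> int_facets M" "E \<subseteq> F" "E \<in> edges M"
  using assms by (auto simp: int_edges_def edge_facets_def int_facets_def)

lemma facet_at:
  assumes E: "E \<in> int_edges M"
  shows "facet_at M E \<in> edge_facets M E"
proof -
  obtain T where T: "T \<in> m_elems M" "E \<in> faces M 1 T" using E by (auto simp: int_edges_def edges_def)
  then obtain V where V: "E = m_chart M T ` (convex hull V)" "V \<subseteq> ref_verts" "card V = 2" unfolding faces_def by auto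
  have "\<not> ref_verts \<subseteq> V" using V(3) finite_ref_verts card_mono[of V ref_verts] card.infinite[of V] by fastforce
  then obtain c where c: "c \<in> ref_verts" "c \<notin> V" by auto
  have "finite V" using V(3) card.infinite by fastforce
  then have "m_chart M T ` (convex hull (insert c V)) \<in> faces M 2 T"
    unfolding faces_def using V c by (intro CollectI exI[of _ "insert c V"]) auto
  moreover have "E \<subseteq> m_chart M T ` (convex hull (insert c V))"
    unfolding V(1) by (intro image_mono hull_mono) auto
  ultimately have "m_chart M T ` (convex hull (insert c V)) \<in> edge_facets M E"
    using T(1) unfolding edge_facets_def facets_def by blast
  then show ?thesis unfolding facet_at_def by (rule someI)
qed

lemma tangent_mono: "D \<subseteq> D' \<Longrightarrow> tangent_space D x \<subseteq> tangent_space D' x"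
  unfolding tangent_space_def tangent_cone_def by (rule span_mono) blast

text \<open>Any two elements around an interior edge are linked through facets containing it.\<close>

lemma edge_continuous:
  assumes s: "\<sigma> \<in> Reg M" and E: "E \<in> int_edges M" and T: "T \<in> m_elems M" "E \<subseteq> T" and T': "T' \<in> m_elems M" "E \<subseteq> T'"
    and x: "x \<in> E" and t: "t \<in> tangent_space E x"
  shows "\<sigma> T x t t = \<sigma> T' x t t"
proof -
  have "(T, T') \<in> {(T1, T2). T1 \<in> m_elems M \<and> T2 \<in> m_elems M \<and> (\<exists>F \<in> faces M 2 T1 \<inter> faces M 2 T2. E \<subseteq> F)}\<^sup>*"
    using triD(4)[OF E T(1) T'(1)] T(2) T'(2) by blast
  then show ?thesis
  proof (induction rule: rtrancl_induct)
    case (step T1 T2)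
    then obtain F where F: "F \<in> faces M 2 T1" "F \<in> faces M 2 T2" "E \<subseteq> F" "T1 \<in> m_elems M" "T2 \<in> m_elems M" by auto
    have "F \<in> int_facets M" using F E unfolding int_facets_def facets_def int_edges_def by blast
    moreover have "T1 \<in> facet_elems M F" "T2 \<in> facet_elems M F" using F by (auto simp: facet_elems_def)
    ultimately have "\<sigma> T1 x t t = \<sigma> T2 x t t"
      using tt_continuous[OF s] F(3) x t tangent_mono[OF F(3), of x] by blast
    then show ?case using step.IH by simp
  qed simp
qed

lemma A_mnnm_eq:
  assumes U: "U \<in> Reg M" and T: "T \<in> m_elems M" "x \<in> T"
  shows "A_mnnm g T F E (A_g g U) x
     = U T x (gcross (g T x) (nrm g T F x) (conrm g T F E x)) (gcross (g T x) (nrm g T F x) (conrm g T F E x))"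
proof -
  interpret inner3 "g T x" by (rule inner_g[OF T])
  show ?thesis
    unfolding A_mnnm_def A_g_def Aop_def gcross_antisym[of "conrm g T F E x" "nrm g T F x"]
    by (simp add: bilinear_simps[OF RegD(1)[OF U T]])
qed

text \<open>The left factor is formed with the normal and conormal of one facet, while the metric
  and U on the rest come from the reference element of the edge. Tested on a vector t tangent to E,
  everything reduces to values on (t, t), which \<open>edge_continuous\<close> carries from one
  element to the other.\<close>

lemma edge_tau:
  assumes U: "U \<in> Reg M" and E: "E \<in> int_edges M" and F: "F \<in> edge_facets M E" and x: "x \<in> E"
    and t: "t \<in> tangent_space E x"
  shows "A_mnnm g (side M F) F E (A_g g U) x * g (side_E M E) x t t = U (side_E M E) x t t"
proof -
  let ?T = "side M F" and ?S = "side_E M E"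
  note ef = edge_facet[OF E F]
  have T: "?T \<in> facet_elems M F" by (rule side[OF ef(1)])
  have Te: "?T \<in> m_elems M" "E \<subseteq> ?T" using facet_elemD[OF T] facet_sub[OF T] ef(2) by auto
  have S: "?S \<in> facet_elems M (facet_at M E)" unfolding side_E_def by (rule side[OF edge_facet(1)[OF E facet_at[OF E]]])
  have Se: "?S \<in> m_elems M" "E \<subseteq> ?S"
    using facet_elemD[OF S] facet_sub[OF S] edge_facet(2)[OF E facet_at[OF E]] by auto
  obtain N \<psi> a b c w where f: "facet_frame (m_chart M ?T) ?T N \<psi> g a b c w" "F = facet_frame.F (m_chart M ?T) a b c"
    "E = facet_frame.E (m_chart M ?T) a b"
    by (rule edge_frame[OF T ef(3,2)])
  have xT: "x \<in> ?T" using x Te by auto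
  have "A_mnnm g ?T F E (A_g g U) x * g ?T x t t = U ?T x t t"
    unfolding A_mnnm_eq[OF U Te(1) xT]
    by (rule facet_frame.tau[OF f(1), folded f(2,3), OF x t RegD(1)[OF U Te(1) xT]])
  then show ?thesis
    using edge_continuous[OF gReg E Te Se x t] edge_continuous[OF U E Te Se x t] by simp
qed

lemma side_E: assumes E: "E \<in> int_edges M"
  shows "side_E M E \<in> facet_elems M (facet_at M E)" "side_E M E \<in> m_elems M" "E \<subseteq> side_E M E"
proof -
  show S: "side_E M E \<in> facet_elems M (facet_at M E)"
    unfolding side_E_def by (rule side[OF edge_facet(1)[OF E facet_at[OF E]]])
  show "side_E M E \<in> m_elems M" "E \<subseteq> side_E M E"
    using facet_elemD[OF S] facet_sub[OF S] edge_facet(2)[OF E facet_at[OF E]] by auto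
qed

lemma frameE_props:
  assumes E: "E \<in> int_edges M" and x: "x \<in> E"
  shows "frameE (g (side_E M E) x) E x 1 \<in> tangent_space E x"
    "g (side_E M E) x (frameE (g (side_E M E) x) E x 1) (frameE (g (side_E M E) x) E x 1) = 1"
proof -
  note ef = edge_facet[OF E facet_at[OF E]]
  obtain N \<psi> a b c w where f: "facet_frame (m_chart M (side_E M E)) (side_E M E) N \<psi> g a b c w"
    "facet_at M E = facet_frame.F (m_chart M (side_E M E)) a b c"
    "E = facet_frame.E (m_chart M (side_E M E)) a b"
    by (rule edge_frame[OF side_E(1)[OF E] ef(3,2)])
  show "frameE (g (side_E M E) x) E x 1 \<in> tangent_space E x"
    "g (side_E M E) x (frameE (g (side_E M E) x) E x 1) (frameE (g (side_E M E) x) E x 1) = 1"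
    using facet_frame.frameE[OF f(1), of x, folded f(3)] x by auto
qed

lemma tau_comp_eq:
  assumes U: "U \<in> Reg M" and E: "E \<in> int_edges M" and x: "x \<in> E"
  shows "tau_comp M g U E x = A_mnnm g (side_E M E) (facet_at M E) E (A_g g U) x"
  unfolding tau_comp_def Let_def using A_mnnm_eq[OF U side_E(2)[OF E]] side_E(3)[OF E] x by auto

lemma tau_comp_facet:
  assumes U: "U \<in> Reg M" and E: "E \<in> int_edges M" and F: "F \<in> edge_facets M E" and x: "x \<in> E"
  shows "A_mnnm g (side M F) F E (A_g g U) x = tau_comp M g U E x"
  using edge_tau[OF U E F x frameE_props(1)[OF E x]] edge_tau[OF U E facet_at[OF E] x frameE_props(1)[OF E x]]
  unfolding frameE_props(2)[OF E x] tau_comp_eq[OF U E x] side_E_def[symmetric] by simp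

lemma tau_comp_trace:
  assumes s: "\<sigma> \<in> Reg M" and E: "E \<in> int_edges M" and x: "x \<in> E"
  shows "tr2 (frameE (g (side_E M E) x) E x) (\<sigma> (side_E M E) x) = tau_comp M g \<sigma> E x"
  using edge_tau[OF s E facet_at[OF E] x frameE_props(1)[OF E x]]
  unfolding frameE_props(2)[OF E x] tau_comp_eq[OF s E x] side_E_def[symmetric] by (simp add: tr2_def)

lemma regular_edge: assumes E: "E \<in> int_edges M" shows "\<exists>\<gamma> :: real \<Rightarrow> real^3. regular_param {0..1} E \<gamma>"
proof -
  note ef = edge_facet[OF E facet_at[OF E]]
  obtain N \<psi> a b c w where f: "facet_frame (m_chart M (side_E M E)) (side_E M E) N \<psi> g a b c w"
    "facet_at M E = facet_frame.F (m_chart M (side_E M E)) a b c"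
    "E = facet_frame.E (m_chart M (side_E M E)) a b"
    by (rule edge_frame[OF side_E(1)[OF E] ef(3,2)])
  show ?thesis using facet_frame.regular_edge[OF f(1)] f(3) by simp
qed

lemma int_E_cong:
  assumes "E \<in> int_edges M" "\<And>x. x \<in> E \<Longrightarrow> f x = f' x" shows "int_E M g E f = int_E M g E f'"
  unfolding int_E_def by (rule edge_int_cong[OF regular_edge[OF assms(1)]]) (rule assms(2))

lemma int_E_Theta:
  assumes U: "U \<in> Reg M" and E: "E \<in> int_edges M"
  shows "int_E M g E (\<lambda>x. Theta M g E x * A_mnnm g (side_E M E) (facet_at M E) E (A_g g U) x)
     = int_E M g E (\<lambda>x. Theta M g E x * tau_comp M g U E x)"
  by (rule int_E_cong[OF E]) (simp add: tau_comp_eq[OF U E])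

lemma int_E_a:
  assumes s: "\<sigma> \<in> Reg M" and U: "U \<in> Reg M" and E: "E \<in> int_edges M"
  shows "int_E M g E (\<lambda>x. tr2 (frameE (g (side_E M E) x) E x) (\<sigma> (side_E M E) x) * Theta M g E x *
          A_mnnm g (side_E M E) (facet_at M E) E (A_g g U) x)
     = int_E M g E (\<lambda>x. Theta M g E x * tau_comp M g \<sigma> E x * tau_comp M g U E x)"
  by (rule int_E_cong[OF E]) (simp add: tau_comp_eq[OF U E] tau_comp_trace[OF s E])

lemma int_E_b:
  assumes U: "U \<in> Reg M" and E: "E \<in> int_edges M"
  shows "int_E M g E (\<lambda>x. \<Sum>F\<in>edge_facets M E. edge_jump M g \<sigma> F E x * A_mnnm g (side M F) F E (A_g g U) x)
     = int_E M g E (\<lambda>x. \<Sum>F\<in>edge_facets M E. edge_jump M g \<sigma> F E x * tau_comp M g U E x)"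
  by (rule int_E_cong[OF E]) (simp add: tau_comp_facet[OF U E])

section \<open>From element boundaries to jumps over facets\<close>

lemma finite_facets: "finite (facets M)"
proof -
  have "finite (faces M 2 T)" for T
  proof -
    have "faces M 2 T \<subseteq> (\<lambda>V. m_chart M T ` (convex hull V)) ` Pow ref_verts" unfolding faces_def by auto
    then show ?thesis using finite_ref_verts(1) finite_subset by blast
  qed
  then show ?thesis unfolding facets_def using finite_elems by blast
qed

lemma facet_integrand_continuous:
  assumes s: "\<sigma> \<in> Reg M" and U: "U \<in> Reg M" and TF: "T \<in> facet_elems M F"
  shows "continuous_on F (flux \<sigma> U T F)"
proof -
  obtain N \<psi> a b c w where f: "facet_frame (m_chart M T) T N \<psi> g a b c w" "F = facet_frame.F (m_chart M T) a b c"
    by (rule facet_frame[OF TF])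
  interpret facet_frame "m_chart M T" T N \<psi> g a b c w by (rule f(1))
  note tf = tensor_field[OF s facet_elemD(1)[OF TF]] tensor_field[OF U facet_elemD(1)[OF TF]]
  show ?thesis
    unfolding f(2) by (rule continuous_on_eq[OF continuous_integrand[OF tf]]) (rule integrand_eq[of \<sigma> U, OF tf, symmetric])
qed

lemma facet_metric_continuous:
  assumes T: "T \<in> facet_elems M F"
  shows "x \<in> F \<Longrightarrow> bilinear (g T x)" "continuous_on F (\<lambda>x. g T x X Y)"
proof -
  show "x \<in> F \<Longrightarrow> bilinear (g T x)" using RegD(1)[OF gReg facet_elemD(1)[OF T]] facet_sub[OF T] by auto
  show "continuous_on F (\<lambda>x. g T x X Y)"
    by (rule smooth_upto_continuous_on[OF smooth_upto_subset[OF RegD(3)[OF gReg facet_elemD(1)[OF T]] facet_sub[OF T]]])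
qed

text \<open>Three changes of viewpoint: A is replaced by its version seen from T, the finite sum is
  taken out of the integral, and the area element of the reference side is replaced by that of
  T.\<close>

lemma int_F_jump:
  assumes s: "\<sigma> \<in> Reg M" and U: "U \<in> Reg M" and F: "F \<in> int_facets M"
  shows "int_F M g F (\<lambda>x. ip2 (gF_frame M g F x) (jump M F (\<lambda>T. B_nu g T F \<sigma> x)) (A_FnnF g (side M F) F (A_g g U) x))
     = (\<Sum>T\<in>facet_elems M F. facet_int F (g T) (flux \<sigma> U T F))"
proof -
  note S = side[OF F]
  have "int_F M g F (\<lambda>x. ip2 (gF_frame M g F x) (jump M F (\<lambda>T. B_nu g T F \<sigma> x)) (A_FnnF g (side M F) F (A_g g U) x))
     = int_F M g F (\<lambda>x. \<Sum>T\<in>facet_elems M F. flux \<sigma> U T F x)"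
  proof (rule int_F_cong[OF F])
    fix x assume x: "x \<in> F"
    show "ip2 (gF_frame M g F x) (jump M F (\<lambda>T. B_nu g T F \<sigma> x)) (A_FnnF g (side M F) F (A_g g U) x)
      = (\<Sum>T\<in>facet_elems M F. flux \<sigma> U T F x)"
      unfolding ip2_jump
    proof (rule sum.cong[OF refl])
      fix T assume T: "T \<in> facet_elems M F"
      show "ip2 (gF_frame M g F x) (B_nu g T F \<sigma> x) (A_FnnF g (side M F) F (A_g g U) x)
         = flux \<sigma> U T F x"
        unfolding frameF_eq[OF F T x]
        by (rule ip2_cong[OF refl]) (simp add: A_FnnF_side[OF U F S x] A_FnnF_side[OF U F T x])
    qed
  qed
  also have "\<dots> = (\<Sum>T\<in>facet_elems M F. facet_int F (g (side M F)) (flux \<sigma> U T F))"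
    unfolding int_F_def
    by (rule facet_int_sum[OF regular_facet[OF S] facet_integrand_continuous[OF s U] facet_metric_continuous[OF S]])
  also have "\<dots> = (\<Sum>T\<in>facet_elems M F. facet_int F (g T) (flux \<sigma> U T F))"
    by (intro sum.cong refl facet_int_cong[OF regular_facet[OF S]] tt_continuous[OF gReg F S])
  finally show ?thesis .
qed

text \<open>The element boundaries in \<open>Inc_dist\<close> include facets on the domain boundary,
  which \<open>b_form\<close> lacks. Their contribution vanishes because U has zero tangential
  values there, and these determine the facet components of A.\<close>

lemma boundary_facet:
  assumes U: "U \<in> Reg0 M" and F: "F \<in> bd_facets M" and T: "T \<in> facet_elems M F"
  shows "facet_int F (g T) (flux \<sigma> U T F) = 0"
proof -
  have U': "U \<in> Reg M" using U by (simp add: Reg0_def)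
  \<comment> \<open>The zero integrand is written as a product so that \<open>facet_int_cmul\<close>
    evaluates its integral.\<close>
  have "facet_int F (g T) (flux \<sigma> U T F) = facet_int F (g T) (\<lambda>x. 0 * 0)"
  proof (rule facet_int_cong[OF regular_facet[OF T]])
    fix x assume x: "x \<in> F"
    have "U T x (frameF (g T x) F x i) (frameF (g T x) F x j) = 0" for i j
      by (rule tt_boundary[OF U F T x frameF_props(1,1)[OF T x]])
    moreover from this have "tr2 (frameF (g T x) F x) (U T x) = 0" by (simp add: tr2_def)
    ultimately show "flux \<sigma> U T F x = 0 * 0"
      unfolding ip2_def A_FnnF_frame[OF U' T x] by (simp cong: if_cong)
  qed simp
  then show ?thesis unfolding facet_int_cmul by simp
qed

lemma edge_integrand_continuous:
  assumes s: "\<sigma> \<in> Reg M" and U: "U \<in> Reg M" and E: "E \<in> int_edges M" and F: "F \<in> edge_facets M E"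
  shows "continuous_on E (\<lambda>x. edge_jump M g \<sigma> F E x * A_mnnm g (side M F) F E (A_g g U) x)"
proof -
  note ef = edge_facet[OF E F]
  have c: "continuous_on E (\<lambda>x. \<sigma> T x (nrm g T F x) (conrm g T F E x))"
    "continuous_on E (\<lambda>x. A_mnnm g T F E (A_g g U) x)" if T: "T \<in> facet_elems M F" for T
  proof -
    obtain N \<psi> a b c w where f: "facet_frame (m_chart M T) T N \<psi> g a b c w" "F = facet_frame.F (m_chart M T) a b c"
      "E = facet_frame.E (m_chart M T) a b"
      by (rule edge_frame[OF T ef(3,2)])
    show "continuous_on E (\<lambda>x. \<sigma> T x (nrm g T F x) (conrm g T F E x))"
      using facet_frame.continuous_edge_jump[OF f(1), of \<sigma>, folded f(2,3)] tensor_field[OF s facet_elemD(1)[OF T]] by blast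
    show "continuous_on E (\<lambda>x. A_mnnm g T F E (A_g g U) x)"
      using facet_frame.continuous_A_mnnm[OF f(1), of U, folded f(2,3)] tensor_field[OF U facet_elemD(1)[OF T]] by blast
  qed
  show ?thesis unfolding edge_jump_def by (intro continuous_intros c side[OF ef(1)])
qed

text \<open>The element terms agree up to the factor -2 by the identity for \<open>Inc\<close>. For
  the facets, the double sum over elements and their facets is reordered by facet, boundary facets
  drop out, and the rest regroups into jumps. On edges the two sides differ only in whether the sum
  over facets stands inside the integral, and the sign parameter is carried along unchanged.\<close>

lemma b_form_inc_dist:
  assumes s: "\<sigma> \<in> Reg M" and U0: "U \<in> Reg0 M"
  shows "b_form \<epsilon> M g \<sigma> U = - 2 * inc_dist \<epsilon> M g \<sigma> U"
proof -
  have U: "U \<in> Reg M" using U0 by (simp add: Reg0_def)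
  define f where "f T F = facet_int F (g T) (flux \<sigma> U T F)" for T F
  have 2: "int_E M g E (\<lambda>x. \<Sum>F\<in>edge_facets M E. edge_jump M g \<sigma> F E x * A_mnnm g (side M F) F E (A_g g U) x)
     = (\<Sum>F\<in>edge_facets M E. int_E M g E (\<lambda>x. edge_jump M g \<sigma> F E x * A_mnnm g (side M F) F E (A_g g U) x))"
    if E: "E \<in> int_edges M" for E
    unfolding int_E_def
  proof (rule edge_int_sum[OF regular_edge[OF E] edge_integrand_continuous[OF s U E]])
    show "bilinear (g (side_E M E) x)" if "x \<in> E" for x
      using RegD(1)[OF gReg side_E(2)[OF E]] side_E(3)[OF E] that by auto
    show "continuous_on E (\<lambda>x. g (side_E M E) x X Y)" for X Y
      by (rule smooth_upto_continuous_on[OF smooth_upto_subset[OF RegD(3)[OF gReg side_E(2)[OF E]] side_E(3)[OF E]]])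
  qed
  have "(\<Sum>T\<in>m_elems M. \<Sum>F\<in>faces M 2 T. f T F) = (\<Sum>T\<in>m_elems M. \<Sum>F | F \<in> facets M \<and> F \<in> faces M 2 T. f T F)"
    by (intro sum.cong refl) (auto simp: facets_def)
  also have "\<dots> = (\<Sum>F\<in>facets M. \<Sum>T | T \<in> m_elems M \<and> F \<in> faces M 2 T. f T F)"
    by (rule sum.swap_restrict[OF finite_elems finite_facets])
  also have "\<dots> = (\<Sum>F\<in>facets M. \<Sum>T\<in>facet_elems M F. f T F)"
    by (simp add: facet_elems_def)
  also have "\<dots> = (\<Sum>F\<in>int_facets M. \<Sum>T\<in>facet_elems M F. f T F)"
  proof (rule sum.mono_neutral_right[OF finite_facets])
    show "int_facets M \<subseteq> facets M" by (auto simp: int_facets_def)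
    show "\<forall>F\<in>facets M - int_facets M. (\<Sum>T\<in>facet_elems M F. f T F) = 0"
    proof
      fix F assume "F \<in> facets M - int_facets M"
      then have "F \<in> bd_facets M" by (auto simp: int_facets_def bd_facets_def)
      then show "(\<Sum>T\<in>facet_elems M F. f T F) = 0" using boundary_facet[OF U0] by (simp add: f_def)
    qed
  qed
  also have "\<dots> = (\<Sum>F\<in>int_facets M. int_F M g F (\<lambda>x. ip2 (gF_frame M g F x) (jump M F (\<lambda>T. B_nu g T F \<sigma> x)) (A_FnnF g (side M F) F (A_g g U) x)))"
    by (simp add: int_F_jump[OF s U] f_def)
  finally have 3: "(\<Sum>T\<in>m_elems M. \<Sum>F\<in>faces M 2 T. f T F) = \<dots>" .
  show ?thesis
    unfolding b_form_def inc_dist_def Inc_dist_def Let_def f_def[symmetric]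
    by (simp add: elem_int_Inc[OF U] 2 3 sum_subtractf sum_negf)
qed

end

theorem proposition6p5:
  fixes M :: mesh and g :: pw2
  assumes "triangulated_domain M"
    and "g \<in> Reg_plus M"
  shows "(\<forall>U\<in>Reg0 M.
      1/4 * Rw_dist M g (A_g g U) =
          (\<Sum>T\<in>m_elems M. elem_int T (g T) (\<lambda>x.
             ip2 (frameT (g T x)) (Q_curv T (g T) x) (U T x)))
        - (\<Sum>F\<in>int_facets M. int_F M g F (\<lambda>x.
             ip2 (gF_frame M g F x) (jump M F (\<lambda>T. IIbar g T F x)) (U (side M F) x)))
        + (\<Sum>E\<in>int_edges M. int_E M g E (\<lambda>x. Theta M g E x * tau_comp M g U E x)))
    \<and> (\<forall>\<sigma>\<in>Reg M. \<forall>U\<in>Reg0 M.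
      a_form M g \<sigma> U =
        - 2 * (\<Sum>T\<in>m_elems M. elem_int T (g T) (\<lambda>x.
             triple (frameT (g T x)) (Q_curv T (g T) x) (\<sigma> T x) (U T x)))
        - 2 * (\<Sum>F\<in>int_facets M. int_F M g F (\<lambda>x.
             triple (gF_frame M g F x) (jump M F (\<lambda>T. II g T F x))
               (SF (g (side M F) x) F x (\<sigma> (side M F) x))
               (SF (g (side M F) x) F x (U (side M F) x))))
        - 2 * (\<Sum>E\<in>int_edges M. int_E M g E (\<lambda>x.
             Theta M g E x * tau_comp M g \<sigma> E x * tau_comp M g U E x)))
    \<and> (\<forall>\<sigma>\<in>Reg M. \<forall>U\<in>Reg0 M. \<forall>\<epsilon>\<in>{-1, 1}.
      b_form \<epsilon> M g \<sigma> U =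
        - 2 * (\<Sum>T\<in>m_elems M. elem_int T (g T) (\<lambda>x.
             ip2 (frameT (g T x)) (inc T (g T) (\<sigma> T) x) (U T x)))
        + 2 * (\<Sum>F\<in>int_facets M. int_F M g F (\<lambda>x.
             ip2 (gF_frame M g F x)
               (jump M F (\<lambda>T X Y.
                  tcross (g T x) (transp2 (curl T (g T) (\<sigma> T) x)) (nrm g T F x) X Y
                  - \<sigma> T x (nrm g T F x) (nrm g T F x) * IIbar g T F x X Y
                  - SF (g T x) F x (nab_nu g T F \<sigma> x) X Y))
               (U (side M F) x)))
        + \<epsilon> * 2 * (\<Sum>E\<in>int_edges M. int_E M g E (\<lambda>x.
             \<Sum>F\<in>edge_facets M E. edge_jump M g \<sigma> F E x * tau_comp M g U E x)))
    \<and> (\<forall>\<sigma>\<in>Reg M. \<forall>U\<in>Reg0 M. \<forall>\<epsilon>\<in>{-1, 1}.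
      b_form \<epsilon> M g \<sigma> U = - 2 * inc_dist \<epsilon> M g \<sigma> U)"
proof -
  interpret regge M g using assms by (rule regge.intro)
  have U: "U \<in> Reg M" if "U \<in> Reg0 M" for U using that by (simp add: Reg0_def)
  note sums = sum_negf sum_distrib_left[symmetric]
  show ?thesis
  proof (intro conjI ballI, goal_cases)
    case (1 U)
    show ?case
      by (simp only: Rw_dist_def elem_int_Rw[OF U[OF 1]] int_F_Rw[OF U[OF 1]] int_E_Theta[OF U[OF 1]] sums cong: sum.cong) simp
  next
    case (2 \<sigma> U)
    show ?case
      by (simp only: a_form_def Let_def elem_int_a[OF 2(1) U[OF 2(2)]] int_F_a[OF U[OF 2(2)]] int_E_a[OF 2(1) U[OF 2(2)]]
        sums cong: sum.cong)
  next
    case (3 \<sigma> U \<epsilon>)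
    show ?case
      by (simp only: b_form_def Let_def elem_int_b[OF 3(1) U[OF 3(2)]] int_F_b[OF 3(1) U[OF 3(2)]] int_E_b[OF U[OF 3(2)]]
        sums cong: sum.cong)
  next
    case (4 \<sigma> U \<epsilon>)
    show ?case by (rule b_form_inc_dist[OF 4(1,2)])
  qed
qed

end
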